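(* (Convergence for $d=3$.) Let $\{I^k_{i,j,l,m,n}\}$ be defined by the three-dimensional upwind scheme (S3) described in the context. Suppose that the discretization parameters satisfy $$\frac{c^+\Delta t}{\Delta x_1}+\frac{c^+\Delta t}{\Delta x_2}+\frac{c^+\Delta t}{\Delta x_3}\le1$$ and $$\Delta\theta^2\,\sup\left|\frac{\partial^2}{\partial\theta^2}\Bigl[p\bigl(x;\xi,\xi'(\theta,\phi)\bigr)\sin\theta\Bigr]\right|+\frac{\Delta\phi^2}{2}\,\sup\left|\frac{\partial^2}{\partial\phi^2}\Bigl[p\bigl(x;\xi,\xi'(\theta,\phi)\bigr)\sin\theta\Bigr]\right|\le\frac{6}{\pi^2}\mu^*,$$ where $\xi'(\theta,\phi)=(\sin\theta\cos\phi,\sin\theta\sin\phi,\cos\theta)$ and the suprema are taken over $(x,\xi)\in X$, $0\le\theta\le\pi$, $0\le\phi\le2\pi$. Suppose besides that: (i) the mesh ratios $\Delta t/\Delta x_i$ $(i=1,2,3)$ are kept fixed; (ii) the coefficients $\mu_{\rm a}$ and $\mu_{\rm s}$ are bounded; (iii) the solution $I$ of the initial-boundary value problem (P3) described in the context belongs to $C^2\bigl([0,T)\times(X\cup\Gamma_-)\bigr)$ and is bounded together with its derivatives of the first and the second order. Then $$\|I(t_k,\cdot,\cdot)-I^k\|_\infty\le C(\Delta t+\Delta\theta^2+\Delta\phi^2),\qquad 0\le k\le T/\Delta t,$$ where $C$ is a positive number independent of $\Delta t$, $\Delta\theta$ and $\Delta\phi$, and $\|I(t_k,\cdot,\cdot)-I^k\|_\infty:=\sup\{|I(t_k,x_{ijl},\xi_{mn})-I^k_{i,j,l,m,n}|:\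 (x_{ijl},\xi_{mn})\in X\cup\Gamma_-\}$.
   Context: Domain and data. Let $T>0$, $\Omega=(0,L_1)\times(0,L_2)\times(0,L_3)\subset\mathbb{R}^3$, $X=\Omega\times S^2$, and $\Gamma_-=\{(x,\xi)\in\partial\Omega\times S^2:\ n(x)\cdot\xi<0\}$, where $n(x)$ is the outward unit normal at $x\in\partial\Omega$ (undefined on the edges and corners of the box, which are not part of $\Gamma_-$ and do not enter the scheme). The functions $c,\mu_{\rm a},\mu_{\rm s}$ on $\Omega$ are measurable with $c(x)>0$, $\mu_{\rm a}(x)\ge0$, $\mu_{\rm s}(x)\ge0$, $\mu_{\rm s}\not\equiv0$, and $$c^+:=\sup_{x\in\Omega}c(x)<\infty,\qquad \mu^*:=\inf_{\{x:\ \mu_{\rm s}(x)\ne0\}}\frac{\mu_{\rm a}(x)}{\mu_{\rm s}(x)}>0.$$ The scattering kernel is $p(x;\xi,\xi')=\tilde p(x;\alpha)$, where $\alpha$ is the angle formed by $\xi,\xi'\in S^2$, and $\tilde p(x;\alpha)\ge0$ is, for each $x\in\Omega$, $2\pi$-periodic, even and of class $C^2$ in $\alpha$, with $2\pi\int_0^{\pi}\tilde p(x;\alpha)\sin\alpha\,d\alpha=1$ (equivalently $\int_{S^2}p(x;\xi,\xi')\,d\omega_{\xi'}=1$ for all $x\in\Omega$, $\xi\in S^2$, with $d\omega$ the surface element) and $\sup_{(x,\alpha)\in\Omega\times[0,2\pi]}|\partial^2\tilde p/\partial\alpha^2(x;\alpha)|<\infty$. The inputs $q(t,x,\xi)$ (for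 $(x,\xi)\in X$), $I_0(x,\xi)$ (for $(x,\xi)\in X$) and $I_1(t,x,\xi)$ (for $(x,\xi)\in\Gamma_-$) are real bounded measurable functions. Problem (P3). $$\frac{1}{c(x)}\frac{\partial I}{\partial t}=-\xi\cdot\nabla_xI-\{\mu_{\rm a}(x)+\mu_{\rm s}(x)\}I+\mu_{\rm s}(x)\int_{S^2}p(x;\xi,\xi')I(t,x,\xi')\,d\omega_{\xi'}+q(t,x,\xi),\quad 0<t<T,\ (x,\xi)\in X,$$ $$I(0,x,\xi)=I_0(x,\xi),\ (x,\xi)\in X;\qquad I(t,x,\xi)=I_1(t,x,\xi),\ 0<t<T,\ (x,\xi)\in\Gamma_-.$$ The equation and the boundary condition are understood to hold also at the endpoint times at which the scheme evaluates $q$ and $I_1$ ($t=0$, and $t=T$ for $I_1$ if $T/\Delta t$ is an integer), with $I(T,\cdot,\cdot)$ being the continuous extension in $t$ of $I$. Grid. For positive integers $M_1,M_2,M_3,M_\theta,M_\phi$ and $\Delta t>0$ put $\Delta x_i=L_i/M_i$ $(i=1,2,3)$, $\Delta\theta=\pi/M_\theta$, $\Delta\phi=2\pi/M_\phi$, $t_k=k\Delta t$, $x_{ijl}=(i\Delta x_1,j\Delta x_2,l\Delta x_3)$, $\theta_m=m\Delta\theta$, $\phi_n=n\Delta\phi$, $\xi_{mn}=(\xi_{mn,1},\xi_{mn,2},\xi_{mn,3})=(\sin\theta_m\cos\phi_n,\sin\theta_m\sin\phi_n,\cos\theta_m)$ for integers $k,i,j,l,m,n$. Scheme (S3). The numbers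 $I^k_{i,j,l,m,n}$ are determined by $$\frac{1}{c(x_{ijl})}\frac{I^{k+1}_{i,j,l,m,n}-I^k_{i,j,l,m,n}}{\Delta t}=A_\Delta I^k_{i,j,l,m,n}-\Sigma_\Delta I^{k+1}_{i,j,l,m,n}+K_\Delta I^k_{i,j,l,m,n}+q(t_k,x_{ijl},\xi_{mn}),\quad 0\le k\le T/\Delta t-1,\ (x_{ijl},\xi_{mn})\in X,$$ $$I^0_{i,j,l,m,n}=I_0(x_{ijl},\xi_{mn}),\ (x_{ijl},\xi_{mn})\in X;\qquad I^k_{i,j,l,m,n}=I_1(t_k,x_{ijl},\xi_{mn}),\ 0\le k\le T/\Delta t,\ (x_{ijl},\xi_{mn})\in\Gamma_-,$$ where $$\begin{aligned}A_\Delta I^k_{i,j,l,m,n}={}&-\xi_{mn,1}\frac{I^k_{i+1,j,l,m,n}-I^k_{i-1,j,l,m,n}}{2\Delta x_1}+|\xi_{mn,1}|\frac{I^k_{i+1,j,l,m,n}-2I^k_{i,j,l,m,n}+I^k_{i-1,j,l,m,n}}{2\Delta x_1}\\&-\xi_{mn,2}\frac{I^k_{i,j+1,l,m,n}-I^k_{i,j-1,l,m,n}}{2\Delta x_2}+|\xi_{mn,2}|\frac{I^k_{i,j+1,l,m,n}-2I^k_{i,j,l,m,n}+I^k_{i,j-1,l,m,n}}{2\Delta x_2}\\&-\xi_{mn,3}\frac{I^k_{i,j,l+1,m,n}-I^k_{i,j,l-1,m,n}}{2\Delta x_3}+|\xi_{mn,3}|\frac{I^k_{i,j,l+1,m,n}-2I^k_{i,j,l,m,n}+I^k_{i,j,l-1,m,n}}{2\Delta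 x_3},\end{aligned}$$ $$\Sigma_\Delta I^k_{i,j,l,m,n}=\{\mu_{\rm s}(x_{ijl})+\mu_{\rm a}(x_{ijl})\}I^k_{i,j,l,m,n},$$ $$K_\Delta I^k_{i,j,l,m,n}=\mu_{\rm s}(x_{ijl})\Delta\theta\Delta\phi\sum_{\mu=1}^{M_\theta-1}\sum_{\nu=0}^{M_\phi-1}p(x_{ijl};\xi_{mn},\xi_{\mu\nu})\sin\theta_\mu\,I^k_{i,j,l,\mu,\nu}.$$ In $A_\Delta$, values at grid points outside $X\cup\Gamma_-$ occur only with total coefficient $0$ and are disregarded. *)

theory Defs
  imports "HOL-Analysis.Analysis"
begin

section \<open>Phase space\<close>

text \<open>\<^term>\<open>L\<close> is the vector of edge lengths; the spatial domain is the open box \<^term>\<open>box 0 L\<close>.\<close>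

abbreviation S2 :: "(real^3) set" where
  "S2 \<equiv> sphere 0 1"

definition phase_space :: "real^3 \<Rightarrow> ((real^3) \<times> (real^3)) set" where
  "phase_space L = box 0 L \<times> S2"

text \<open>The outward unit normal exists only on the relatively open faces of the box, so it is a
  relation; edges and corners have no normal.\<close>

definition outward_normal :: "real^3 \<Rightarrow> real^3 \<Rightarrow> real^3 \<Rightarrow> bool" where
  "outward_normal L x n \<longleftrightarrow>
     (\<exists>i. (\<forall>j. j \<noteq> i \<longrightarrow> 0 < x $ j \<and> x $ j < L $ j) \<and>
          (x $ i = 0 \<and> n = - axis i 1 \<or> x $ i = L $ i \<and> n = axis i 1))"

definition inflow :: "real^3 \<Rightarrow> ((real^3) \<times> (real^3)) set" where
  "inflow L = {(x, \<xi>). \<xi> \<in> S2 \<and> (\<exists>n. outward_normal L x n \<and> n \<bullet> \<xi> < 0)}"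

definition sph_dir :: "real \<Rightarrow> real \<Rightarrow> real^3" where
  "sph_dir \<theta> \<phi> = vector [sin \<theta> * cos \<phi>, sin \<theta> * sin \<phi>, cos \<theta>]"

text \<open>Surface measure: image of \<open>sin \<theta> d\<theta> d\<phi>\<close> under spherical coordinates. Its underlying space
  is the sphere itself, so values of integrands off the sphere are irrelevant.\<close>

definition sphere_measure :: "(real^3) measure" where
  "sphere_measure =
     distr (density lborel
              (\<lambda>(\<theta>, \<phi>). ennreal (sin \<theta> * indicator ({0..pi} \<times> {0..2*pi}) (\<theta>, \<phi>))))
           (restrict_space borel S2) (\<lambda>(\<theta>, \<phi>). sph_dir \<theta> \<phi>)"


section \<open>Data\<close>

definition c_plus :: "real^3 \<Rightarrow> (real^3 \<Rightarrow> real) \<Rightarrow> real" where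
  "c_plus L c = (SUP x\<in>box 0 L. c x)"

definition mu_star :: "real^3 \<Rightarrow> (real^3 \<Rightarrow> real) \<Rightarrow> (real^3 \<Rightarrow> real) \<Rightarrow> real" where
  "mu_star L \<mu>a \<mu>s = (INF x\<in>{x \<in> box 0 L. \<mu>s x \<noteq> 0}. \<mu>a x / \<mu>s x)"

definition coefficients ::
  "real^3 \<Rightarrow> (real^3 \<Rightarrow> real) \<Rightarrow> (real^3 \<Rightarrow> real) \<Rightarrow> (real^3 \<Rightarrow> real) \<Rightarrow> bool" where
  "coefficients L c \<mu>a \<mu>s \<longleftrightarrow>
     c \<in> borel_measurable (lebesgue_on (box 0 L)) \<and>
     \<mu>a \<in> borel_measurable (lebesgue_on (box 0 L)) \<and>
     \<mu>s \<in> borel_measurable (lebesgue_on (box 0 L)) \<and>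
     (\<forall>x\<in>box 0 L. c x > 0 \<and> \<mu>a x \<ge> 0 \<and> \<mu>s x \<ge> 0) \<and>
     (\<exists>x\<in>box 0 L. \<mu>s x \<noteq> 0) \<and>
     bdd_above (c ` box 0 L) \<and>
     mu_star L \<mu>a \<mu>s > 0"

definition C2_real :: "(real \<Rightarrow> real) \<Rightarrow> bool" where
  "C2_real f \<longleftrightarrow>
     (\<forall>a. f field_differentiable at a) \<and>
     (\<forall>a. deriv f field_differentiable at a) \<and>
     continuous_on UNIV (deriv (deriv f))"

definition phase_function :: "real^3 \<Rightarrow> (real^3 \<Rightarrow> real \<Rightarrow> real) \<Rightarrow> bool" where
  "phase_function L pt \<longleftrightarrow>
     (\<forall>x\<in>box 0 L.
        (\<forall>\<alpha>. pt x \<alpha> \<ge> 0 \<and> pt x (\<alpha> + 2*pi) = pt x \<alpha> \<and> pt x (-\<alpha>) = pt x \<alpha>) \<and>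
        C2_real (pt x) \<and>
        2 * pi * integral {0..pi} (\<lambda>\<alpha>. pt x \<alpha> * sin \<alpha>) = 1) \<and>
     bdd_above ((\<lambda>(x, \<alpha>). \<bar>deriv (deriv (pt x)) \<alpha>\<bar>) ` (box 0 L \<times> {0..2*pi}))"

text \<open>For unit vectors, \<open>arccos (\<xi> \<bullet> \<xi>')\<close> is the angle they form.\<close>

definition kernel :: "(real^3 \<Rightarrow> real \<Rightarrow> real) \<Rightarrow> real^3 \<Rightarrow> real^3 \<Rightarrow> real^3 \<Rightarrow> real" where
  "kernel pt x \<xi> \<xi>' = pt x (arccos (\<xi> \<bullet> \<xi>'))"

text \<open>Measurability of \<^term>\<open>q\<close> and \<^term>\<open>I0\<close> is with respect to the completed product of
  Lebesgue and surface measure. For \<^term>\<open>I1\<close> the Borel sets are used; this is no restriction for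
  a boundary value attained by a continuous solution. The time ranges are those in which the
  scheme evaluates the inputs.\<close>

definition inputs ::
  "real^3 \<Rightarrow> real \<Rightarrow> (real \<Rightarrow> real^3 \<Rightarrow> real^3 \<Rightarrow> real) \<Rightarrow> (real^3 \<Rightarrow> real^3 \<Rightarrow> real) \<Rightarrow>
   (real \<Rightarrow> real^3 \<Rightarrow> real^3 \<Rightarrow> real) \<Rightarrow> bool" where
  "inputs L T q I0 I1 \<longleftrightarrow>
     (\<lambda>(t, x, \<xi>). q t x \<xi>) \<in> borel_measurable
        (restrict_space (completion (lborel \<Otimes>\<^sub>M (lborel \<Otimes>\<^sub>M sphere_measure))) ({0..<T} \<times> phase_space L)) \<and>
     bounded ((\<lambda>(t, x, \<xi>). q t x \<xi>) ` ({0..<T} \<times> phase_space L)) \<and>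
     (\<lambda>(x, \<xi>). I0 x \<xi>) \<in> borel_measurable
        (restrict_space (completion (lborel \<Otimes>\<^sub>M sphere_measure)) (phase_space L)) \<and>
     bounded ((\<lambda>(x, \<xi>). I0 x \<xi>) ` phase_space L) \<and>
     (\<lambda>(t, x, \<xi>). I1 t x \<xi>) \<in> borel_measurable (restrict_space borel ({0..<T} \<times> inflow L)) \<and>
     bounded ((\<lambda>(t, x, \<xi>). I1 t x \<xi>) ` ({0..T} \<times> inflow L))"


section \<open>The initial-boundary value problem\<close>

text \<open>The equation and the boundary condition include the initial time, where the time derivative
  is one-sided. The value at time \<^term>\<open>T\<close> is the continuous extension in time.\<close>

definition solves_P3 ::
  "real^3 \<Rightarrow> real \<Rightarrow> (real^3 \<Rightarrow> real) \<Rightarrow> (real^3 \<Rightarrow> real) \<Rightarrow> (real^3 \<Rightarrow> real) \<Rightarrow>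
   (real^3 \<Rightarrow> real \<Rightarrow> real) \<Rightarrow> (real \<Rightarrow> real^3 \<Rightarrow> real^3 \<Rightarrow> real) \<Rightarrow> (real^3 \<Rightarrow> real^3 \<Rightarrow> real) \<Rightarrow>
   (real \<Rightarrow> real^3 \<Rightarrow> real^3 \<Rightarrow> real) \<Rightarrow> (real \<Rightarrow> real^3 \<Rightarrow> real^3 \<Rightarrow> real) \<Rightarrow> bool" where
  "solves_P3 L T c \<mu>a \<mu>s pt q I0 I1 I \<longleftrightarrow>
     (\<forall>t\<in>{0..<T}. \<forall>(x, \<xi>)\<in>phase_space L. \<exists>I_t grad_I.
        ((\<lambda>s. I s x \<xi>) has_real_derivative I_t) (at t within {0..<T}) \<and>
        (GDERIV (\<lambda>y. I t y \<xi>) x :> grad_I) \<and>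
        integrable sphere_measure (\<lambda>\<xi>'. kernel pt x \<xi> \<xi>' * I t x \<xi>') \<and>
        1 / c x * I_t =
          - (\<xi> \<bullet> grad_I) - (\<mu>a x + \<mu>s x) * I t x \<xi>
          + \<mu>s x * (\<integral>\<xi>'. kernel pt x \<xi> \<xi>' * I t x \<xi>' \<partial>sphere_measure) + q t x \<xi>) \<and>
     (\<forall>(x, \<xi>)\<in>phase_space L. I 0 x \<xi> = I0 x \<xi>) \<and>
     (\<forall>t\<in>{0..<T}. \<forall>(x, \<xi>)\<in>inflow L. I t x \<xi> = I1 t x \<xi>) \<and>
     (\<forall>(x, \<xi>)\<in>phase_space L \<union> inflow L. ((\<lambda>t. I t x \<xi>) \<longlongrightarrow> I T x \<xi>) (at_left T))"

text \<open>Twice continuously differentiable on a not necessarily open set, with first and second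
  Frechet derivatives \<^term>\<open>f'\<close> and \<^term>\<open>f''\<close> (one-sided at boundary points of the set).\<close>

definition C2_on ::
  "'a::real_normed_vector set \<Rightarrow> ('a \<Rightarrow> real) \<Rightarrow> ('a \<Rightarrow> 'a \<Rightarrow>\<^sub>L real) \<Rightarrow> ('a \<Rightarrow> 'a \<Rightarrow>\<^sub>L 'a \<Rightarrow>\<^sub>L real) \<Rightarrow> bool" where
  "C2_on S f f' f'' \<longleftrightarrow>
     (\<forall>z\<in>S. (f has_derivative blinfun_apply (f' z)) (at z within S)) \<and>
     (\<forall>z\<in>S. (f' has_derivative blinfun_apply (f'' z)) (at z within S)) \<and>
     continuous_on S f''"

text \<open>Differentiation along the sphere is expressed through the extension of \<^term>\<open>I\<close> that is
  homogeneous of degree 0 in the direction, \<open>y \<mapsto> I t x (y / \<bar>y\<bar>)\<close> for \<open>y \<noteq> 0\<close>: a function on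
  the sphere is of class \<open>C\<^sup>2\<close> iff this extension is, and at \<open>\<bar>y\<bar> = 1\<close> the derivatives of the
  extension of order at most 2 are bounded iff the intrinsic derivatives of order at most 2 are.\<close>

definition C2_bounded_solution :: "real^3 \<Rightarrow> real \<Rightarrow> (real \<Rightarrow> real^3 \<Rightarrow> real^3 \<Rightarrow> real) \<Rightarrow> bool" where
  "C2_bounded_solution L T I \<longleftrightarrow>
     (let S = {0..<T} \<times> (phase_space L \<union> inflow L);
          S_ext = {(t, x, y). y \<noteq> 0 \<and> (t, x, sgn y) \<in> S}
      in \<exists>J' J''. C2_on S_ext (\<lambda>(t, x, y). I t x (sgn y)) J' J'' \<and>
           bounded ((\<lambda>(t, x, \<xi>). I t x \<xi>) ` S) \<and> bounded (J' ` S) \<and> bounded (J'' ` S))"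


section \<open>The upwind scheme\<close>

text \<open>\<^term>\<open>M\<close> collects the numbers of spatial subintervals; \<^term>\<open>Mt\<close> and \<^term>\<open>Mp\<close> are those for
  the polar and the azimuthal angle.\<close>

definition dx :: "real^3 \<Rightarrow> nat^3 \<Rightarrow> real^3" where
  "dx L M = (\<chi> i. L $ i / real (M $ i))"

definition dtheta :: "nat \<Rightarrow> real" where
  "dtheta Mt = pi / real Mt"

definition dphi :: "nat \<Rightarrow> real" where
  "dphi Mp = 2 * pi / real Mp"

definition grid_pt :: "real^3 \<Rightarrow> nat^3 \<Rightarrow> int \<Rightarrow> int \<Rightarrow> int \<Rightarrow> real^3" where
  "grid_pt L M i j l =
     vector [of_int i * dx L M $ 1, of_int j * dx L M $ 2, of_int l * dx L M $ 3]"

definition grid_dir :: "nat \<Rightarrow> nat \<Rightarrow> int \<Rightarrow> int \<Rightarrow> real^3" where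
  "grid_dir Mt Mp m n = sph_dir (of_int m * dtheta Mt) (of_int n * dphi Mp)"

type_synonym grid_fun = "int \<Rightarrow> int \<Rightarrow> int \<Rightarrow> int \<Rightarrow> int \<Rightarrow> real"

text \<open>Values of \<^term>\<open>v\<close> outside the phase space and the inflow boundary enter with total
  coefficient 0, so they may be left arbitrary.\<close>

definition A_Delta :: "real^3 \<Rightarrow> nat^3 \<Rightarrow> nat \<Rightarrow> nat \<Rightarrow> grid_fun \<Rightarrow> grid_fun" where
  "A_Delta L M Mt Mp v i j l m n =
     (let \<xi> = grid_dir Mt Mp m n; h = dx L M in
      - \<xi>$1 * ((v (i+1) j l m n - v (i-1) j l m n) / (2 * h$1))
      + \<bar>\<xi>$1\<bar> * ((v (i+1) j l m n - 2 * v i j l m n + v (i-1) j l m n) / (2 * h$1))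
      - \<xi>$2 * ((v i (j+1) l m n - v i (j-1) l m n) / (2 * h$2))
      + \<bar>\<xi>$2\<bar> * ((v i (j+1) l m n - 2 * v i j l m n + v i (j-1) l m n) / (2 * h$2))
      - \<xi>$3 * ((v i j (l+1) m n - v i j (l-1) m n) / (2 * h$3))
      + \<bar>\<xi>$3\<bar> * ((v i j (l+1) m n - 2 * v i j l m n + v i j (l-1) m n) / (2 * h$3)))"

definition Sigma_Delta ::
  "real^3 \<Rightarrow> nat^3 \<Rightarrow> (real^3 \<Rightarrow> real) \<Rightarrow> (real^3 \<Rightarrow> real) \<Rightarrow> grid_fun \<Rightarrow> grid_fun" where
  "Sigma_Delta L M \<mu>a \<mu>s v i j l m n =
     (\<mu>s (grid_pt L M i j l) + \<mu>a (grid_pt L M i j l)) * v i j l m n"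

definition K_Delta ::
  "real^3 \<Rightarrow> nat^3 \<Rightarrow> nat \<Rightarrow> nat \<Rightarrow> (real^3 \<Rightarrow> real) \<Rightarrow> (real^3 \<Rightarrow> real \<Rightarrow> real) \<Rightarrow> grid_fun \<Rightarrow> grid_fun" where
  "K_Delta L M Mt Mp \<mu>s pt v i j l m n =
     \<mu>s (grid_pt L M i j l) * dtheta Mt * dphi Mp *
     (\<Sum>\<mu>=1..int Mt - 1. \<Sum>\<nu>=0..int Mp - 1.
        kernel pt (grid_pt L M i j l) (grid_dir Mt Mp m n) (grid_dir Mt Mp \<mu> \<nu>)
        * sin (of_int \<mu> * dtheta Mt) * v i j l \<mu> \<nu>)"

definition upwind_scheme ::
  "real^3 \<Rightarrow> real \<Rightarrow> (real^3 \<Rightarrow> real) \<Rightarrow> (real^3 \<Rightarrow> real) \<Rightarrow> (real^3 \<Rightarrow> real) \<Rightarrow>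
   (real^3 \<Rightarrow> real \<Rightarrow> real) \<Rightarrow> (real \<Rightarrow> real^3 \<Rightarrow> real^3 \<Rightarrow> real) \<Rightarrow> (real^3 \<Rightarrow> real^3 \<Rightarrow> real) \<Rightarrow>
   (real \<Rightarrow> real^3 \<Rightarrow> real^3 \<Rightarrow> real) \<Rightarrow> nat^3 \<Rightarrow> nat \<Rightarrow> nat \<Rightarrow> real \<Rightarrow> (nat \<Rightarrow> grid_fun) \<Rightarrow> bool" where
  "upwind_scheme L T c \<mu>a \<mu>s pt q I0 I1 M Mt Mp dt u \<longleftrightarrow>
     (\<forall>k i j l m n. real k \<le> T / dt - 1 \<and>
        (grid_pt L M i j l, grid_dir Mt Mp m n) \<in> phase_space L \<longrightarrow>
        1 / c (grid_pt L M i j l) * ((u (Suc k) i j l m n - u k i j l m n) / dt) =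
          A_Delta L M Mt Mp (u k) i j l m n
          - Sigma_Delta L M \<mu>a \<mu>s (u (Suc k)) i j l m n
          + K_Delta L M Mt Mp \<mu>s pt (u k) i j l m n
          + q (real k * dt) (grid_pt L M i j l) (grid_dir Mt Mp m n)) \<and>
     (\<forall>i j l m n. (grid_pt L M i j l, grid_dir Mt Mp m n) \<in> phase_space L \<longrightarrow>
        u 0 i j l m n = I0 (grid_pt L M i j l) (grid_dir Mt Mp m n)) \<and>
     (\<forall>k i j l m n. real k \<le> T / dt \<and>
        (grid_pt L M i j l, grid_dir Mt Mp m n) \<in> inflow L \<longrightarrow>
        u k i j l m n = I1 (real k * dt) (grid_pt L M i j l) (grid_dir Mt Mp m n))"

text \<open>The suprema are taken in the extended nonnegative reals. In particular the norm below is 0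
  on a grid so coarse that no grid point lies in the phase space or on the inflow boundary.\<close>

definition sup_theta :: "real^3 \<Rightarrow> (real^3 \<Rightarrow> real \<Rightarrow> real) \<Rightarrow> ennreal" where
  "sup_theta L pt =
     (SUP (x, \<xi>, \<theta>, \<phi>)\<in>{(x, \<xi>, \<theta>, \<phi>). (x, \<xi>) \<in> phase_space L \<and> \<theta> \<in> {0..pi} \<and> \<phi> \<in> {0..2*pi}}.
        ennreal \<bar>(deriv ^^ 2) (\<lambda>\<theta>. kernel pt x \<xi> (sph_dir \<theta> \<phi>) * sin \<theta>) \<theta>\<bar>)"

definition sup_phi :: "real^3 \<Rightarrow> (real^3 \<Rightarrow> real \<Rightarrow> real) \<Rightarrow> ennreal" where
  "sup_phi L pt =
     (SUP (x, \<xi>, \<theta>, \<phi>)\<in>{(x, \<xi>, \<theta>, \<phi>). (x, \<xi>) \<in> phase_space L \<and> \<theta> \<in> {0..pi} \<and> \<phi> \<in> {0..2*pi}}.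
        ennreal \<bar>(deriv ^^ 2) (\<lambda>\<phi>. kernel pt x \<xi> (sph_dir \<theta> \<phi>) * sin \<theta>) \<phi>\<bar>)"

definition error_norm ::
  "real^3 \<Rightarrow> nat^3 \<Rightarrow> nat \<Rightarrow> nat \<Rightarrow> (real^3 \<Rightarrow> real^3 \<Rightarrow> real) \<Rightarrow> grid_fun \<Rightarrow> ennreal" where
  "error_norm L M Mt Mp f v =
     (SUP (i, j, l, m, n)\<in>{(i, j, l, m, n).
          (grid_pt L M i j l, grid_dir Mt Mp m n) \<in> phase_space L \<union> inflow L}.
        ennreal \<bar>f (grid_pt L M i j l) (grid_dir Mt Mp m n) - v i j l m n\<bar>)"

end

theory Submission imports Defs begin

text \<open>
  Multiplying the scheme by \<open>c \<Delta>t\<close>, the CFL condition makes the explicit upwind part a convex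
  combination of neighbouring values, and the implicit absorption term yields the factor
  \<open>1 + c \<Delta>t (\<mu>a + \<mu>s)\<close> on the left. The condition on the angular mesh widths is exactly what bounds the
  discrete scattering sum by \<open>1 + \<mu>\<^sup>*\<close>: the trapezoidal rule in \<open>\<theta>\<close> has error constant 1/12, while the
  rectangle rule for the \<open>2\<pi>\<close>-periodic variable \<open>\<phi>\<close> is a midpoint rule and has constant 1/24, so the
  total quadrature error of the kernel is at most
  \<open>\<pi>\<^sup>2 / 6 (A \<Delta>\<theta>\<^sup>2 + B \<Delta>\<phi>\<^sup>2 / 2) \<le> \<mu>\<^sup>*\<close>. As \<open>\<mu>s (1 + \<mu>\<^sup>*) \<le> \<mu>s + \<mu>a\<close>, scattering is dominated by the
  implicit term and the maximum norm of the error grows per step by at most the truncation error.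
\<close>

section \<open>Regularity of the kernel along coordinate curves\<close>

text \<open>The obstacle in the angular quadrature is the kernel: \<open>arccos\<close> is not
  differentiable at 1 and -1. Along a coordinate curve the kernel is therefore shown to be C^1, and
  twice differentiable only off finitely many points. This is why the quadrature rules are proved
  for functions with a Lipschitz derivative (\<open>C11_on\<close>); the Lipschitz constants for the
  kernel are the two suprema in the angular condition. The 1 in the bound \<open>1 + mu_star\<close>
  needs the kernel to be normalised around every direction, whereas the hypothesis is a single
  integral in \<alpha>; rotation invariance of the surface integral bridges the two. Consistency is
  a Taylor estimate along curves. Only upwind neighbours enter the scheme, and these are interior or
  inflow points, so regularity on \<open>phase_space L \<union> inflow L\<close> suffices. Errors
  add up over at most T / \<Delta>t steps without an exponential factor, whence a constant of the
  form T times the truncation constant. The fixed mesh ratios enter through \<Lambda>, the sum of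
  their reciprocals, which turns the spatial widths into multiples of \<Delta>t.\<close>

lemma half_le_sin:
  fixes x :: real
  assumes "0 \<le> x" "x \<le> pi / 2"
  shows "x / 2 \<le> sin x"
\<comment> \<open>Up to pi/3 the cosine is at least 1/2, so \<open>sin x - x / 2\<close> is
  nondecreasing; beyond it, sin x is at least sqrt 3 / 2, which exceeds pi/4.\<close>
proof (cases "x \<le> pi / 3")
  case True
  have "(\<lambda>x. sin x - x / 2) 0 \<le> (\<lambda>x. sin x - x / 2) x"
  proof (rule DERIV_nonneg_imp_nondecreasing[OF assms(1)])
    fix y assume y: "0 \<le> y" "y \<le> x"
    have "cos (pi / 3) \<le> cos y" using y True by (intro cos_monotone_0_pi_le) auto
    then have "cos y - 1 / 2 \<ge> 0" by (simp add: cos_60)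
    moreover have "((\<lambda>x. sin x - x / 2) has_real_derivative cos y - 1 / 2) (at y)"
      by (auto intro!: derivative_eq_intros)
    ultimately show "\<exists>z. ((\<lambda>x. sin x - x / 2) has_real_derivative z) (at y) \<and> 0 \<le> z" by blast
  qed
  then show ?thesis by simp
next
  case False
  have "sin (pi / 3) \<le> sin x" using False assms by (intro sin_monotone_2pi_le) auto
  moreover have "1.6 \<le> sqrt 3" by (rule real_le_rsqrt) (simp add: power2_eq_square)
  moreover have "pi < 3.2" using pi_approx by simp
  ultimately show ?thesis using assms by (simp add: sin_60)
qed

lemma deriv_even:
  fixes h :: "real \<Rightarrow> real"
  assumes "h field_differentiable at 0" "\<And>x. h (-x) = h x"
  shows "deriv h 0 = 0"
proof -
  have d: "(h has_real_derivative deriv h 0) (at 0)"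
    using assms(1) by (simp add: DERIV_deriv_iff_field_differentiable)
  then have "((\<lambda>x. h (- x)) has_real_derivative deriv h 0 * (-1)) (at 0)"
    by (intro DERIV_chain'[where g=h and f="\<lambda>x. - x"]) (auto intro!: derivative_eq_intros)
  then have "(h has_real_derivative - deriv h 0) (at 0)" using assms(2) by simp
  with d have "deriv h 0 = - deriv h 0" by (rule DERIV_unique)
  then show ?thesis by simp
qed

locale even_periodic_C2 =
  fixes h :: "real \<Rightarrow> real"
  assumes C2: "C2_real h"
    and even: "h (- x) = h x"
    and periodic: "h (x + 2 * pi) = h x"
begin

lemma h_deriv: "(h has_real_derivative deriv h x) (at x)"
  using C2 by (simp add: C2_real_def DERIV_deriv_iff_field_differentiable)

lemma h_deriv2: "(deriv h has_real_derivative deriv (deriv h) x) (at x)"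
  using C2 by (simp add: C2_real_def DERIV_deriv_iff_field_differentiable)

lemma cont_h: "continuous_on S h"
  using h_deriv by (meson DERIV_continuous_on has_field_derivative_at_within)

lemma deriv_0: "deriv h 0 = 0"
  using C2 even by (intro deriv_even) (auto simp: C2_real_def)

text \<open>Evenness and the period 2 pi together make \<open>h\<close> symmetric about pi.\<close>

lemma deriv_pi: "deriv h pi = 0"
proof -
  have "h (- x + pi) = h (x + pi)" for x
  proof -
    have "- x + pi = - (x + pi) + 2 * pi" by simp
    then show ?thesis by (simp only: periodic even)
  qed
  then have e: "(\<lambda>x. h (- x + pi)) = (\<lambda>x. h (x + pi))" by (rule ext)
  have d: "((\<lambda>x. h (x + pi)) has_real_derivative deriv h pi) (at 0)"
    using h_deriv[of pi] DERIV_shift[of h "deriv h pi" 0 pi] by simp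
  have "((\<lambda>x. h (- x + pi)) has_real_derivative deriv h pi * (-1)) (at 0)"
  proof (rule DERIV_chain'[where g=h and f="\<lambda>x. - x + pi"])
    show "((\<lambda>x. - x + pi) has_real_derivative - 1) (at 0)" by (auto intro!: derivative_eq_intros)
    show "(h has_real_derivative deriv h pi) (at (- 0 + pi))" using h_deriv[of pi] by simp
  qed
  then have "((\<lambda>x. h (x + pi)) has_real_derivative - deriv h pi) (at 0)" unfolding e by simp
  with d have "deriv h pi = - deriv h pi" by (rule DERIV_unique)
  then show ?thesis by simp
qed

text \<open>The derivative of \<open>h\<close> is Lipschitz on [0, pi] and vanishes at both ends,
  hence is dominated by the distance to the nearer end, which is at most twice the sine. This
  cancels the factor 1 / sin that differentiating \<open>arccos\<close> produces.\<close>

lemma deriv_le_sin: "\<exists>K\<ge>0. \<forall>\<alpha>\<in>{0..pi}. \<bar>deriv h \<alpha>\<bar> \<le> K * sin \<alpha>"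
proof -
  have "bounded (deriv (deriv h) ` {0..pi})"
    using C2 by (intro compact_imp_bounded compact_continuous_image)
      (auto simp: C2_real_def intro: continuous_on_subset)
  then obtain M where M: "\<And>x. x \<in> {0..pi} \<Longrightarrow> \<bar>deriv (deriv h) x\<bar> \<le> M" "M > 0"
    unfolding bounded_pos real_norm_def by blast
  have lip: "\<bar>deriv h a - deriv h b\<bar> \<le> M * \<bar>a - b\<bar>" if "a \<in> {0..pi}" "b \<in> {0..pi}" for a b
  proof -
    have "norm (deriv h a - deriv h b) \<le> M * norm (a - b)"
      by (rule field_differentiable_bound[of "{0..pi}" "deriv h" "deriv (deriv h)"])
        (use that M(1) has_field_derivative_at_within[OF h_deriv2] in \<open>simp_all only: real_norm_def convex_real_interval\<close>)
    then show ?thesis by simp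
  qed
  have "\<bar>deriv h \<alpha>\<bar> \<le> (2 * M) * sin \<alpha>" if "\<alpha> \<in> {0..pi}" for \<alpha>
  proof (cases "\<alpha> \<le> pi / 2")
    case True
    have "\<bar>deriv h \<alpha>\<bar> \<le> M * \<alpha>" using lip[of \<alpha> 0] deriv_0 that by simp
    also have "\<dots> = 2 * M * (\<alpha> / 2)" by simp
    also have "\<dots> \<le> 2 * M * sin \<alpha>"
      using half_le_sin[of \<alpha>] that True M(2) by (intro mult_left_mono) auto
    finally show ?thesis .
  next
    case False
    have "\<bar>deriv h \<alpha>\<bar> \<le> M * (pi - \<alpha>)" using lip[of \<alpha> pi] deriv_pi that by simp
    also have "\<dots> = 2 * M * ((pi - \<alpha>) / 2)" by simp
    also have "\<dots> \<le> 2 * M * sin (pi - \<alpha>)"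
      using half_le_sin[of "pi - \<alpha>"] that False M(2) by (intro mult_left_mono) auto
    finally show ?thesis by simp
  qed
  moreover have "0 \<le> 2 * M" using M(2) by simp
  ultimately show ?thesis by blast
qed

text \<open>Along a coordinate curve of the sphere the cosine of the angle to a fixed direction is
  \<open>u s = R * cos (s - d) + k\<close>. At the points where \<open>u s = 1\<close> or \<open>u s = -1\<close>, where \<open>arccos\<close> is not
  differentiable, the derivative below is 0 through division by \<open>sin 0\<close> or \<open>sin pi\<close>.\<close>

lemma curve_regular:
  fixes R d k :: real
  defines "u \<equiv> \<lambda>s. R * cos (s - d) + k"
  defines "D \<equiv> \<lambda>s. deriv h (arccos (u s)) / sin (arccos (u s)) * (R * sin (s - d))"
  assumes u1: "\<And>s. \<bar>u s\<bar> \<le> 1"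
  shows "((\<lambda>s. h (arccos (u s))) has_real_derivative D s) (at s)"
    and "continuous_on UNIV D"
    and "finite {s\<in>{a..b}. \<not> D field_differentiable at s}"
proof -
  let ?F = "\<lambda>s. h (arccos (u s))"
  have u': "(u has_real_derivative - (R * sin (s - d))) (at s)" for s
    unfolding u_def by (auto intro!: derivative_eq_intros)
  have ucont: "continuous_on S u" for S
    unfolding u_def by (intro continuous_intros)
  obtain K where K: "K \<ge> 0" "\<And>\<alpha>. \<alpha> \<in> {0..pi} \<Longrightarrow> \<bar>deriv h \<alpha>\<bar> \<le> K * sin \<alpha>"
    using deriv_le_sin by blast
  have ac: "arccos (u s) \<in> {0..pi}" for s using u1[of s] by (auto intro!: arccos_lbound arccos_ubound simp: abs_le_iff)
  have s0: "sin (arccos (u s)) = sqrt (1 - (u s)\<^sup>2)" for s using u1[of s] by (intro sin_arccos_abs) 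
  have dF: "(?F has_real_derivative D s) (at s)" if "\<bar>u s\<bar> < 1" for s
  proof -
    have "(?F has_real_derivative deriv h (arccos (u s)) * (inverse (- sqrt (1 - (u s)\<^sup>2)) * (- (R * sin (s - d))))) (at s)"
      using that u'[of s] h_deriv DERIV_arccos[of "u s"]
      by (intro DERIV_chain2[where f=h] DERIV_chain2[where f=arccos]) (auto simp: abs_less_iff)
    then show ?thesis unfolding D_def s0 by (simp add: divide_inverse mult.assoc)
  qed
  have Ddiff: "D field_differentiable at s" if "\<bar>u s\<bar> < 1" for s
  proof -
    have A: "((\<lambda>s. arccos (u s)) has_real_derivative (inverse (- sqrt (1 - (u s)\<^sup>2)) * (- (R * sin (s - d))))) (at s)"
      using that u'[of s] DERIV_arccos[of "u s"]
      by (intro DERIV_chain2[where f=arccos]) (auto simp: abs_less_iff)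
    have B: "(\<lambda>s. deriv h (arccos (u s))) field_differentiable at s"
      using DERIV_chain2[OF h_deriv2 A] field_differentiable_def by blast
    have C: "(\<lambda>s. sin (arccos (u s))) field_differentiable at s"
      using DERIV_chain2[OF DERIV_sin A] field_differentiable_def by blast
    have E: "(\<lambda>s. R * sin (s - d)) field_differentiable at s"
      unfolding field_differentiable_def by (auto intro!: derivative_eq_intros exI)
    have "(u s)\<^sup>2 < 1" using that by (simp add: abs_square_less_1)
    then have "sin (arccos (u s)) \<noteq> 0" unfolding s0 by simp
    then show ?thesis unfolding D_def
      by (intro field_differentiable_mult field_differentiable_divide B C E)
  qed
  \<comment> \<open>Where the sine vanishes the quotient is 0 by the convention for division, so the
    bound holds at every \<open>s\<close>; it gives continuity of \<open>D\<close> at the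
    exceptional points by squeezing.\<close>
  have Dbound: "\<bar>D s\<bar> \<le> K * \<bar>R * sin (s - d)\<bar>" for s
  proof -
    have "\<bar>deriv h (arccos (u s)) / sin (arccos (u s))\<bar> \<le> K"
    proof (cases "sin (arccos (u s)) = 0")
      case False
      then have "sin (arccos (u s)) > 0" using ac[of s] by (metis atLeastAtMost_iff sin_ge_zero less_eq_real_def)
      then show ?thesis using K(2)[OF ac[of s]] by (simp add: field_simps)
    qed (use K in simp)
    then show ?thesis unfolding D_def abs_mult[of "_ / _"] by (intro mult_right_mono) auto
  qed
  \<comment> \<open>Evaluating \<open>u1\<close> at \<open>d\<close> and \<open>d + pi\<close> gives
    |R| + |k| \<le> 1. So |u s| = 1 with \<open>R\<close> nonzero forces |cos (s - d)| = 1, and the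
    exceptional points lie among the zeros of \<open>sin (s - d)\<close>.\<close>
  have bad: "R * sin (s - d) = 0" if "\<not> \<bar>u s\<bar> < 1" for s
  proof (rule ccontr)
    assume n: "R * sin (s - d) \<noteq> 0"
    have "\<bar>R\<bar> + \<bar>k\<bar> \<le> 1" using u1[of d] u1[of "d + pi"] by (auto simp: u_def)
    moreover have "\<bar>cos (s - d)\<bar> < 1"
    proof -
      have "sin (s - d) \<noteq> 0" using n by auto
      then have "(cos (s - d))\<^sup>2 < 1" by (simp add: cos_squared_eq)
      then show ?thesis by (simp add: abs_square_less_1)
    qed
    then have "\<bar>R * cos (s - d)\<bar> < \<bar>R\<bar>" using n by (simp add: abs_mult)
    ultimately show False using that unfolding u_def by linarith
  qed
  have contD_at: "isCont D s" for s
  proof (cases "\<bar>u s\<bar> < 1")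
    case True
    then show ?thesis using Ddiff field_differentiable_imp_continuous_at by blast
  next
    case False
    then have z: "R * sin (s - d) = 0" by (rule bad)
    have "(\<lambda>t. K * \<bar>R * sin (t - d)\<bar>) \<midarrow>s\<rightarrow> K * \<bar>R * sin (s - d)\<bar>"
      by (intro tendsto_intros)
    then have "D \<midarrow>s\<rightarrow> 0"
      unfolding z by (intro Lim_null_comparison[where g="\<lambda>t. K * \<bar>R * sin (t - d)\<bar>" and f=D]) (use Dbound in auto)
    moreover have "D s = 0" unfolding D_def z by simp
    ultimately show ?thesis by (simp add: isCont_def)
  qed
  then show contD: "continuous_on UNIV D" by (simp add: continuous_at_imp_continuous_on)
  have finbad: "R = 0 \<or> finite {s\<in>{a..b}. \<not> \<bar>u s\<bar> < 1}" for a b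
  proof (cases "R = 0")
    case False
    have "{s\<in>{a..b}. \<not> \<bar>u s\<bar> < 1} \<subseteq> (\<lambda>i. d + of_int i * pi) ` {\<lfloor>(a - d) / pi\<rfloor>..\<lceil>(b - d) / pi\<rceil>}"
    proof
      fix s assume "s \<in> {s\<in>{a..b}. \<not> \<bar>u s\<bar> < 1}"
      then have s: "a \<le> s" "s \<le> b" "sin (s - d) = 0" using bad False by auto
      then obtain i :: int where i: "s - d = of_int i * pi" by (auto simp: sin_zero_iff_int2)
      have "(a - d) / pi \<le> of_int i" "of_int i \<le> (b - d) / pi" using s i by (auto simp: field_simps)
      then have "i \<in> {\<lfloor>(a - d) / pi\<rfloor>..\<lceil>(b - d) / pi\<rceil>}" by (auto simp: floor_le_iff le_ceiling_iff)
      then show "s \<in> (\<lambda>i. d + of_int i * pi) ` {\<lfloor>(a - d) / pi\<rfloor>..\<lceil>(b - d) / pi\<rceil>}" 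
        using i by (auto intro!: image_eqI[of _ _ i])
    qed
    then show ?thesis using finite_subset by blast
  qed simp
  show "finite {s\<in>{a..b}. \<not> D field_differentiable at s}"
  proof (cases "R = 0")
    case True
    then have "D = (\<lambda>_. 0)" by (auto simp: D_def)
    then show ?thesis by simp
  next
    case False
    then show ?thesis using finbad[of a b] Ddiff by (auto elim: rev_finite_subset)
  qed
  \<comment> \<open>The chain rule fails at exceptional points. There are finitely many on
    [s - 1, s + 1], so the strong fundamental theorem still makes \<open>?F\<close> a primitive of
    the continuous function \<open>D\<close>, and a primitive of a continuous function is
    differentiable everywhere.\<close>
  show "(?F has_real_derivative D s) (at s)"
  proof (cases "R = 0")
    case True
    then show ?thesis by (auto simp: D_def u_def)
  next
    case False
    let ?a = "s - 1" and ?b = "s + 1"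
    have cF: "continuous_on S ?F" for S
      by (rule continuous_on_compose2[OF cont_h[of UNIV]], rule continuous_on_compose2[OF continuous_on_arccos' ucont])
        (use u1 in \<open>auto simp: abs_le_iff minus_le_iff\<close>)
    have FTC: "(D has_integral ?F t - ?F ?a) {?a..t}" if "t \<in> {?a..?b}" for t
      by (rule fundamental_theorem_of_calculus_strong[of "{s\<in>{?a..t}. \<not> \<bar>u s\<bar> < 1}"])
        (use that finbad False dF cF in \<open>auto simp: has_real_derivative_iff_has_vector_derivative[symmetric]\<close>)
    have "((\<lambda>x. integral {?a..x} D) has_real_derivative D s) (at s within {?a..?b})"
      by (rule integral_has_real_derivative) (use contD in \<open>auto intro: continuous_on_subset\<close>)
    then have "((\<lambda>x. ?F x - ?F ?a) has_real_derivative D s) (at s within {?a..?b})"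
      by (rule has_field_derivative_transform_within[where d=1]) (use FTC in \<open>auto dest: integral_unique\<close>)
    then have "((\<lambda>x. ?F x - ?F ?a + ?F ?a) has_real_derivative D s + 0) (at s within {?a..?b})"
      by (intro DERIV_add DERIV_const)
    moreover have "at s within {?a..?b} = at s" by (rule at_within_Icc_at) auto
    ultimately show ?thesis by simp
  qed
qed

end

text \<open>The second derivative may be missing at finitely many points, so the bound goes through the
  fundamental theorem of calculus.\<close>

lemma Lipschitz_of_deriv_bound:
  fixes f :: "real \<Rightarrow> real"
  assumes "continuous_on {a..b} f" "finite {s\<in>{a..b}. \<not> f field_differentiable at s}"
    and bound: "\<And>s. s \<in> {a..b} \<Longrightarrow> \<bar>deriv f s\<bar> \<le> B"
    and "s \<in> {a..b}" "t \<in> {a..b}"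
  shows "\<bar>f s - f t\<bar> \<le> B * \<bar>s - t\<bar>"
proof -
  have *: "\<bar>f t - f s\<bar> \<le> B * (t - s)" if "s \<in> {a..b}" "t \<in> {a..b}" "s \<le> t" for s t
  proof -
    have "(deriv f has_integral f t - f s) {s..t}"
      by (rule fundamental_theorem_of_calculus_strong[OF assms(2) \<open>s \<le> t\<close>])
        (use that assms(1) in \<open>auto simp: DERIV_deriv_iff_field_differentiable
            has_real_derivative_iff_has_vector_derivative[symmetric] intro: continuous_on_subset\<close>)
    moreover have "0 \<le> B" using bound[OF that(1)] by linarith
    ultimately show ?thesis
      using has_integral_bound_real[of B "{}" "deriv f" "f t - f s" s t] bound that by auto
  qed
  show ?thesis using *[of s t] *[of t s] assms(4,5) by (cases "s \<le> t") auto
qed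

section \<open>Quadrature with Lipschitz derivatives\<close>

lemma Taylor_Lipschitz:
  fixes f f' :: "real \<Rightarrow> real"
  assumes df: "\<And>s. s \<in> {a..b} \<Longrightarrow> (f has_real_derivative f' s) (at s within {a..b})"
    and lip: "\<And>s. s \<in> {a..b} \<Longrightarrow> \<bar>f' s - f' m\<bar> \<le> K * \<bar>s - m\<bar>"
    and m: "m \<in> {a..b}" and t: "t \<in> {a..b}"
  shows "\<bar>f t - f m - f' m * (t - m)\<bar> \<le> K / 2 * (t - m)\<^sup>2"
proof -
  \<comment> \<open>The sign \<open>?\<sigma>\<close> makes |s - m| equal to
    \<open>?\<sigma> * (s - m)\<close> on the whole segment, so that both positions of
    \<open>t\<close> relative to \<open>m\<close> share one integral.\<close>
  let ?l = "min m t" and ?r = "max m t" and ?\<sigma> = "sgn (t - m)"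
  have le: "?l \<le> ?r" by simp
  have sub: "{?l..?r} \<subseteq> {a..b}" using m t by auto
  have 1: "((\<lambda>s. f' s - f' m) has_integral (f ?r - f' m * ?r) - (f ?l - f' m * ?l)) {?l..?r}"
    by (rule fundamental_theorem_of_calculus[OF le])
      (use sub in \<open>auto simp: has_real_derivative_iff_has_vector_derivative[symmetric]
        intro!: derivative_eq_intros has_field_derivative_subset[OF df _]\<close>)
  have 2: "((\<lambda>s. K * (?\<sigma> * (s - m))) has_integral (K * ?\<sigma> * (?r - m)\<^sup>2 / 2 - K * ?\<sigma> * (?l - m)\<^sup>2 / 2)) {?l..?r}"
    by (rule fundamental_theorem_of_calculus[OF le])
      (auto simp: has_real_derivative_iff_has_vector_derivative[symmetric] intro!: derivative_eq_intros)
  have "norm (integral {?l..?r} (\<lambda>s. f' s - f' m)) \<le> integral {?l..?r} (\<lambda>s. K * (?\<sigma> * (s - m)))"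
  proof (rule integral_norm_bound_integral)
    fix s assume s: "s \<in> {?l..?r}"
    then have "\<bar>s - m\<bar> = ?\<sigma> * (s - m)" by (auto simp: sgn_if min_def max_def split: if_splits)
    then show "norm (f' s - f' m) \<le> K * (?\<sigma> * (s - m))" using lip[of s] s sub
      by (simp only: real_norm_def subset_iff)
  qed (use 1 2 in \<open>auto simp: integrable_on_def\<close>)
  then show ?thesis
    unfolding integral_unique[OF 1] integral_unique[OF 2]
    using abs_minus_commute[of "f t + m * f' m" "f m + t * f' m"]
    by (cases "m \<le> t") (auto simp: sgn_if min_def max_def algebra_simps split: if_splits)
qed

text \<open>The class C^{1,1} with explicit constants. A Lipschitz constant \<open>K2\<close> of the
  derivative replaces a bound on a second derivative that need not be known to exist everywhere;
  \<open>K0\<close> and \<open>K1\<close> are carried along for the product of kernel and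
  solution.\<close>

definition C11_on :: "real set \<Rightarrow> real \<Rightarrow> real \<Rightarrow> real \<Rightarrow> (real \<Rightarrow> real) \<Rightarrow> bool" where
  "C11_on S K0 K1 K2 f \<longleftrightarrow>
     (\<exists>f'. (\<forall>s\<in>S. (f has_real_derivative f' s) (at s within S) \<and> \<bar>f s\<bar> \<le> K0 \<and> \<bar>f' s\<bar> \<le> K1) \<and>
           (\<forall>s\<in>S. \<forall>t\<in>S. \<bar>f' s - f' t\<bar> \<le> K2 * \<bar>s - t\<bar>))"

lemma C11_on_subset: "C11_on S K0 K1 K2 f \<Longrightarrow> R \<subseteq> S \<Longrightarrow> C11_on R K0 K1 K2 f"
  unfolding C11_on_def by (meson has_field_derivative_subset subsetD)

lemma C11_on_continuous: "C11_on S K0 K1 K2 f \<Longrightarrow> continuous_on S f"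
  unfolding C11_on_def by (meson DERIV_continuous_on)

lemma C11_on_cong:
  assumes "C11_on S K0 K1 K2 f" "\<And>s. s \<in> S \<Longrightarrow> f s = g s"
  shows "C11_on S K0 K1 K2 g"
proof -
  have "(g has_real_derivative D) (at s within S)"
    if "(f has_real_derivative D) (at s within S)" "s \<in> S" for D s
    by (rule has_field_derivative_transform_within[OF that(1) zero_less_one that(2)]) (rule assms(2))
  then show ?thesis using assms unfolding C11_on_def by metis
qed

lemma C11_on_mono:
  assumes "C11_on S K0 K1 K2 f" "K0 \<le> L0" "K1 \<le> L1" "K2 \<le> L2"
  shows "C11_on S L0 L1 L2 f"
proof -
  obtain f' where f': "\<forall>s\<in>S. (f has_real_derivative f' s) (at s within S) \<and> \<bar>f s\<bar> \<le> K0 \<and> \<bar>f' s\<bar> \<le> K1"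
    "\<forall>s\<in>S. \<forall>t\<in>S. \<bar>f' s - f' t\<bar> \<le> K2 * \<bar>s - t\<bar>"
    using assms(1) unfolding C11_on_def by blast
  have "\<bar>f' s - f' t\<bar> \<le> L2 * \<bar>s - t\<bar>" if "s \<in> S" "t \<in> S" for s t
    using f'(2) that mult_right_mono[OF assms(4), of "\<bar>s - t\<bar>"] by force
  then show ?thesis using f'(1) assms(2,3) unfolding C11_on_def by (intro exI[of _ f']) force
qed

text \<open>The constants are those of the Leibniz rule for the function and its first two
  derivatives. On an interval the mean value theorem makes \<open>K1\<close> and \<open>L1\<close>
  Lipschitz constants of the factors, and the difference of the product's derivatives telescopes
  into four terms in each of which a single factor varies.\<close>

lemma C11_on_mult:
  assumes "C11_on S K0 K1 K2 f" "C11_on S L0 L1 L2 g"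
    and S: "S = {a..b}"
  shows "C11_on S (K0 * L0) (K1 * L0 + K0 * L1) (K2 * L0 + 2 * K1 * L1 + K0 * L2) (\<lambda>s. f s * g s)"
proof -
  obtain f' where f: "\<And>s. s \<in> S \<Longrightarrow> (f has_real_derivative f' s) (at s within S)"
      "\<And>s. s \<in> S \<Longrightarrow> \<bar>f s\<bar> \<le> K0" "\<And>s. s \<in> S \<Longrightarrow> \<bar>f' s\<bar> \<le> K1"
      "\<And>s t. s \<in> S \<Longrightarrow> t \<in> S \<Longrightarrow> \<bar>f' s - f' t\<bar> \<le> K2 * \<bar>s - t\<bar>"
    using assms(1) unfolding C11_on_def by blast
  obtain g' where g: "\<And>s. s \<in> S \<Longrightarrow> (g has_real_derivative g' s) (at s within S)"
      "\<And>s. s \<in> S \<Longrightarrow> \<bar>g s\<bar> \<le> L0" "\<And>s. s \<in> S \<Longrightarrow> \<bar>g' s\<bar> \<le> L1"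
      "\<And>s t. s \<in> S \<Longrightarrow> t \<in> S \<Longrightarrow> \<bar>g' s - g' t\<bar> \<le> L2 * \<bar>s - t\<bar>"
    using assms(2) unfolding C11_on_def by blast
  have f_lip: "\<bar>f s - f t\<bar> \<le> K1 * \<bar>s - t\<bar>" if "s \<in> S" "t \<in> S" for s t
    using field_differentiable_bound[of S f f' K1 s t] f that S by auto
  have g_lip: "\<bar>g s - g t\<bar> \<le> L1 * \<bar>s - t\<bar>" if "s \<in> S" "t \<in> S" for s t
    using field_differentiable_bound[of S g g' L1 s t] g that S by auto
  define D where "D = (\<lambda>s. f' s * g s + f s * g' s)"
  show ?thesis unfolding C11_on_def
  proof (intro exI[of _ D] conjI ballI)
    fix s assume s: "s \<in> S"
    show "((\<lambda>s. f s * g s) has_real_derivative D s) (at s within S)"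
      unfolding D_def using f(1)[OF s] g(1)[OF s] by (auto intro!: derivative_eq_intros)
    show "\<bar>f s * g s\<bar> \<le> K0 * L0"
      unfolding abs_mult using f(2)[OF s] g(2)[OF s] by (intro mult_mono) auto
    have "\<bar>f' s * g s\<bar> \<le> K1 * L0" "\<bar>f s * g' s\<bar> \<le> K0 * L1"
      unfolding abs_mult using f(2,3)[OF s] g(2,3)[OF s] by (auto intro!: mult_mono)
    then show "\<bar>D s\<bar> \<le> K1 * L0 + K0 * L1" unfolding D_def by linarith
    fix t assume t: "t \<in> S"
    have m: "\<bar>x * y\<bar> \<le> A * B * d" if "\<bar>x\<bar> \<le> A * d" "\<bar>y\<bar> \<le> B" for x y A B d :: real
    proof -
      have "\<bar>x * y\<bar> \<le> (A * d) * B" unfolding abs_mult using that by (intro mult_mono) auto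
      then show ?thesis by (simp add: mult_ac)
    qed
    have "\<bar>(f' s - f' t) * g s\<bar> \<le> K2 * L0 * \<bar>s - t\<bar>"
      "\<bar>(g s - g t) * f' t\<bar> \<le> L1 * K1 * \<bar>s - t\<bar>"
      "\<bar>(f s - f t) * g' s\<bar> \<le> K1 * L1 * \<bar>s - t\<bar>"
      "\<bar>(g' s - g' t) * f t\<bar> \<le> L2 * K0 * \<bar>s - t\<bar>"
      using f(4)[OF s t] g(4)[OF s t] f_lip[OF s t] g_lip[OF s t] g(2)[OF s] f(3)[OF t] g(3)[OF s] f(2)[OF t]
      by (auto intro!: m)
    moreover have "D s - D t = (f' s - f' t) * g s + (g s - g t) * f' t + (f s - f t) * g' s + (g' s - g' t) * f t"
      unfolding D_def by (simp add: algebra_simps)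
    moreover have "(K2 * L0 + 2 * K1 * L1 + K0 * L2) * \<bar>s - t\<bar> =
        K2 * L0 * \<bar>s - t\<bar> + L1 * K1 * \<bar>s - t\<bar> + K1 * L1 * \<bar>s - t\<bar> + L2 * K0 * \<bar>s - t\<bar>"
      by (simp add: algebra_simps)
    ultimately show "\<bar>D s - D t\<bar> \<le> (K2 * L0 + 2 * K1 * L1 + K0 * L2) * \<bar>s - t\<bar>"
      by linarith
  qed
qed

text \<open>Integration by parts against s - m, with \<open>m\<close> the midpoint, expresses the
  error as the integral of (s - m) f'(s). Since s - m has mean zero, f'(s) may be replaced by f'(s)
  - f'(m), and 1/12 comes from integrating K (s - m)^2.\<close>

lemma trapezoid_error:
  assumes f: "C11_on {a..b} K0 K1 K f" and le: "a \<le> b"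
  shows "\<bar>integral {a..b} f - (b - a) / 2 * (f a + f b)\<bar> \<le> K * (b - a) ^ 3 / 12"
proof -
  define m where "m = (a + b) / 2"
  have m: "m \<in> {a..b}" using le by (auto simp: m_def)
  obtain f' where f': "\<And>s. s \<in> {a..b} \<Longrightarrow> (f has_real_derivative f' s) (at s within {a..b})"
      "\<And>s t. s \<in> {a..b} \<Longrightarrow> t \<in> {a..b} \<Longrightarrow> \<bar>f' s - f' t\<bar> \<le> K * \<bar>s - t\<bar>"
    using f unfolding C11_on_def by blast
  have 1: "((\<lambda>s. f s + (s - m) * (f' s - f' m)) has_integral
      ((b - m) * f b - f' m * (b - m)\<^sup>2 / 2) - ((a - m) * f a - f' m * (a - m)\<^sup>2 / 2)) {a..b}"
    by (rule fundamental_theorem_of_calculus[OF le])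
      (auto simp: has_real_derivative_iff_has_vector_derivative[symmetric] algebra_simps diff_divide_distrib
        intro!: derivative_eq_intros f'(1))
  have 2: "(f has_integral integral {a..b} f) {a..b}"
    by (intro integrable_integral integrable_continuous_real C11_on_continuous[OF f])
  have 3: "((\<lambda>s. K * (s - m)\<^sup>2) has_integral (K * (b - m) ^ 3 / 3 - K * (a - m) ^ 3 / 3)) {a..b}"
    by (rule fundamental_theorem_of_calculus[OF le])
      (auto simp: has_real_derivative_iff_has_vector_derivative[symmetric] intro!: derivative_eq_intros)
  have eq: "((b - m) * f b - f' m * (b - m)\<^sup>2 / 2) - ((a - m) * f a - f' m * (a - m)\<^sup>2 / 2)
      = (b - a) / 2 * (f a + f b)"
    unfolding m_def by (simp add: field_simps power2_eq_square)
  have 4: "((\<lambda>s. (s - m) * (f' s - f' m)) has_integral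
      (b - a) / 2 * (f a + f b) - integral {a..b} f) {a..b}"
    using has_integral_diff[OF 1 2] unfolding eq by simp
  have "norm (integral {a..b} (\<lambda>s. (s - m) * (f' s - f' m))) \<le> integral {a..b} (\<lambda>s. K * (s - m)\<^sup>2)"
  proof (rule integral_norm_bound_integral)
    fix s assume s: "s \<in> {a..b}"
    have "\<bar>s - m\<bar> * \<bar>f' s - f' m\<bar> \<le> \<bar>s - m\<bar> * (K * \<bar>s - m\<bar>)"
      by (intro mult_left_mono f'(2) s m) auto
    also have "\<dots> = K * (s - m)\<^sup>2" by (simp add: power2_eq_square)
    finally show "norm ((s - m) * (f' s - f' m)) \<le> K * (s - m)\<^sup>2" by (simp add: abs_mult)
  qed (use 3 4 in \<open>auto simp: integrable_on_def\<close>)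
  also have "\<dots> = K * (b - a) ^ 3 / 12"
    unfolding integral_unique[OF 3] unfolding m_def by (simp add: field_simps power3_eq_cube)
  finally show ?thesis unfolding integral_unique[OF 4] by (simp add: abs_minus_commute)
qed

text \<open>The linear Taylor term at the centre integrates to zero, and the remainder is at most
  K/2 (s - m)^2; this factor 1/2 is the gain over the trapezoidal rule.\<close>

lemma midpoint_error:
  assumes f: "C11_on {m - r..m + r} K0 K1 K f" and r: "0 \<le> r"
  shows "\<bar>integral {m - r..m + r} f - 2 * r * f m\<bar> \<le> K * (2 * r) ^ 3 / 24"
proof -
  let ?I = "{m - r..m + r}"
  have m: "m \<in> ?I" and le: "m - r \<le> m + r" using r by auto
  obtain f' where f': "\<And>s. s \<in> ?I \<Longrightarrow> (f has_real_derivative f' s) (at s within ?I)"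
      "\<And>s t. s \<in> ?I \<Longrightarrow> t \<in> ?I \<Longrightarrow> \<bar>f' s - f' t\<bar> \<le> K * \<bar>s - t\<bar>"
    using f unfolding C11_on_def by blast
  have 1: "((\<lambda>s. f m + f' m * (s - m)) has_integral
      (f m * (m + r) + f' m * (m + r - m)\<^sup>2 / 2) - (f m * (m - r) + f' m * (m - r - m)\<^sup>2 / 2)) ?I"
    by (rule fundamental_theorem_of_calculus[OF le])
      (auto simp: has_real_derivative_iff_has_vector_derivative[symmetric] algebra_simps diff_divide_distrib
        intro!: derivative_eq_intros f'(1))
  have 2: "(f has_integral integral ?I f) ?I"
    by (intro integrable_integral integrable_continuous_real C11_on_continuous[OF f])
  have 3: "((\<lambda>s. K / 2 * (s - m)\<^sup>2) has_integral (K * (m + r - m) ^ 3 / 6 - K * (m - r - m) ^ 3 / 6)) ?I"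
    by (rule fundamental_theorem_of_calculus[OF le])
      (auto simp: has_real_derivative_iff_has_vector_derivative[symmetric] intro!: derivative_eq_intros)
  have 4: "((\<lambda>s. f s - (f m + f' m * (s - m))) has_integral integral ?I f - 2 * r * f m) ?I"
    using has_integral_diff[OF 2 1] by (simp add: algebra_simps)
  have "norm (integral ?I (\<lambda>s. f s - (f m + f' m * (s - m)))) \<le> integral ?I (\<lambda>s. K / 2 * (s - m)\<^sup>2)"
  proof (rule integral_norm_bound_integral)
    fix s assume s: "s \<in> ?I"
    show "norm (f s - (f m + f' m * (s - m))) \<le> K / 2 * (s - m)\<^sup>2"
      using Taylor_Lipschitz[OF f'(1) _ m s] f'(2) m by (simp add: diff_diff_eq)
  qed (use 3 4 in \<open>auto simp: integrable_on_def\<close>)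
  also have "\<dots> = K * (2 * r) ^ 3 / 24"
    unfolding integral_unique[OF 3] by (simp add: field_simps power3_eq_cube)
  finally show ?thesis unfolding integral_unique[OF 4] by simp
qed

section \<open>Composite rules in one and two angular variables\<close>

lemma composite_error:
  fixes f :: "real \<Rightarrow> real" and h :: real
  assumes h: "h \<ge> 0"
    and cell: "\<And>j. j < N \<Longrightarrow> \<bar>integral {a + real j * h..a + real (Suc j) * h} f - Q j\<bar> \<le> e"
    and int: "f integrable_on {a..a + real N * h}"
  shows "\<bar>integral {a..a + real N * h} f - (\<Sum>j<N. Q j)\<bar> \<le> real N * e"
  using cell int
proof (induction N)
  case (Suc N)
  have le: "a \<le> a + real N * h" "a + real N * h \<le> a + real (Suc N) * h"
    using h by (auto simp: algebra_simps)
  have "f integrable_on {a..a + real N * h}"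
    by (rule integrable_on_subinterval[OF Suc.prems(2)]) (use le in auto)
  then have "\<bar>integral {a..a + real N * h} f - (\<Sum>j<N. Q j)\<bar> \<le> real N * e"
    using Suc.IH Suc.prems(1) by simp
  moreover have "\<bar>integral {a + real N * h..a + real (Suc N) * h} f - Q N\<bar> \<le> e"
    using Suc.prems(1)[of N] by simp
  moreover have "integral {a..a + real N * h} f + integral {a + real N * h..a + real (Suc N) * h} f
      = integral {a..a + real (Suc N) * h} f"
    using le Suc.prems(2) by (intro Henstock_Kurzweil_Integration.integral_combine)
  moreover have "real (Suc N) * e = real N * e + e" by (simp add: algebra_simps)
  ultimately show ?case unfolding sum.lessThan_Suc by linarith
qed simp

text \<open>With vanishing end values the trapezoidal sum reduces to the interior nodes, each
  collecting two halves. This is the polar sum of the scheme, whose integrand carries the factor sin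
  \<theta>.\<close>

lemma composite_trapezoid:
  assumes f: "C11_on {0..b} K0 K1 K f" and N: "N > 0" and b: "b \<ge> 0"
    and ends: "f 0 = 0" "f b = 0"
  defines "h \<equiv> b / real N"
  shows "\<bar>integral {0..b} f - h * (\<Sum>j=1..int N - 1. f (of_int j * h))\<bar> \<le> b * K * h\<^sup>2 / 12"
proof -
  have h: "h \<ge> 0" "real N * h = b" using N b by (auto simp: h_def)
  have "\<bar>integral {0..0 + real N * h} f - (\<Sum>j<N. h / 2 * (f (real j * h) + f (real (Suc j) * h)))\<bar> \<le> real N * (K * h ^ 3 / 12)"
  proof (rule composite_error[OF h(1)])
    fix j assume j: "j < N"
    let ?a = "real j * h" and ?b = "real (Suc j) * h"
    have eb: "?b = ?a + h" by (simp add: algebra_simps)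
    have "?b \<le> real N * h" using j h(1) by (intro mult_right_mono) auto
    then have "{?a..?b} \<subseteq> {0..b}" using h by (auto intro: order_trans[OF mult_nonneg_nonneg])
    from trapezoid_error[OF C11_on_subset[OF f this]] eb h(1)
    show "\<bar>integral {0 + ?a..0 + ?b} f - h / 2 * (f ?a + f ?b)\<bar> \<le> K * h ^ 3 / 12"
      by simp
  qed (use C11_on_continuous[OF f] h integrable_continuous_real in auto)
  moreover have "(\<Sum>j<N. h / 2 * (f (real j * h) + f (real (Suc j) * h))) = h * (\<Sum>j=1..int N - 1. f (of_int j * h))"
  proof -
    obtain n where n: "N = Suc n" using N gr0_implies_Suc by blast
    have "(\<Sum>j<N. f (real j * h)) = (\<Sum>j<n. f (real (Suc j) * h))"
      unfolding n sum.lessThan_Suc_shift using ends by simp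
    moreover have "(\<Sum>j<N. f (real (Suc j) * h)) = (\<Sum>j<n. f (real (Suc j) * h))"
      unfolding n sum.lessThan_Suc using ends h(2) n by simp
    moreover have "(\<Sum>j=1..int N - 1. f (of_int j * h)) = (\<Sum>j<n. f (real (Suc j) * h))"
      unfolding n by (rule sum.reindex_bij_witness[of _ "\<lambda>j. int (Suc j)" "\<lambda>j. nat j - 1"]) auto
    moreover have "(\<Sum>j<N. h / 2 * (f (real j * h) + f (real (Suc j) * h)))
        = h / 2 * ((\<Sum>j<N. f (real j * h)) + (\<Sum>j<N. f (real (Suc j) * h)))"
      by (simp only: sum_distrib_left[symmetric] sum.distrib)
    ultimately show ?thesis by simp
  qed
  moreover have "real N * (K * h ^ 3 / 12) = b * K * h\<^sup>2 / 12"
    unfolding h(2)[symmetric] by (simp add: power3_eq_cube power2_eq_square)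
  ultimately show ?thesis by (simp only: add_0 h(2))
qed

text \<open>For a periodic integrand the rectangle rule is a midpoint rule on shifted cells, which gains
  a factor 2 over the trapezoidal rule.\<close>

lemma composite_periodic:
  assumes f: "C11_on {- b..b} K0 K1 K f" and N: "N > 0" and b: "b > 0"
    and per: "\<And>s. f (s + b) = f s"
  defines "h \<equiv> b / real N"
  shows "\<bar>integral {0..b} f - h * (\<Sum>j=0..int N - 1. f (of_int j * h))\<bar> \<le> b * K * h\<^sup>2 / 24"
proof -
  have h: "h > 0" "real N * h = b" using N b by (auto simp: h_def)
  have hb: "h \<le> b" using N b by (simp add: h_def field_simps)
  \<comment> \<open>Cells centred at the nodes j h begin at -h/2, which is why \<open>f\<close> is
    controlled on \<open>{- b..b}\<close> and not only on \<open>{0..b}\<close>. Periodicity later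
    moves the piece [-h/2, 0] to the right end.\<close>
  define a where "a = - (h / 2)"
  have cont: "continuous_on {u..v} f" if "- b \<le> u" "v \<le> b" for u v
    using C11_on_continuous[OF f] by (rule continuous_on_subset) (use that in auto)
  have "\<bar>integral {a..a + real N * h} f - (\<Sum>j<N. h * f (real j * h))\<bar> \<le> real N * (K * h ^ 3 / 24)"
  proof (rule composite_error)
    fix j assume j: "j < N"
    have "real (Suc j) * h \<le> real N * h" using j h(1) by (intro mult_right_mono) auto
    then have "real j * h + h \<le> b" using h by (simp add: algebra_simps)
    moreover have "0 \<le> real j * h" using h by simp
    ultimately have "- b \<le> real j * h - h / 2" "real j * h + h / 2 \<le> b" using h(1) hb by linarith+
    then have "{real j * h - h / 2..real j * h + h / 2} \<subseteq> {- b..b}" by auto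
    from midpoint_error[OF C11_on_subset[OF f this]] h(1)
    have "\<bar>integral {real j * h - h / 2..real j * h + h / 2} f - h * f (real j * h)\<bar> \<le> K * h ^ 3 / 24"
      by simp
    moreover have "a + real j * h = real j * h - h / 2" "a + real (Suc j) * h = real j * h + h / 2"
      by (auto simp: a_def field_simps)
    ultimately show "\<bar>integral {a + real j * h..a + real (Suc j) * h} f - h * f (real j * h)\<bar> \<le> K * h ^ 3 / 24"
      by metis
  qed (use h hb in \<open>auto intro!: integrable_continuous_real cont simp: a_def\<close>)
  moreover have "integral {a..a + real N * h} f = integral {0..b} f"
  proof -
    have "integral {a..0} f = integral {a..0} (f \<circ> (\<lambda>s. s + b))" by (simp add: o_def per)
    also have "\<dots> = integral {a + b..0 + b} f"
      by (rule integral_shift) (use h hb in \<open>auto intro!: cont simp: a_def\<close>)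
    finally have 1: "integral {a..0} f = integral {a + b..b} f" by simp
    have "integral {a..0} f + integral {0..a + b} f = integral {a..a + b} f"
      by (rule Henstock_Kurzweil_Integration.integral_combine)
        (use h hb in \<open>auto intro!: integrable_continuous_real cont simp: a_def\<close>)
    moreover have "integral {0..a + b} f + integral {a + b..b} f = integral {0..b} f"
      by (rule Henstock_Kurzweil_Integration.integral_combine)
        (use h hb in \<open>auto intro!: integrable_continuous_real cont simp: a_def\<close>)
    ultimately show ?thesis using 1 h(2) by simp
  qed
  moreover have "(\<Sum>j<N. f (real j * h)) = (\<Sum>j=0..int N - 1. f (of_int j * h))"
    by (rule sum.reindex_bij_witness[of _ nat int]) auto
  moreover have "real N * (K * h ^ 3 / 24) = b * K * h\<^sup>2 / 24"
    unfolding h(2)[symmetric] by (simp add: power3_eq_cube power2_eq_square)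
  ultimately show ?thesis by (simp only: sum_distrib_left[symmetric])
qed

text \<open>The \<phi>-integral is discretised first, and its error is integrated over a length pi.
  Then each of the \<open>N\<close> resulting \<theta>-integrals is discretised, with total weight
  \<open>N * dphi N\<close>, that is 2 pi. The constants pi * 2 pi / 24 and 2 pi * pi / 12 combine
  into pi^2 / 6 with weights 1/2 and 1.\<close>

lemma quadrature_2d:
  fixes F :: "real \<Rightarrow> real \<Rightarrow> real"
  assumes cont: "continuous_on UNIV (\<lambda>(x, y). F x y)"
    and x: "\<And>y. y \<in> {0..2 * pi} \<Longrightarrow> C11_on {0..pi} X0 X1 A (\<lambda>x. F x y)"
    and x0: "\<And>y. F 0 y = 0" "\<And>y. F pi y = 0"
    and y: "\<And>x. x \<in> {0..pi} \<Longrightarrow> C11_on {- (2 * pi)..2 * pi} Y0 Y1 B (F x)"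
    and per: "\<And>x y. F x (y + 2 * pi) = F x y"
    and M: "M > 0" and N: "N > 0"
  shows "\<bar>integral {0..pi} (\<lambda>x. integral {0..2 * pi} (F x))
      - dtheta M * dphi N * (\<Sum>i=1..int M - 1. \<Sum>j=0..int N - 1. F (of_int i * dtheta M) (of_int j * dphi N))\<bar>
    \<le> pi\<^sup>2 / 6 * (A * (dtheta M)\<^sup>2 + B * ((dphi N)\<^sup>2 / 2))"
proof -
  let ?h = "dtheta M" and ?k = "dphi N"
  define G where "G = (\<lambda>x. ?k * (\<Sum>j=0..int N - 1. F x (of_int j * ?k)))"
  have k0: "?k \<ge> 0" by (simp add: dphi_def)
  have cx: "continuous_on S (\<lambda>x. F x y)" for S y
    by (rule continuous_on_compose2[OF cont, where f="\<lambda>x. (x, y)", simplified]) (auto intro!: continuous_intros)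
  have cI: "(\<lambda>x. integral {0..2 * pi} (F x)) integrable_on {0..pi}"
  proof -
    have "continuous_on (cbox (0, 0) (pi, 2 * pi)) (\<lambda>(x, y). F x y)"
      using cont by (rule continuous_on_subset) auto
    from integral_integrable_2dim[OF this] show ?thesis by simp
  qed
  have cG: "G integrable_on {0..pi}"
    unfolding G_def by (intro integrable_continuous_real continuous_intros cx)
  have 1: "\<bar>integral {0..pi} (\<lambda>x. integral {0..2 * pi} (F x)) - integral {0..pi} G\<bar> \<le> pi * (2 * pi * B * ?k\<^sup>2 / 24)"
  proof -
    have "\<bar>integral {0..pi} (\<lambda>x. integral {0..2 * pi} (F x) - G x)\<bar> \<le> integral {0..pi} (\<lambda>x. 2 * pi * B * ?k\<^sup>2 / 24)"
    proof (subst real_norm_def[symmetric], rule integral_norm_bound_integral)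
      show "norm (integral {0..2 * pi} (F x) - G x) \<le> 2 * pi * B * ?k\<^sup>2 / 24" if "x \<in> {0..pi}" for x
        using composite_periodic[OF y[OF that] N _ per] by (simp add: G_def dphi_def)
    qed (use cI cG integrable_diff in auto)
    also have "\<dots> = pi * (2 * pi * B * ?k\<^sup>2 / 24)"
      by (subst integral_const_real) simp
    finally show ?thesis unfolding integral_diff[OF cI cG] .
  qed
  have 2: "\<bar>integral {0..pi} G - ?h * ?k * (\<Sum>i=1..int M - 1. \<Sum>j=0..int N - 1. F (of_int i * ?h) (of_int j * ?k))\<bar>
      \<le> 2 * pi * (pi * A * ?h\<^sup>2 / 12)"
  proof -
    have G: "integral {0..pi} G = ?k * (\<Sum>j=0..int N - 1. integral {0..pi} (\<lambda>x. F x (of_int j * ?k)))"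
      unfolding G_def by (simp add: integral_sum integrable_continuous_real cx)
    have e: "?h * ?k * (\<Sum>i=1..int M - 1. \<Sum>j=0..int N - 1. F (of_int i * ?h) (of_int j * ?k))
      = ?k * (\<Sum>j=0..int N - 1. ?h * (\<Sum>i=1..int M - 1. F (of_int i * ?h) (of_int j * ?k)))"
      by (subst sum.swap) (simp add: sum_distrib_left mult_ac)
    have "\<bar>\<Sum>j=0..int N - 1. integral {0..pi} (\<lambda>x. F x (of_int j * ?k)) - ?h * (\<Sum>i=1..int M - 1. F (of_int i * ?h) (of_int j * ?k))\<bar>
        \<le> (\<Sum>j=0..int N - 1. pi * A * ?h\<^sup>2 / 12)"
    proof (intro order_trans[OF sum_abs] sum_mono)
      fix j :: int assume j: "j \<in> {0..int N - 1}"
      have "of_int j * (2 * pi) \<le> real N * (2 * pi)" using j by (intro mult_right_mono) auto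
      then have "of_int j * ?k \<in> {0..2 * pi}" using j N by (auto simp: dphi_def field_simps)
      from composite_trapezoid[OF x[OF this] M _ x0(1) x0(2)]
      show "\<bar>integral {0..pi} (\<lambda>x. F x (of_int j * ?k)) - ?h * (\<Sum>i=1..int M - 1. F (of_int i * ?h) (of_int j * ?k))\<bar>
          \<le> pi * A * ?h\<^sup>2 / 12" by (simp add: dtheta_def)
    qed
    also have "\<dots> = real N * (pi * A * ?h\<^sup>2 / 12)" by simp
    finally have "?k * \<bar>\<Sum>j=0..int N - 1. integral {0..pi} (\<lambda>x. F x (of_int j * ?k)) - ?h * (\<Sum>i=1..int M - 1. F (of_int i * ?h) (of_int j * ?k))\<bar>
        \<le> ?k * (real N * (pi * A * ?h\<^sup>2 / 12))" by (intro mult_left_mono k0)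
    moreover have "?k * (real N * (pi * A * ?h\<^sup>2 / 12)) = 2 * pi * (pi * A * ?h\<^sup>2 / 12)"
      using N by (simp add: dphi_def)
    ultimately show ?thesis
      using k0 by (simp only: G e right_diff_distrib[symmetric] sum_subtractf[symmetric] abs_mult abs_of_nonneg)
  qed
  have "pi\<^sup>2 / 6 * (A * ?h\<^sup>2 + B * (?k\<^sup>2 / 2)) = pi * (2 * pi * B * ?k\<^sup>2 / 24) + 2 * pi * (pi * A * ?h\<^sup>2 / 12)"
    by (simp add: field_simps power2_eq_square)
  with 1 2 show ?thesis by linarith
qed

section \<open>The surface measure of the sphere\<close>

lemma sph_dir_inner:
  "sph_dir a b \<bullet> sph_dir \<theta> \<phi> = sin a * sin \<theta> * cos (\<phi> - b) + cos a * cos \<theta>"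
  by (simp add: sph_dir_def inner_vec_def sum_3 cos_diff algebra_simps)

lemma sph_dir_in_S2: "sph_dir \<theta> \<phi> \<in> S2"
proof -
  have "sph_dir \<theta> \<phi> \<bullet> sph_dir \<theta> \<phi> = 1"
    unfolding sph_dir_inner by (simp flip: power2_eq_square)
  then show ?thesis by (simp add: norm_eq_1)
qed

lemma continuous_on_sph_dir [continuous_intros]:
  fixes S :: "'a::t2_space set"
  assumes "continuous_on S f" "continuous_on S g"
  shows "continuous_on S (\<lambda>x. sph_dir (f x) (g x))"
proof -
  have "continuous_on S (\<lambda>x. sph_dir (f x) (g x) $ i)" for i
    using exhaust_3[of i] assms by (elim disjE; simp add: sph_dir_def; auto intro!: continuous_intros)
  then have "continuous_on S (\<lambda>x. \<chi> i. sph_dir (f x) (g x) $ i)" by (rule continuous_on_vec_lambda)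
  then show ?thesis by simp
qed

text \<open>Undoing the image measure and the density gives an integral over the parameter
  rectangle; Fubini for a continuous integrand then yields the iterated form to which
  \<open>quadrature_2d\<close> applies.\<close>

lemma integral_sphere_measure:
  assumes g: "continuous_on S2 g"
  shows "(\<integral>\<xi>. g \<xi> \<partial>sphere_measure) =
    integral {0..pi} (\<lambda>\<theta>. integral {0..2 * pi} (\<lambda>\<phi>. sin \<theta> * g (sph_dir \<theta> \<phi>)))"
proof -
  let ?B = "cbox (0, 0) (pi, 2 * pi) :: (real \<times> real) set"
  let ?\<sigma> = "\<lambda>(\<theta>, \<phi>). sph_dir \<theta> \<phi>"
  let ?d = "\<lambda>z :: real \<times> real. sin (fst z) * indicator ?B z"
  have B: "?B = {0..pi} \<times> {0..2 * pi}" by (auto simp: cbox_Pair_eq)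
  have d: "(\<lambda>(\<theta>, \<phi>). ennreal (sin \<theta> * indicator ({0..pi} \<times> {0..2*pi}) (\<theta>, \<phi>))) = (\<lambda>z. ennreal (?d z))"
    by (auto simp: B fun_eq_iff)
  have c\<sigma>: "continuous_on UNIV ?\<sigma>" unfolding case_prod_unfold by (intro continuous_intros)
  have m\<sigma>: "?\<sigma> \<in> measurable lborel (restrict_space borel S2)"
    by (rule measurable_restrict_space2) (use sph_dir_in_S2 borel_measurable_continuous_onI[OF c\<sigma>] in auto)
  have mg: "g \<in> borel_measurable (restrict_space borel S2)"
    by (rule borel_measurable_continuous_on_restrict[OF g])
  have md: "?d \<in> borel_measurable lborel"
    by (simp add: borel_measurable_times borel_measurable_continuous_onI continuous_intros)
  have cg: "continuous_on UNIV (\<lambda>z. sin (fst z) * g (?\<sigma> z))"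
    by (intro continuous_intros continuous_on_compose2[OF g c\<sigma>]) (use sph_dir_in_S2 in auto)
  have "(\<integral>\<xi>. g \<xi> \<partial>sphere_measure) = (\<integral>z. g (?\<sigma> z) \<partial>density lborel (\<lambda>z. ennreal (?d z)))"
    unfolding sphere_measure_def d by (rule integral_distr) (use m\<sigma> mg in simp_all)
  also have "\<dots> = (\<integral>z. ?d z *\<^sub>R g (?\<sigma> z) \<partial>lborel)"
  proof (rule integral_density)
    show "(\<lambda>z. g (?\<sigma> z)) \<in> borel_measurable lborel" using measurable_compose[OF m\<sigma> mg] .
    show "AE z in lborel. 0 \<le> ?d z" by (rule AE_I2) (auto simp: B indicator_def sin_ge_zero)
  qed (rule md)
  also have "\<dots> = (LINT z:?B|lborel. sin (fst z) * g (?\<sigma> z))"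
    unfolding set_lebesgue_integral_def by (rule Bochner_Integration.integral_cong) auto
  also have "\<dots> = integral ?B (\<lambda>z. sin (fst z) * g (?\<sigma> z))"
    by (rule set_borel_integral_eq_integral, unfold set_integrable_def)
      (rule borel_integrable_compact[OF compact_cbox continuous_on_subset[OF cg subset_UNIV]])
  also have "\<dots> = integral {0..pi} (\<lambda>\<theta>. integral {0..2 * pi} (\<lambda>\<phi>. sin \<theta> * g (sph_dir \<theta> \<phi>)))"
    using integral_prod_continuous[OF continuous_on_subset[OF cg], of 0 0 pi "2 * pi"] by simp
  finally show ?thesis .
qed

text \<open>Rotation invariance of the surface integral for functions of the angle to an axis.
  Instead of a change of variables, the integral is differentiated in the polar angle
  \<open>a\<close> of the axis, and the derivative of the integrand is a sum of exact \<theta>- and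
  \<phi>-derivatives.\<close>

lemma zonal_integral_const_smooth:
  fixes g g' :: "real \<Rightarrow> real"
  assumes g: "\<And>u. (g has_real_derivative g' u) (at u)" and g': "continuous_on UNIV g'"
  shows "integral (cbox (0, 0) (pi, 2 * pi)) (\<lambda>(\<theta>, \<phi>). g (sph_dir a b \<bullet> sph_dir \<theta> \<phi>) * sin \<theta>)
       = integral (cbox (0, 0) (pi, 2 * pi)) (\<lambda>(\<theta>, \<phi>). g (sph_dir 0 b \<bullet> sph_dir \<theta> \<phi>) * sin \<theta>)"
proof -
  let ?B = "cbox (0, 0) (pi, 2 * pi) :: (real \<times> real) set"
  define U where "U = (\<lambda>a \<theta> \<phi>. sin a * sin \<theta> * cos (\<phi> - b) + cos a * cos \<theta>)"
  define Ua where "Ua = (\<lambda>a \<theta> \<phi>. cos a * sin \<theta> * cos (\<phi> - b) - sin a * cos \<theta>)"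
  define Ut where "Ut = (\<lambda>a \<theta> \<phi>. sin a * cos \<theta> * cos (\<phi> - b) - cos a * sin \<theta>)"
  define Up where "Up = (\<lambda>a \<theta> \<phi>. - (sin a * sin \<theta> * sin (\<phi> - b)))"
  have cg: "continuous_on UNIV g" using g by (meson DERIV_continuous_on has_field_derivative_at_within)
  note cc = continuous_on_compose2[OF cg _ subset_UNIV] continuous_on_compose2[OF g' _ subset_UNIV]
  \<comment> \<open>\<open>P\<close> is minus the \<theta>-derivative of sin \<theta> cos (\<phi> -
    b) g(U), which vanishes at both poles. \<open>Q\<close> is the \<phi>-derivative of cos \<theta>
    sin (\<phi> - b) g(U), which has period 2 pi. Both therefore integrate to zero, and in their sum
    the terms without g' cancel.\<close>
  define P where "P = (\<lambda>a \<theta> \<phi>. - (cos \<theta> * cos (\<phi> - b) * g (U a \<theta> \<phi>) + sin \<theta> * cos (\<phi> - b) * (g' (U a \<theta> \<phi>) * Ut a \<theta> \<phi>)))"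
  define Q where "Q = (\<lambda>a \<theta> \<phi>. cos \<theta> * cos (\<phi> - b) * g (U a \<theta> \<phi>) + cos \<theta> * sin (\<phi> - b) * (g' (U a \<theta> \<phi>) * Up a \<theta> \<phi>))"
  text \<open>Turning \<open>\<xi> = sph_dir a b\<close> moves along a rotation field, which is divergence free on the sphere.\<close>
  have div: "g' (U a \<theta> \<phi>) * Ua a \<theta> \<phi> * sin \<theta> = P a \<theta> \<phi> + Q a \<theta> \<phi>" for a \<theta> \<phi>
  proof -
    have "Ua a \<theta> \<phi> * sin \<theta> = - sin \<theta> * cos (\<phi> - b) * Ut a \<theta> \<phi> + cos \<theta> * sin (\<phi> - b) * Up a \<theta> \<phi>"
    proof -
      have s: "sin (\<phi> - b) * sin (\<phi> - b) = 1 - cos (\<phi> - b) * cos (\<phi> - b)"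
        using sin_squared_eq[of "\<phi> - b"] by (simp add: power2_eq_square)
      have "cos \<theta> * sin (\<phi> - b) * Up a \<theta> \<phi> = - (sin a * sin \<theta> * cos \<theta> * (sin (\<phi> - b) * sin (\<phi> - b)))"
        by (simp add: Up_def)
      then show ?thesis unfolding s by (simp add: Ua_def Ut_def algebra_simps)
    qed
    then have "g' (U a \<theta> \<phi>) * Ua a \<theta> \<phi> * sin \<theta> =
        g' (U a \<theta> \<phi>) * (- sin \<theta> * cos (\<phi> - b) * Ut a \<theta> \<phi> + cos \<theta> * sin (\<phi> - b) * Up a \<theta> \<phi>)"
      by (simp only: mult.assoc)
    then show ?thesis by (simp add: P_def Q_def algebra_simps)
  qed
  have Ut: "((\<lambda>\<theta>. U a \<theta> \<phi>) has_real_derivative Ut a \<theta> \<phi>) (at \<theta> within S)" for a \<theta> \<phi> S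
    unfolding U_def Ut_def by (auto intro!: derivative_eq_intros)
  have Up: "((\<lambda>\<phi>. U a \<theta> \<phi>) has_real_derivative Up a \<theta> \<phi>) (at \<phi> within S)" for a \<theta> \<phi> S
    unfolding U_def Up_def by (auto intro!: derivative_eq_intros)
  have Ua: "((\<lambda>a. U a \<theta> \<phi>) has_real_derivative Ua a \<theta> \<phi>) (at a within S)" for a \<theta> \<phi> S
    unfolding U_def Ua_def by (auto intro!: derivative_eq_intros)
  have cP: "continuous_on S (\<lambda>(\<theta>, \<phi>). P a \<theta> \<phi>)" and cQ: "continuous_on S (\<lambda>(\<theta>, \<phi>). Q a \<theta> \<phi>)" for S a
    unfolding P_def Q_def U_def Ut_def Up_def case_prod_unfold by (intro continuous_intros cc)+
  have intP: "integral ?B (\<lambda>(\<theta>, \<phi>). P a \<theta> \<phi>) = 0" for a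
  proof -
    have "integral {0..pi} (\<lambda>\<theta>. P a \<theta> \<phi>) = 0" for \<phi>
    proof -
      have "((\<lambda>\<theta>. P a \<theta> \<phi>) has_integral
          - (sin pi * cos (\<phi> - b) * g (U a pi \<phi>)) - - (sin 0 * cos (\<phi> - b) * g (U a 0 \<phi>))) {0..pi}"
        by (rule fundamental_theorem_of_calculus)
          (auto simp: P_def has_real_derivative_iff_has_vector_derivative[symmetric] algebra_simps
            intro!: derivative_eq_intros DERIV_chain2[OF g Ut])
      then show ?thesis by (auto dest: integral_unique)
    qed
    moreover have "integral ?B (\<lambda>(\<theta>, \<phi>). P a \<theta> \<phi>) =
        integral (cbox 0 pi) (\<lambda>\<theta>. integral (cbox 0 (2 * pi)) (P a \<theta>))"
      using integral_prod_continuous[OF cP[of _ a], of 0 0 pi "2 * pi"] by simp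
    moreover have "\<dots> = integral (cbox 0 (2 * pi)) (\<lambda>\<phi>. integral (cbox 0 pi) (\<lambda>\<theta>. P a \<theta> \<phi>))"
      by (rule integral_swap_continuous[OF cP])
    ultimately show ?thesis by simp
  qed
  have intQ: "integral ?B (\<lambda>(\<theta>, \<phi>). Q a \<theta> \<phi>) = 0" for a
  proof -
    have "integral {0..2 * pi} (\<lambda>\<phi>. Q a \<theta> \<phi>) = 0" for \<theta>
    proof -
      have "((\<lambda>\<phi>. Q a \<theta> \<phi>) has_integral
          cos \<theta> * sin (2 * pi - b) * g (U a \<theta> (2 * pi)) - cos \<theta> * sin (0 - b) * g (U a \<theta> 0)) {0..2 * pi}"
        by (rule fundamental_theorem_of_calculus)
          (auto simp: Q_def has_real_derivative_iff_has_vector_derivative[symmetric] algebra_simps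
            intro!: derivative_eq_intros DERIV_chain2[OF g Up])
      then show ?thesis by (auto dest: integral_unique simp: U_def sin_diff cos_diff)
    qed
    then show ?thesis using integral_prod_continuous[OF cQ[of _ a], of 0 0 pi "2 * pi"] by simp
  qed
  define \<Phi> where "\<Phi> = (\<lambda>a. integral ?B (\<lambda>z. g (U a (fst z) (snd z)) * sin (fst z)))"
  have "(\<Phi> has_real_derivative 0) (at a)" for a
  proof -
    have "(\<Phi> has_real_derivative integral ?B (\<lambda>z. g' (U a (fst z) (snd z)) * Ua a (fst z) (snd z) * sin (fst z))) (at a within UNIV)"
      unfolding \<Phi>_def
    proof (rule leibniz_rule_field_derivative[where U=UNIV])
      show "((\<lambda>a. g (U a (fst z) (snd z)) * sin (fst z)) has_real_derivative
          g' (U a (fst z) (snd z)) * Ua a (fst z) (snd z) * sin (fst z)) (at a within UNIV)" for a z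
        by (auto intro!: derivative_eq_intros DERIV_chain2[OF g Ua])
      show "(\<lambda>z. g (U a (fst z) (snd z)) * sin (fst z)) integrable_on ?B" for a
        unfolding U_def by (intro integrable_continuous continuous_intros cc)
      show "continuous_on (UNIV \<times> ?B) (\<lambda>(a, z). g' (U a (fst z) (snd z)) * Ua a (fst z) (snd z) * sin (fst z))"
        unfolding U_def Ua_def case_prod_unfold by (intro continuous_intros cc)
    qed auto
    moreover have "integral ?B (\<lambda>z. g' (U a (fst z) (snd z)) * Ua a (fst z) (snd z) * sin (fst z)) = 0"
      using intP[of a] intQ[of a] integral_add[OF integrable_continuous[OF cP[of "?B" a]] integrable_continuous[OF cQ[of "?B" a]]]
      unfolding div by (simp add: case_prod_unfold)
    ultimately show ?thesis by simp
  qed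
  then have "\<Phi> a = \<Phi> 0" using DERIV_isconst_all[of \<Phi> a 0] by blast
  then show ?thesis unfolding \<Phi>_def U_def sph_dir_inner case_prod_unfold .
qed

lemma abs_sph_dir_inner_le: "\<bar>sph_dir a b \<bullet> sph_dir \<theta> \<phi>\<bar> \<le> 1"
  using Cauchy_Schwarz_ineq2[of "sph_dir a b" "sph_dir \<theta> \<phi>"] sph_dir_in_S2[of a b] sph_dir_in_S2[of \<theta> \<phi>]
  by simp

lemma continuous_on_zonal:
  assumes "continuous_on {-1..1} g"
  shows "continuous_on S (\<lambda>(\<theta>, \<phi>). g (sph_dir a b \<bullet> sph_dir \<theta> \<phi>) :: real)"
  unfolding case_prod_unfold
  by (rule continuous_on_compose2[OF assms])
    (use abs_sph_dir_inner_le in \<open>auto intro!: continuous_intros simp: abs_le_iff minus_le_iff\<close>)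

text \<open>Composition with \<open>arccos\<close> supplies only a continuous function on [-1, 1].
  Polynomials approximate it uniformly there, and for them the smooth case applies. With the axis at
  the pole the inner product is cos \<theta>, so the \<phi>-integral contributes just 2 pi.\<close>

lemma zonal_integral:
  fixes g :: "real \<Rightarrow> real"
  assumes g: "continuous_on {-1..1} g"
  shows "integral {0..pi} (\<lambda>\<theta>. integral {0..2 * pi} (\<lambda>\<phi>. g (sph_dir a b \<bullet> sph_dir \<theta> \<phi>) * sin \<theta>))
       = 2 * pi * integral {0..pi} (\<lambda>\<theta>. g (cos \<theta>) * sin \<theta>)"
proof -
  let ?B = "cbox (0, 0) (pi, 2 * pi) :: (real \<times> real) set"
  define Z where "Z = (\<lambda>g a (\<theta>, \<phi>). g (sph_dir a b \<bullet> sph_dir \<theta> \<phi>) * sin \<theta> :: real)"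
  define c where "c = measure lborel ?B"
  have c: "c \<ge> 0" by (simp add: c_def)
  have cZ: "continuous_on S (Z g a)" if "continuous_on {-1..1} g" for S g a
    using continuous_on_zonal[OF that, of S a b] unfolding Z_def case_prod_unfold
    by (intro continuous_intros)
  have iZ: "Z g a integrable_on ?B" if "continuous_on {-1..1} g" for g a
    using cZ[OF that] by (rule integrable_continuous)
  have "\<bar>integral ?B (Z g a) - integral ?B (Z g 0)\<bar> \<le> 0"
  proof (rule field_le_epsilon)
    fix e :: real assume e: "e > 0"
    \<comment> \<open>The function is replaced by the polynomial twice, once per axis, at a cost of
      at most \<epsilon> c each; adding 1 keeps the denominator positive without computing
      \<open>c\<close>.\<close>
    define \<epsilon> where "\<epsilon> = e / (2 * c + 1)"
    have \<epsilon>: "\<epsilon> > 0" using e c by (simp add: \<epsilon>_def)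
    obtain p where p: "real_polynomial_function p" "\<And>u. u \<in> {-1..1} \<Longrightarrow> \<bar>g u - p u\<bar> < \<epsilon>"
      using Stone_Weierstrass_real_polynomial_function[OF _ g \<epsilon>] by auto
    obtain p' where p': "real_polynomial_function p'" "\<And>u. (p has_real_derivative p' u) (at u)"
      using has_real_derivative_polynomial_function[OF p(1)] by blast
    have cp: "continuous_on S p" for S
      using continuous_polymonial_function p(1) real_polynomial_function_eq continuous_at_imp_continuous_on by blast
    have cp': "continuous_on S p'" for S
      using continuous_polymonial_function p'(1) real_polynomial_function_eq continuous_at_imp_continuous_on by blast
    have eq: "integral ?B (Z p a) = integral ?B (Z p 0)"
      unfolding Z_def by (rule zonal_integral_const_smooth[OF p'(2) cp'])
    have near: "\<bar>integral ?B (Z g a) - integral ?B (Z p a)\<bar> \<le> \<epsilon> * c" for a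
    proof -
      have "norm (integral ?B (\<lambda>z. Z g a z - Z p a z)) \<le> integral ?B (\<lambda>z. \<epsilon>)"
      proof (rule integral_norm_bound_integral)
        fix z assume "z \<in> ?B"
        have "\<bar>g u - p u\<bar> * \<bar>sin t\<bar> \<le> \<epsilon> * 1" if "\<bar>u\<bar> \<le> 1" for u t
          using p(2)[of u] that \<epsilon> by (intro mult_mono) (auto simp: abs_le_iff)
        then show "norm (Z g a z - Z p a z) \<le> \<epsilon>"
          using abs_sph_dir_inner_le by (cases z) (simp add: Z_def left_diff_distrib[symmetric] abs_mult)
      qed (intro integrable_diff iZ g cp integrable_const)+
      then show ?thesis using integral_diff[OF iZ[OF g] iZ[OF cp], of a a] by (simp add: c_def mult.commute)
    qed
    have "\<bar>integral ?B (Z g a) - integral ?B (Z g 0)\<bar> \<le> 2 * (\<epsilon> * c)"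
      using near[of a] near[of 0] eq by linarith
    also have "\<dots> = e * (2 * c / (2 * c + 1))" by (simp add: \<epsilon>_def)
    also have "\<dots> \<le> e * 1" using c e by (intro mult_left_mono) auto
    finally show "\<bar>integral ?B (Z g a) - integral ?B (Z g 0)\<bar> \<le> 0 + e" by simp
  qed
  then have "integral ?B (Z g a) = integral ?B (Z g 0)" by simp
  then have "integral {0..pi} (\<lambda>\<theta>. integral {0..2 * pi} (\<lambda>\<phi>. Z g a (\<theta>, \<phi>)))
      = integral {0..pi} (\<lambda>\<theta>. integral {0..2 * pi} (\<lambda>\<phi>. Z g 0 (\<theta>, \<phi>)))"
    using integral_prod_continuous[OF cZ[OF g]] by (metis box_real(2))
  moreover have "integral {0..2 * pi} (\<lambda>\<phi>. Z g 0 (\<theta>, \<phi>)) = (2 * pi) *\<^sub>R (g (cos \<theta>) * sin \<theta>)" for \<theta>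
    by (simp add: Z_def sph_dir_inner)
  ultimately have "integral {0..pi} (\<lambda>\<theta>. integral {0..2 * pi} (\<lambda>\<phi>. Z g a (\<theta>, \<phi>)))
      = (2 * pi) *\<^sub>R integral {0..pi} (\<lambda>\<theta>. g (cos \<theta>) * sin \<theta>)"
    by (simp only: integral_cmul)
  then show ?thesis unfolding Z_def prod.case real_scaleR_def .
qed

section \<open>Consistency of the difference quotients\<close>

text \<open>Derivatives are restricted to the image of the curve before the chain rule is applied,
  so the one-sided derivatives at boundary points of \<open>E\<close> are enough.\<close>

lemma C2_on_curve:
  fixes f :: "'a::real_normed_vector \<Rightarrow> real" and \<gamma> :: "real \<Rightarrow> 'a"
  assumes f: "C2_on E f f' f''"
    and E: "\<And>s. s \<in> A \<Longrightarrow> \<gamma> s \<in> E"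
    and \<gamma>: "\<And>s. s \<in> A \<Longrightarrow> (\<gamma> has_vector_derivative \<gamma>' s) (at s within A)"
    and \<gamma>': "\<And>s. s \<in> A \<Longrightarrow> (\<gamma>' has_vector_derivative \<gamma>'' s) (at s within A)"
    and s: "s \<in> A"
  shows "((\<lambda>s. f (\<gamma> s)) has_real_derivative f' (\<gamma> s) (\<gamma>' s)) (at s within A)"
    and "((\<lambda>s. f' (\<gamma> s) (\<gamma>' s)) has_real_derivative
           f'' (\<gamma> s) (\<gamma>' s) (\<gamma>' s) + f' (\<gamma> s) (\<gamma>'' s)) (at s within A)"
proof -
  have d1: "(f has_derivative f' (\<gamma> s)) (at (\<gamma> s) within \<gamma> ` A)"
    using f E s unfolding C2_on_def by (meson has_derivative_subset image_subsetI)
  have d2: "(f' has_derivative f'' (\<gamma> s)) (at (\<gamma> s) within \<gamma> ` A)"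
    using f E s unfolding C2_on_def by (meson has_derivative_subset image_subsetI)
  note g = \<gamma>[OF s, unfolded has_vector_derivative_def]
  note g' = \<gamma>'[OF s, unfolded has_vector_derivative_def]
  show "((\<lambda>s. f (\<gamma> s)) has_real_derivative f' (\<gamma> s) (\<gamma>' s)) (at s within A)"
    unfolding has_field_derivative_def using has_derivative_in_compose[OF g d1]
    by (rule has_derivative_eq_rhs) (auto simp: blinfun.scaleR_right)
  have "((\<lambda>s. f' (\<gamma> s) (\<gamma>' s)) has_derivative
      (\<lambda>h. f' (\<gamma> s) (h *\<^sub>R \<gamma>'' s) + f'' (\<gamma> s) (h *\<^sub>R \<gamma>' s) (\<gamma>' s))) (at s within A)"
    by (rule bounded_bilinear.FDERIV[OF bounded_bilinear_blinfun_apply has_derivative_in_compose[OF g d2] g'])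
  then show "((\<lambda>s. f' (\<gamma> s) (\<gamma>' s)) has_real_derivative
      f'' (\<gamma> s) (\<gamma>' s) (\<gamma>' s) + f' (\<gamma> s) (\<gamma>'' s)) (at s within A)"
    unfolding has_field_derivative_def
    by (rule has_derivative_eq_rhs) (auto simp: blinfun.scaleR_right blinfun.scaleR_left algebra_simps)
qed

text \<open>The second derivative along the curve is f''(\<gamma>', \<gamma>') + f'(\<gamma>''): the
  speed bound 1 gives the first \<open>K\<close>, the acceleration bound \<open>G\<close> gives K
  G.\<close>

lemma C11_on_curve:
  fixes f :: "'a::real_normed_vector \<Rightarrow> real" and \<gamma> :: "real \<Rightarrow> 'a"
  assumes f: "C2_on E f f' f''"
    and E: "\<And>s. s \<in> {a..b} \<Longrightarrow> \<gamma> s \<in> E"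
    and \<gamma>: "\<And>s. s \<in> {a..b} \<Longrightarrow> (\<gamma> has_vector_derivative \<gamma>' s) (at s within {a..b})"
    and \<gamma>': "\<And>s. s \<in> {a..b} \<Longrightarrow> (\<gamma>' has_vector_derivative \<gamma>'' s) (at s within {a..b})"
    and K: "\<And>s. s \<in> {a..b} \<Longrightarrow> \<bar>f (\<gamma> s)\<bar> \<le> K" "\<And>s. s \<in> {a..b} \<Longrightarrow> norm (f' (\<gamma> s)) \<le> K"
      "\<And>s. s \<in> {a..b} \<Longrightarrow> norm (f'' (\<gamma> s)) \<le> K"
    and g: "\<And>s. s \<in> {a..b} \<Longrightarrow> norm (\<gamma>' s) \<le> 1" "\<And>s. s \<in> {a..b} \<Longrightarrow> norm (\<gamma>'' s) \<le> G"
  shows "C11_on {a..b} K K (K + K * G) (\<lambda>s. f (\<gamma> s))"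
  unfolding C11_on_def
proof (intro exI[of _ "\<lambda>s. f' (\<gamma> s) (\<gamma>' s)"] conjI ballI)
  note d = C2_on_curve[OF f E \<gamma> \<gamma>']
  fix s assume s: "s \<in> {a..b}"
  have K0: "K \<ge> 0" using K(1)[OF s] by linarith
  show "((\<lambda>s. f (\<gamma> s)) has_real_derivative f' (\<gamma> s) (\<gamma>' s)) (at s within {a..b})"
    by (rule d(1)) (use s in auto)
  show "\<bar>f (\<gamma> s)\<bar> \<le> K" by (rule K(1)[OF s])
  have app: "\<bar>blinfun_apply B v\<bar> \<le> k * l" if "norm B \<le> k" "norm v \<le> l" "0 \<le> k" for B :: "'a \<Rightarrow>\<^sub>L real" and v k l
    using norm_blinfun[of B v] mult_mono[OF that(1,2)] that(3) by simp
  show "\<bar>f' (\<gamma> s) (\<gamma>' s)\<bar> \<le> K" using app[OF K(2)[OF s] g(1)[OF s] K0] by simp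
  fix t assume t: "t \<in> {a..b}"
  have "norm (f' (\<gamma> s) (\<gamma>' s) - f' (\<gamma> t) (\<gamma>' t)) \<le> (K + K * G) * norm (s - t)"
  proof (rule field_differentiable_bound[of "{a..b}" _ "\<lambda>s. f'' (\<gamma> s) (\<gamma>' s) (\<gamma>' s) + f' (\<gamma> s) (\<gamma>'' s)"])
    fix s assume s: "s \<in> {a..b}"
    show "((\<lambda>s. f' (\<gamma> s) (\<gamma>' s)) has_real_derivative
           f'' (\<gamma> s) (\<gamma>' s) (\<gamma>' s) + f' (\<gamma> s) (\<gamma>'' s)) (at s within {a..b})"
      by (rule d(2)) (use s in auto)
    have "norm (f'' (\<gamma> s) (\<gamma>' s)) \<le> K * 1"
      using norm_blinfun[of "f'' (\<gamma> s)" "\<gamma>' s"] mult_mono[OF K(3)[OF s] g(1)[OF s]] K0 by simp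
    then have "\<bar>f'' (\<gamma> s) (\<gamma>' s) (\<gamma>' s)\<bar> \<le> K" using app[OF _ g(1)[OF s] K0] by simp
    moreover have "\<bar>f' (\<gamma> s) (\<gamma>'' s)\<bar> \<le> K * G" using app[OF K(2)[OF s] g(2)[OF s] K0] .
    ultimately show "norm (f'' (\<gamma> s) (\<gamma>' s) (\<gamma>' s) + f' (\<gamma> s) (\<gamma>'' s)) \<le> K + K * G" by simp
  qed (use s t in auto)
  then show "\<bar>f' (\<gamma> s) (\<gamma>' s) - f' (\<gamma> t) (\<gamma>' t)\<bar> \<le> (K + K * G) * \<bar>s - t\<bar>" by simp
qed

text \<open>The equation provides its own derivative \<open>D\<close>; uniqueness of derivatives on
  a nondegenerate interval identifies it with the one hidden in \<open>C11_on\<close>, although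
  \<open>D\<close> is only one-sided.\<close>

lemma Taylor_C11:
  assumes f: "C11_on {a..a + h} K0 K1 K f" and h: "h > 0"
    and d: "(f has_real_derivative D) (at a within {a..a + h})"
  shows "\<bar>f (a + h) - f a - h * D\<bar> \<le> K * h\<^sup>2"
    and "\<bar>f (a + h) - f a\<bar> \<le> K1 * h"
proof -
  obtain f' where f': "\<And>s. s \<in> {a..a + h} \<Longrightarrow> (f has_real_derivative f' s) (at s within {a..a + h})"
      "\<And>s. s \<in> {a..a + h} \<Longrightarrow> \<bar>f' s\<bar> \<le> K1"
      "\<And>s t. s \<in> {a..a + h} \<Longrightarrow> t \<in> {a..a + h} \<Longrightarrow> \<bar>f' s - f' t\<bar> \<le> K * \<bar>s - t\<bar>"
    using f unfolding C11_on_def by blast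
  have a: "a \<in> {a..a + h}" "a + h \<in> {a..a + h}" using h by auto
  have D: "D = f' a"
    using vector_derivative_unique_within_closed_interval[of a "a + h" a f D "f' a"] h d f'(1)[OF a(1)]
    by (simp add: has_real_derivative_iff_has_vector_derivative)
  have "0 \<le> K * h" using f'(3)[OF a(2,1)] h abs_ge_zero[of "f' (a + h) - f' a"] by simp
  then have "0 \<le> K" using h by (simp add: zero_le_mult_iff)
  then have "K / 2 * h\<^sup>2 \<le> K * h\<^sup>2" by (intro mult_right_mono) auto
  then show "\<bar>f (a + h) - f a - h * D\<bar> \<le> K * h\<^sup>2"
    using Taylor_Lipschitz[OF f'(1) f'(3) a(1) a(2)] a(1) D by (simp add: mult.commute)
  show "\<bar>f (a + h) - f a\<bar> \<le> K1 * h"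
    using field_differentiable_bound[of "{a..a + h}" f f' K1 "a + h" a] f' a h by auto
qed

text \<open>Both derivatives are again multiples of \<open>sph_dir\<close>, so differentiating twice
  is a further shift by pi/2, and \<open>norm_sph_dir\<close> bounds speed and acceleration by
  1.\<close>

lemma sph_dir_derivs:
  shows "((\<lambda>\<theta>. sph_dir \<theta> \<phi>) has_vector_derivative sph_dir (\<theta> + pi / 2) \<phi>) (at \<theta> within A)"
    and "((\<lambda>\<phi>. sph_dir \<theta> \<phi>) has_vector_derivative sin \<theta> *\<^sub>R sph_dir (pi / 2) (\<phi> + pi / 2)) (at \<phi> within A)"
proof -
  have e: "sph_dir \<theta> \<phi> = (sin \<theta> * cos \<phi>) *\<^sub>R axis 1 1 + (sin \<theta> * sin \<phi>) *\<^sub>R axis 2 1 + cos \<theta> *\<^sub>R axis 3 1" for \<theta> \<phi>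
    by (simp add: sph_dir_def vec_eq_iff forall_3 axis_def)
  have s: "((\<lambda>s. f s *\<^sub>R v) has_vector_derivative f' *\<^sub>R v) (at s within A)"
    if "(f has_real_derivative f') (at s within A)" for f f' s and v :: "real^3"
    using has_vector_derivative_scaleR[OF that has_vector_derivative_const[of v]] by simp
  show "((\<lambda>\<theta>. sph_dir \<theta> \<phi>) has_vector_derivative sph_dir (\<theta> + pi / 2) \<phi>) (at \<theta> within A)"
    unfolding e
    by (intro has_vector_derivative_add s) (auto intro!: derivative_eq_intros simp: sin_add cos_add)
  have e2: "sin \<theta> *\<^sub>R sph_dir (pi / 2) (\<phi> + pi / 2) = (- sin \<theta> * sin \<phi>) *\<^sub>R axis 1 1 + (sin \<theta> * cos \<phi>) *\<^sub>R axis 2 1 + 0 *\<^sub>R axis 3 1"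
    by (simp add: sph_dir_def vec_eq_iff forall_3 axis_def sin_add cos_add)
  show "((\<lambda>\<phi>. sph_dir \<theta> \<phi>) has_vector_derivative sin \<theta> *\<^sub>R sph_dir (pi / 2) (\<phi> + pi / 2)) (at \<phi> within A)"
    unfolding e2 unfolding e
    by (intro has_vector_derivative_add s) (auto intro!: derivative_eq_intros)
qed

lemma has_vector_derivative_shift:
  assumes "\<And>s. (f has_vector_derivative f' s) (at s)"
  shows "((\<lambda>s. f (s + c)) has_vector_derivative f' (s + c)) (at s within A)"
proof -
  have "((\<lambda>s. s + c) has_vector_derivative 1) (at s within A)"
    using has_vector_derivative_add[OF has_vector_derivative_id has_vector_derivative_const[of c]] by simp
  from vector_diff_chain_within[OF this has_vector_derivative_at_within[OF assms]]
  show ?thesis by (simp add: o_def)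
qed

lemma norm_sph_dir [simp]: "norm (sph_dir \<theta> \<phi>) = 1"
  using sph_dir_in_S2[of \<theta> \<phi>] by simp

text \<open>Moving against the sign of \<open>\<xi> $ d\<close> along axis \<open>d\<close> can only
  reach the face through which \<xi> enters. The other coordinates stay strictly inside, so the face
  is met in its relative interior, where the normal exists.\<close>

lemma upwind_segment:
  assumes z: "(x, \<xi>) \<in> phase_space L" and s: "0 \<le> s"
    "\<xi> $ d > 0 \<Longrightarrow> s \<le> x $ d" "\<xi> $ d < 0 \<Longrightarrow> s \<le> L $ d - x $ d"
    and d: "\<xi> $ d \<noteq> 0"
  shows "(x - (s * sgn (\<xi> $ d)) *\<^sub>R axis d 1, \<xi>) \<in> phase_space L \<union> inflow L"
proof -
  define y where "y = x - (s * sgn (\<xi> $ d)) *\<^sub>R axis d 1"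
  have x: "0 < x $ j" "x $ j < L $ j" for j
    using z by (auto simp: phase_space_def mem_box_cart)
  have y: "y $ d = x $ d - s * sgn (\<xi> $ d)" "\<And>j. j \<noteq> d \<Longrightarrow> y $ j = x $ j"
    by (auto simp: y_def axis_def)
  have "(y, \<xi>) \<in> phase_space L \<union> inflow L"
  proof (cases "0 < y $ d \<and> y $ d < L $ d")
    case True
    have "0 < y $ j \<and> y $ j < L $ j" for j
    proof (cases "j = d")
      case False
      then show ?thesis unfolding y(2)[OF False] using x by simp
    qed (use True in simp)
    then show ?thesis using z by (auto simp: phase_space_def mem_box_cart)
  next
    case False
    then have "y $ d = 0 \<and> \<xi> $ d > 0 \<or> y $ d = L $ d \<and> \<xi> $ d < 0"
      using s x[of d] d unfolding y(1) by (cases "\<xi> $ d > 0") auto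
    then have "\<exists>n. outward_normal L y n \<and> n \<bullet> \<xi> < 0"
    proof (elim disjE conjE)
      assume "y $ d = 0" "\<xi> $ d > 0"
      then show ?thesis
        by (intro exI[of _ "- axis d 1"])
          (use x y(2) in \<open>auto simp: outward_normal_def inner_axis' intro!: exI[of _ d]\<close>)
    next
      assume "y $ d = L $ d" "\<xi> $ d < 0"
      then show ?thesis
        by (intro exI[of _ "axis d 1"])
          (use x y(2) in \<open>auto simp: outward_normal_def inner_axis' intro!: exI[of _ d]\<close>)
    qed
    then show ?thesis using z by (auto simp: inflow_def phase_space_def)
  qed
  then show ?thesis by (simp add: y_def)
qed

section \<open>Taylor estimates for the exact solution along angles, axes and time\<close>

locale smooth_solution =
  fixes L :: "real^3" and T :: real and I :: "real \<Rightarrow> real^3 \<Rightarrow> real^3 \<Rightarrow> real"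
    and J' :: "real \<times> (real^3) \<times> (real^3) \<Rightarrow> (real \<times> (real^3) \<times> (real^3)) \<Rightarrow>\<^sub>L real"
    and J'' :: "real \<times> (real^3) \<times> (real^3) \<Rightarrow> (real \<times> (real^3) \<times> (real^3)) \<Rightarrow>\<^sub>L (real \<times> (real^3) \<times> (real^3)) \<Rightarrow>\<^sub>L real"
    and K :: real
  assumes C2: "C2_on {(t, x, y). y \<noteq> 0 \<and> (t, x, sgn y) \<in> {0..<T} \<times> (phase_space L \<union> inflow L)}
      (\<lambda>(t, x, y). I t x (sgn y)) J' J''"
    and bounds: "\<And>t x \<xi>. t \<in> {0..<T} \<Longrightarrow> (x, \<xi>) \<in> phase_space L \<union> inflow L \<Longrightarrow>
      \<bar>I t x \<xi>\<bar> \<le> K \<and> norm (J' (t, x, \<xi>)) \<le> K \<and> norm (J'' (t, x, \<xi>)) \<le> K"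
begin

lemma direction_unit: "(x, \<xi>) \<in> phase_space L \<union> inflow L \<Longrightarrow> \<xi> \<noteq> 0 \<and> sgn \<xi> = \<xi>"
  by (auto simp: phase_space_def inflow_def sgn_div_norm)

lemma C11_on_solution_curve:
  assumes E: "\<And>s. s \<in> {a..b} \<Longrightarrow> \<tau> s \<in> {0..<T} \<and> (\<chi>' s, \<eta> s) \<in> phase_space L \<union> inflow L"
    and \<gamma>: "\<And>s. s \<in> {a..b} \<Longrightarrow> ((\<lambda>s. (\<tau> s, \<chi>' s, \<eta> s)) has_vector_derivative \<gamma>' s) (at s within {a..b})"
    and \<gamma>': "\<And>s. s \<in> {a..b} \<Longrightarrow> (\<gamma>' has_vector_derivative \<gamma>'' s) (at s within {a..b})"
    and g: "\<And>s. s \<in> {a..b} \<Longrightarrow> norm (\<gamma>' s) \<le> 1" "\<And>s. s \<in> {a..b} \<Longrightarrow> norm (\<gamma>'' s) \<le> G"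
  shows "C11_on {a..b} K K (K + K * G) (\<lambda>s. I (\<tau> s) (\<chi>' s) (\<eta> s))"
proof -
  have "C11_on {a..b} K K (K + K * G) (\<lambda>s. (\<lambda>(t, x, y). I t x (sgn y)) (\<tau> s, \<chi>' s, \<eta> s))"
    by (rule C11_on_curve[OF C2 _ \<gamma> \<gamma>' _ _ _ g]) (use E direction_unit bounds in \<open>auto; metis\<close>)+
  moreover have "sgn (\<eta> s) = \<eta> s" if "s \<in> {a..b}" for s using E[OF that] direction_unit by blast
  ultimately show ?thesis using C11_on_cong by fastforce
qed

lemma K_nonneg:
  assumes "t \<in> {0..<T}" "(x, \<xi>) \<in> phase_space L \<union> inflow L"
  shows "0 \<le> K"
  using bounds[OF assms] by linarith

lemma solution_theta:
  assumes "t \<in> {0..<T}" "x \<in> box 0 L"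
  shows "C11_on {a..b} K K (2 * K) (\<lambda>\<theta>. I t x (sph_dir \<theta> \<phi>))"
proof -
  have "C11_on {a..b} K K (K + K * 1) (\<lambda>\<theta>. I t x (sph_dir \<theta> \<phi>))"
  proof (rule C11_on_solution_curve[where \<gamma>'="\<lambda>\<theta>. (0, 0, sph_dir (\<theta> + pi / 2) \<phi>)"
        and \<gamma>''="\<lambda>\<theta>. (0, 0, sph_dir (\<theta> + pi / 2 + pi / 2) \<phi>)"])
    fix s :: real
    show "((\<lambda>s. (t, x, sph_dir s \<phi>)) has_vector_derivative (0, 0, sph_dir (s + pi / 2) \<phi>)) (at s within {a..b})"
      by (intro has_vector_derivative_Pair has_vector_derivative_const sph_dir_derivs)
    have "((\<lambda>s. sph_dir (s + pi / 2) \<phi>) has_vector_derivative sph_dir (s + pi / 2 + pi / 2) \<phi>) (at s within {a..b})"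
      by (rule has_vector_derivative_shift) (rule sph_dir_derivs)
    then show "((\<lambda>s. (0 :: real, 0 :: real^3, sph_dir (s + pi / 2) \<phi>)) has_vector_derivative
        (0, 0, sph_dir (s + pi / 2 + pi / 2) \<phi>)) (at s within {a..b})"
      by (intro has_vector_derivative_Pair has_vector_derivative_const)
  qed (use assms in \<open>simp_all add: phase_space_def norm_Pair abs_sin_le_one\<close>)
  then show ?thesis by simp
qed

lemma solution_phi:
  assumes "t \<in> {0..<T}" "x \<in> box 0 L"
  shows "C11_on {a..b} K K (2 * K) (\<lambda>\<phi>. I t x (sph_dir \<theta> \<phi>))"
proof -
  have "C11_on {a..b} K K (K + K * 1) (\<lambda>\<phi>. I t x (sph_dir \<theta> \<phi>))"
  proof (rule C11_on_solution_curve[where \<gamma>'="\<lambda>\<phi>. (0, 0, sin \<theta> *\<^sub>R sph_dir (pi / 2) (\<phi> + pi / 2))"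
        and \<gamma>''="\<lambda>\<phi>. (0, 0, sin \<theta> *\<^sub>R sph_dir (pi / 2) (\<phi> + pi / 2 + pi / 2))"])
    fix s :: real
    show "((\<lambda>s. (t, x, sph_dir \<theta> s)) has_vector_derivative (0, 0, sin \<theta> *\<^sub>R sph_dir (pi / 2) (s + pi / 2))) (at s within {a..b})"
      by (intro has_vector_derivative_Pair has_vector_derivative_const sph_dir_derivs)
    have "((\<lambda>s. sph_dir (pi / 2) (s + pi / 2)) has_vector_derivative sph_dir (pi / 2) (s + pi / 2 + pi / 2)) (at s within {a..b})"
      by (rule has_vector_derivative_shift) (use sph_dir_derivs(2)[of "pi / 2"] in simp)
    then have "((\<lambda>s. sin \<theta> *\<^sub>R sph_dir (pi / 2) (s + pi / 2)) has_vector_derivative sin \<theta> *\<^sub>R sph_dir (pi / 2) (s + pi / 2 + pi / 2)) (at s within {a..b})"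
      by (rule bounded_linear.has_vector_derivative[OF bounded_linear_scaleR_right])
    then show "((\<lambda>s. (0 :: real, 0 :: real^3, sin \<theta> *\<^sub>R sph_dir (pi / 2) (s + pi / 2))) has_vector_derivative
        (0, 0, sin \<theta> *\<^sub>R sph_dir (pi / 2) (s + pi / 2 + pi / 2))) (at s within {a..b})"
      by (intro has_vector_derivative_Pair has_vector_derivative_const)
  qed (use assms in \<open>simp_all add: phase_space_def norm_Pair abs_sin_le_one\<close>)
  then show ?thesis by simp
qed

lemma solution_continuous:
  assumes "t \<in> {0..<T}" "x \<in> box 0 L"
  shows "continuous_on S2 (I t x)"
proof -
  let ?E = "{(t, x, y). y \<noteq> 0 \<and> (t, x, sgn y) \<in> {0..<T} \<times> (phase_space L \<union> inflow L)}"
  have "continuous_on ?E (\<lambda>(t, x, y). I t x (sgn y))"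
    using C2 unfolding C2_on_def by (meson has_derivative_continuous_on)
  then have "continuous_on S2 (\<lambda>\<xi>. (\<lambda>(t, x, y). I t x (sgn y)) (t, x, \<xi>))"
    by (rule continuous_on_compose2) (use assms in \<open>auto intro!: continuous_intros simp: phase_space_def sgn_div_norm\<close>)
  then show ?thesis by (rule continuous_on_eq) (auto simp: sgn_div_norm)
qed

text \<open>First-order consistency in one coordinate: Taylor expansion along the straight segment
  to the upwind neighbour, which has no acceleration term (G = 0). Division by \<open>h\<close> and
  |\<xi>_d| \<le> 1 leave K h. If \<xi>_d = 0, both terms vanish.\<close>

lemma space_step:
  assumes t: "t \<in> {0..<T}" and z: "(x, \<xi>) \<in> phase_space L"
    and grad: "GDERIV (\<lambda>y. I t y \<xi>) x :> g"
    and h: "h > 0" "\<xi> $ d > 0 \<Longrightarrow> h \<le> x $ d" "\<xi> $ d < 0 \<Longrightarrow> h \<le> L $ d - x $ d"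
  shows "\<bar>\<bar>\<xi> $ d\<bar> / h * (I t (x - (h * sgn (\<xi> $ d)) *\<^sub>R axis d 1) \<xi> - I t x \<xi>) + \<xi> $ d * g $ d\<bar> \<le> K * h"
proof (cases "\<xi> $ d = 0")
  case True
  then show ?thesis using K_nonneg[OF t, of x \<xi>] z h(1) by simp
next
  case False
  let ?v = "- sgn (\<xi> $ d) *\<^sub>R axis d 1 :: real^3"
  have v: "x + s *\<^sub>R ?v = x - (s * sgn (\<xi> $ d)) *\<^sub>R axis d 1" for s by simp
  have C11: "C11_on {0..0 + h} K K (K + K * 0) (\<lambda>s. I t (x + s *\<^sub>R ?v) \<xi>)"
  proof (rule C11_on_solution_curve[where \<gamma>'="\<lambda>s. (0, ?v, 0)" and \<gamma>''="\<lambda>s. 0"])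
    fix s assume "s \<in> {0..0 + h}"
    then have s: "0 \<le> s" "s \<le> h" by auto
    show "t \<in> {0..<T} \<and> (x + s *\<^sub>R ?v, \<xi>) \<in> phase_space L \<union> inflow L"
      unfolding v using t upwind_segment[OF z s(1), of d] s h False by force
    show "((\<lambda>s. (t, x + s *\<^sub>R ?v, \<xi>)) has_vector_derivative (0, ?v, 0)) (at s within {0..0 + h})"
      by (intro has_vector_derivative_Pair has_vector_derivative_const)
        (auto intro!: derivative_eq_intros simp: has_vector_derivative_def)
  qed (use False in \<open>auto simp: norm_Pair sgn_if intro: has_vector_derivative_const\<close>)
  have "((\<lambda>s. I t (x + s *\<^sub>R ?v) \<xi>) has_real_derivative ?v \<bullet> g) (at 0 within {0..0 + h})"
  proof -
    have "((\<lambda>y. I t y \<xi>) has_derivative (\<lambda>w. w \<bullet> g)) (at (x + 0 *\<^sub>R ?v))"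
      using grad by (simp add: gderiv_def)
    then have "((\<lambda>s. I t (x + s *\<^sub>R ?v) \<xi>) has_derivative (\<lambda>s. (s *\<^sub>R ?v) \<bullet> g)) (at 0 within {0..0 + h})"
      by (rule has_derivative_compose[rotated]) (auto intro!: derivative_eq_intros)
    then show ?thesis unfolding has_field_derivative_def
      by (rule has_derivative_eq_rhs) (auto simp: fun_eq_iff)
  qed
  from Taylor_C11(1)[OF C11 h(1) this]
  have *: "\<bar>I t (x - (h * sgn (\<xi> $ d)) *\<^sub>R axis d 1) \<xi> - I t x \<xi> + h * (sgn (\<xi> $ d) * g $ d)\<bar> \<le> K * h\<^sup>2"
    by (simp add: inner_axis' algebra_simps)
  have le1: "\<bar>\<xi> $ d\<bar> \<le> 1" using component_le_norm_cart[of \<xi> d] z by (auto simp: phase_space_def)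
  have "\<bar>\<xi> $ d\<bar> / h * (I t (x - (h * sgn (\<xi> $ d)) *\<^sub>R axis d 1) \<xi> - I t x \<xi>) + \<xi> $ d * g $ d
      = \<bar>\<xi> $ d\<bar> / h * (I t (x - (h * sgn (\<xi> $ d)) *\<^sub>R axis d 1) \<xi> - I t x \<xi> + h * (sgn (\<xi> $ d) * g $ d))"
    using h(1) by (simp add: field_simps abs_mult_sgn)
  also have "\<bar>\<dots>\<bar> \<le> 1 / h * (K * h\<^sup>2)"
    unfolding abs_mult using le1 h(1) * by (intro mult_mono) (auto simp: divide_right_mono)
  also have "\<dots> = K * h" using h(1) by (simp add: power2_eq_square)
  finally show ?thesis .
qed

text \<open>The step may end at \<open>T\<close>, where the solution is known only as a left limit;
  the estimates hold for all shorter steps and pass to the limit. The second bound serves the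
  absorption term, which the scheme takes at the new time level.\<close>

lemma time_step:
  assumes t: "0 \<le> t" "h > 0" "t + h \<le> T" and z: "(x, \<xi>) \<in> phase_space L"
    and d: "((\<lambda>s. I s x \<xi>) has_real_derivative D) (at t within {0..<T})"
    and lim: "((\<lambda>t. I t x \<xi>) \<longlongrightarrow> I T x \<xi>) (at_left T)"
  shows "\<bar>I (t + h) x \<xi> - I t x \<xi> - h * D\<bar> \<le> K * h\<^sup>2"
    and "\<bar>I (t + h) x \<xi> - I t x \<xi>\<bar> \<le> K * h"
proof -
  have before: "\<bar>I (t + s) x \<xi> - I t x \<xi> - s * D\<bar> \<le> K * s\<^sup>2 \<and> \<bar>I (t + s) x \<xi> - I t x \<xi>\<bar> \<le> K * s"
    if s: "s > 0" "t + s < T" for s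
  proof -
    have C11: "C11_on {t..t + s} K K (K + K * 0) (\<lambda>s. I s x \<xi>)"
      by (rule C11_on_solution_curve[where \<gamma>'="\<lambda>s. (1, 0, 0)" and \<gamma>''="\<lambda>s. 0"])
        (use z s t in \<open>auto simp: norm_Pair intro!: has_vector_derivative_Pair has_vector_derivative_const has_vector_derivative_id\<close>)
    have d': "((\<lambda>s. I s x \<xi>) has_real_derivative D) (at t within {t..t + s})"
      by (rule has_field_derivative_subset[OF d]) (use s t in auto)
    show ?thesis using Taylor_C11[OF C11 s(1) d'] by simp
  qed
  have "\<bar>I (t + h) x \<xi> - I t x \<xi> - h * D\<bar> \<le> K * h\<^sup>2 \<and> \<bar>I (t + h) x \<xi> - I t x \<xi>\<bar> \<le> K * h"
  proof (cases "t + h < T")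
    case False
    then have T: "t + h = T" using t by simp
    have nb: "at_left T \<noteq> bot" by simp
    have ev: "eventually (\<lambda>s. t < s \<and> s < T) (at_left T)"
      using t by (auto simp: eventually_at_left[of t T] intro!: exI[of _ t])
    have "\<bar>I T x \<xi> - I t x \<xi> - (T - t) * D\<bar> \<le> K * (T - t)\<^sup>2"
    proof (rule tendsto_le[OF nb])
      show "((\<lambda>s. \<bar>I s x \<xi> - I t x \<xi> - (s - t) * D\<bar>) \<longlongrightarrow> \<bar>I T x \<xi> - I t x \<xi> - (T - t) * D\<bar>) (at_left T)"
        by (intro tendsto_intros lim)
      show "((\<lambda>s. K * (s - t)\<^sup>2) \<longlongrightarrow> K * (T - t)\<^sup>2) (at_left T)" by (intro tendsto_intros)
      show "eventually (\<lambda>s. \<bar>I s x \<xi> - I t x \<xi> - (s - t) * D\<bar> \<le> K * (s - t)\<^sup>2) (at_left T)"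
        using ev
      proof eventually_elim
        case (elim s)
        then show ?case using before[of "s - t"] by simp
      qed
    qed
    moreover have "\<bar>I T x \<xi> - I t x \<xi>\<bar> \<le> K * (T - t)"
    proof (rule tendsto_le[OF nb])
      show "((\<lambda>s. \<bar>I s x \<xi> - I t x \<xi>\<bar>) \<longlongrightarrow> \<bar>I T x \<xi> - I t x \<xi>\<bar>) (at_left T)"
        by (intro tendsto_intros lim)
      show "((\<lambda>s. K * (s - t)) \<longlongrightarrow> K * (T - t)) (at_left T)" by (intro tendsto_intros)
      show "eventually (\<lambda>s. \<bar>I s x \<xi> - I t x \<xi>\<bar> \<le> K * (s - t)) (at_left T)"
        using ev
      proof eventually_elim
        case (elim s)
        then show ?case using before[of "s - t"] by simp
      qed
    qed
    ultimately show ?thesis using T by (auto simp: algebra_simps)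
  qed (use before t in auto)
  then show "\<bar>I (t + h) x \<xi> - I t x \<xi> - h * D\<bar> \<le> K * h\<^sup>2" "\<bar>I (t + h) x \<xi> - I t x \<xi>\<bar> \<le> K * h" by auto
qed

end

section \<open>Quadrature of the scattering integral\<close>

text \<open>Uniformly in position and direction only the second derivative is controlled. Equal
  values at \<open>c\<close> and \<open>d\<close> give a zero of f' by Rolle, from which integrating
  the bound twice controls f' and f on the whole interval.\<close>

lemma C11_on_of_deriv2_bound:
  fixes f f' :: "real \<Rightarrow> real"
  assumes df: "\<And>s. (f has_real_derivative f' s) (at s)"
    and cont: "continuous_on UNIV f'"
    and fin: "finite {s\<in>{a..b}. \<not> f' field_differentiable at s}"
    and bound: "\<And>s. s \<in> {a..b} \<Longrightarrow> \<bar>(deriv ^^ 2) f s\<bar> \<le> A"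
    and Rolle: "a \<le> c" "c < d" "d \<le> b" "f c = f d"
  shows "C11_on {a..b} (\<bar>f a\<bar> + A * (b - a)\<^sup>2) (A * (b - a)) A f"
proof -
  have "deriv f = f'" using df DERIV_imp_deriv by blast
  then have d2: "(deriv ^^ 2) f = deriv f'" by (simp add: numeral_2_eq_2)
  have lip: "\<bar>f' s - f' t\<bar> \<le> A * \<bar>s - t\<bar>" if "s \<in> {a..b}" "t \<in> {a..b}" for s t
    by (rule Lipschitz_of_deriv_bound[OF continuous_on_subset[OF cont subset_UNIV] fin _ that])
      (use bound d2 in simp)
  obtain z where z: "c < z" "z < d" "f d - f c = (d - c) * f' z"
    using MVT2[OF Rolle(2), of f f'] df by blast
  then have fz: "f' z = 0" "z \<in> {a..b}" using Rolle by auto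
  have A: "0 \<le> A" using bound[OF fz(2)] by linarith
  have f'b: "\<bar>f' s\<bar> \<le> A * (b - a)" if "s \<in> {a..b}" for s
  proof -
    have "\<bar>f' s\<bar> \<le> A * \<bar>s - z\<bar>" using lip[OF that fz(2)] fz(1) by simp
    also have "\<dots> \<le> A * (b - a)" using that fz(2) A by (intro mult_left_mono) auto
    finally show ?thesis .
  qed
  have fb: "\<bar>f s\<bar> \<le> \<bar>f a\<bar> + A * (b - a)\<^sup>2" if s: "s \<in> {a..b}" for s
  proof -
    have "norm (f s - f a) \<le> (A * (b - a)) * norm (s - a)"
      by (rule field_differentiable_bound[of "{a..b}" f f'])
        (use s f'b df in \<open>auto intro: has_field_derivative_at_within\<close>)
    also have "\<dots> \<le> (A * (b - a)) * (b - a)" using s A by (intro mult_left_mono) auto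
    finally show ?thesis by (simp add: power2_eq_square mult.assoc)
  qed
  show ?thesis unfolding C11_on_def
    using lip f'b fb df has_field_derivative_at_within by blast
qed

lemma deriv_periodic:
  fixes f :: "real \<Rightarrow> real"
  assumes "\<And>s. f (s + p) = f s"
  shows "deriv f (s + p) = deriv f s"
proof -
  have "(f has_field_derivative d) (at (s + p)) \<longleftrightarrow> (f has_field_derivative d) (at s)" for d
    unfolding DERIV_shift using assms by simp
  then show ?thesis by (simp add: deriv_def)
qed

section \<open>Kernel bounds uniform in position and direction\<close>

locale scattering =
  fixes L :: "real^3" and pt :: "real^3 \<Rightarrow> real \<Rightarrow> real" and A B :: real
  assumes phase: "phase_function L pt"
    and sup_theta: "sup_theta L pt = ennreal A" "A \<ge> 0"
    and sup_phi: "sup_phi L pt = ennreal B" "B \<ge> 0"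
begin

lemma even_periodic: "x \<in> box 0 L \<Longrightarrow> even_periodic_C2 (pt x)"
  using phase by unfold_locales (auto simp: phase_function_def)

lemma kernel_eq: "kernel pt x (sph_dir \<alpha> \<beta>) (sph_dir \<theta> \<phi>) =
    pt x (arccos (sin \<alpha> * sin \<theta> * cos (\<phi> - \<beta>) + cos \<alpha> * cos \<theta>))"
  by (simp add: kernel_def sph_dir_inner)

lemma cos_angle_le: "\<bar>sin (\<alpha> :: real) * sin \<theta> * cos (\<phi> - \<beta>) + cos \<alpha> * cos \<theta>\<bar> \<le> 1"
  using abs_sph_dir_inner_le[of \<alpha> \<beta> \<theta> \<phi>] by (simp add: sph_dir_inner)

text \<open>Polar coordinates for the two coefficients bring the cosine of the angle to the form R
  cos (\<theta> - d) required by \<open>curve_regular\<close>. The factor sin \<theta> vanishes at 0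
  and pi, which supplies the Rolle condition and removes the boundary value from the bound.\<close>

lemma kernel_theta:
  assumes x: "x \<in> box 0 L" and \<phi>: "\<phi> \<in> {0..2 * pi}"
  shows "C11_on {0..pi} (A * pi\<^sup>2) (A * pi) A (\<lambda>\<theta>. kernel pt x (sph_dir \<alpha> \<beta>) (sph_dir \<theta> \<phi>) * sin \<theta>)"
proof -
  interpret even_periodic_C2 "pt x" using x by (rule even_periodic)
  let ?f = "\<lambda>\<theta>. kernel pt x (sph_dir \<alpha> \<beta>) (sph_dir \<theta> \<phi>) * sin \<theta>"
  obtain R d where Rd: "cos \<alpha> = R * cos d" "sin \<alpha> * cos (\<phi> - \<beta>) = R * sin d"
    using polar_Ex by blast
  have u: "sin \<alpha> * sin s * cos (\<phi> - \<beta>) + cos \<alpha> * cos s = R * cos (s - d) + 0" for s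
  proof -
    have "sin \<alpha> * sin s * cos (\<phi> - \<beta>) = (sin \<alpha> * cos (\<phi> - \<beta>)) * sin s" by simp
    then show ?thesis unfolding Rd by (simp add: cos_diff algebra_simps)
  qed
  have u1: "\<bar>R * cos (s - d) + 0\<bar> \<le> 1" for s using cos_angle_le[of \<alpha> s \<phi> \<beta>] unfolding u .
  define F where "F = (\<lambda>s. pt x (arccos (R * cos (s - d) + 0)))"
  define D where "D = (\<lambda>s. deriv (pt x) (arccos (R * cos (s - d) + 0)) /
    sin (arccos (R * cos (s - d) + 0)) * (R * sin (s - d)))"
  have D: "(F has_real_derivative D s) (at s)" "continuous_on UNIV D"
    "finite {s\<in>{0..pi}. \<not> D field_differentiable at s}" for s
    unfolding F_def D_def by (rule curve_regular[OF u1])+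
  have f: "?f = (\<lambda>s. F s * sin s)" by (simp add: kernel_eq u F_def)
  let ?f' = "\<lambda>s. D s * sin s + cos s * F s"
  have cF: "F field_differentiable at s" for s using D(1) field_differentiable_def by blast
  have "C11_on {0..pi} (\<bar>?f 0\<bar> + A * (pi - 0)\<^sup>2) (A * (pi - 0)) A ?f"
  proof (rule C11_on_of_deriv2_bound[where f="?f" and f'="?f'" and a=0 and b=pi and c=0 and d=pi])
    show "(?f has_real_derivative ?f' s) (at s)" for s
      unfolding f using D(1) by (rule DERIV_mult) (rule DERIV_sin)
    have "continuous_on UNIV F" using D(1) by (meson DERIV_continuous_on has_field_derivative_at_within)
    then show "continuous_on UNIV ?f'" using D(2) by (intro continuous_intros)
    have "?f' field_differentiable at s" if "D field_differentiable at s" for s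
      using that cF field_differentiable_at_sin field_differentiable_at_cos
      by (intro field_differentiable_add field_differentiable_mult)
    then show "finite {s\<in>{0..pi}. \<not> ?f' field_differentiable at s}"
      by (intro finite_subset[OF _ D(3)]) blast
    show "\<bar>(deriv ^^ 2) ?f s\<bar> \<le> A" if s: "s \<in> {0..pi}" for s
    proof -
      have "ennreal \<bar>(deriv ^^ 2) ?f s\<bar> \<le> sup_theta L pt"
        unfolding sup_theta_def
        by (rule SUP_upper2[of "(x, sph_dir \<alpha> \<beta>, s, \<phi>)"])
          (use x s \<phi> sph_dir_in_S2 in \<open>auto simp: phase_space_def\<close>)
      then show ?thesis using sup_theta by simp
    qed
  qed simp_all
  then show ?thesis by simp
qed

text \<open>The supremum covers only \<phi> in [0, 2 pi]; periodicity of the second derivative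
  extends it to the interval of length 4 pi needed by \<open>composite_periodic\<close>. The value
  at the left end is that at \<phi> = 0, already bounded by \<open>kernel_theta\<close>.\<close>

lemma kernel_phi:
  assumes x: "x \<in> box 0 L" and \<theta>: "\<theta> \<in> {0..pi}"
  shows "C11_on {- (2 * pi)..2 * pi} (A * pi\<^sup>2 + B * (4 * pi)\<^sup>2) (B * (4 * pi)) B
    (\<lambda>\<phi>. kernel pt x (sph_dir \<alpha> \<beta>) (sph_dir \<theta> \<phi>) * sin \<theta>)"
proof -
  interpret even_periodic_C2 "pt x" using x by (rule even_periodic)
  let ?f = "\<lambda>\<phi>. kernel pt x (sph_dir \<alpha> \<beta>) (sph_dir \<theta> \<phi>) * sin \<theta>"
  let ?u = "\<lambda>s. (sin \<alpha> * sin \<theta>) * cos (s - \<beta>) + cos \<alpha> * cos \<theta>"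
  define F where "F = (\<lambda>s. pt x (arccos (?u s)))"
  define D where "D = (\<lambda>s. deriv (pt x) (arccos ((sin \<alpha> * sin \<theta>) * cos (s - \<beta>) + cos \<alpha> * cos \<theta>)) /
    sin (arccos ((sin \<alpha> * sin \<theta>) * cos (s - \<beta>) + cos \<alpha> * cos \<theta>)) * ((sin \<alpha> * sin \<theta>) * sin (s - \<beta>)))"
  have D: "(F has_real_derivative D s) (at s)" "continuous_on UNIV D"
    "finite {s\<in>{- (2 * pi)..2 * pi}. \<not> D field_differentiable at s}" for s
    unfolding F_def D_def by (rule curve_regular[OF cos_angle_le])+
  have f: "?f = (\<lambda>s. F s * sin \<theta>)" by (simp add: kernel_eq F_def)
  have per: "?f (s + 2 * pi) = ?f s" for s
  proof -
    have "cos (s + 2 * pi - \<beta>) = cos (s - \<beta>)"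
      using cos_periodic[of "s - \<beta>"] by (simp add: algebra_simps)
    then show ?thesis by (simp add: kernel_eq)
  qed
  let ?f' = "\<lambda>s. D s * sin \<theta>"
  have nonneg: "\<bar>(deriv ^^ 2) ?f s\<bar> \<le> B" if s: "s \<in> {0..2 * pi}" for s
  proof -
    have "ennreal \<bar>(deriv ^^ 2) ?f s\<bar> \<le> sup_phi L pt"
      unfolding sup_phi_def
      by (rule SUP_upper2[of "(x, sph_dir \<alpha> \<beta>, \<theta>, s)"])
        (use x s \<theta> sph_dir_in_S2 in \<open>auto simp: phase_space_def\<close>)
    then show ?thesis using sup_phi by simp
  qed
  have "C11_on {- (2 * pi)..2 * pi} (\<bar>?f (- (2 * pi))\<bar> + B * (2 * pi - - (2 * pi))\<^sup>2) (B * (2 * pi - - (2 * pi))) B ?f"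
  proof (rule C11_on_of_deriv2_bound[where f="?f" and f'="?f'" and a="- (2 * pi)" and b="2 * pi" and c=0 and d="2 * pi"])
    show "(?f has_real_derivative ?f' s) (at s)" for s
      unfolding f using D(1) by (rule DERIV_cmult_right)
    show "continuous_on UNIV ?f'" using D(2) by (intro continuous_intros)
    have "?f' field_differentiable at s" if "D field_differentiable at s" for s
      using that by (intro field_differentiable_mult field_differentiable_const)
    then show "finite {s\<in>{- (2 * pi)..2 * pi}. \<not> ?f' field_differentiable at s}"
      by (intro finite_subset[OF _ D(3)]) blast
    show "\<bar>(deriv ^^ 2) ?f s\<bar> \<le> B" if s: "s \<in> {- (2 * pi)..2 * pi}" for s
    proof (cases "s < 0")
      case True
      have "(deriv ^^ 2) ?f (s + 2 * pi) = (deriv ^^ 2) ?f s"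
        using deriv_periodic[of "deriv ?f", OF deriv_periodic[of ?f, OF per]] by (simp add: numeral_2_eq_2)
      then show ?thesis using nonneg[of "s + 2 * pi"] s True by simp
    qed (use nonneg s in auto)
    show "?f 0 = ?f (2 * pi)" using per[of 0, symmetric] by simp
  qed auto
  moreover have "\<bar>?f (- (2 * pi))\<bar> \<le> A * pi\<^sup>2"
  proof -
    have "?f (- (2 * pi)) = ?f 0" using per[of "- (2 * pi)", symmetric] by (simp only: left_minus)
    moreover have "\<bar>?f 0\<bar> \<le> A * pi\<^sup>2"
      using kernel_theta[OF x, of 0 \<alpha> \<beta>] \<theta> unfolding C11_on_def by auto
    ultimately show ?thesis by (simp only:)
  qed
  ultimately show ?thesis by (auto elim!: C11_on_mono)
qed

lemma kernel_continuous:
  assumes x: "x \<in> box 0 L"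
  shows "continuous_on S (\<lambda>(\<theta>, \<phi>). kernel pt x (sph_dir \<alpha> \<beta>) (sph_dir \<theta> \<phi>))"
    and "continuous_on S2 (kernel pt x (sph_dir \<alpha> \<beta>))"
    and "continuous_on {-1..1} (\<lambda>u. pt x (arccos u))"
proof -
  interpret even_periodic_C2 "pt x" using x by (rule even_periodic)
  show c: "continuous_on {-1..1} (\<lambda>u. pt x (arccos u))"
    by (rule continuous_on_compose2[OF cont_h[of UNIV]]) (auto intro: continuous_on_arccos')
  show "continuous_on S (\<lambda>(\<theta>, \<phi>). kernel pt x (sph_dir \<alpha> \<beta>) (sph_dir \<theta> \<phi>))"
    using continuous_on_zonal[OF c] unfolding kernel_def .
  have "\<bar>sph_dir \<alpha> \<beta> \<bullet> \<xi>\<bar> \<le> 1" if "\<xi> \<in> S2" for \<xi>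
    using Cauchy_Schwarz_ineq2[of "sph_dir \<alpha> \<beta>" \<xi>] sph_dir_in_S2[of \<alpha> \<beta>] that by simp
  then show "continuous_on S2 (kernel pt x (sph_dir \<alpha> \<beta>))"
    unfolding kernel_def
    by (intro continuous_on_compose2[OF c]) (auto intro!: continuous_intros simp: abs_le_iff minus_le_iff)
qed

text \<open>By \<open>zonal_integral\<close> the exact integral equals the normalisation integral of
  \<open>pt\<close> for every direction, hence is 1; what remains is the quadrature error.\<close>

lemma sum_kernel_le:
  assumes x: "x \<in> box 0 L" and M: "M > 0" and N: "N > 0"
  shows "dtheta M * dphi N * (\<Sum>i=1..int M - 1. \<Sum>j=0..int N - 1.
      kernel pt x (sph_dir \<alpha> \<beta>) (grid_dir M N i j) * sin (of_int i * dtheta M))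
    \<le> 1 + pi\<^sup>2 / 6 * (A * (dtheta M)\<^sup>2 + B * ((dphi N)\<^sup>2 / 2))"
proof -
  let ?F = "\<lambda>\<theta> \<phi>. kernel pt x (sph_dir \<alpha> \<beta>) (sph_dir \<theta> \<phi>) * sin \<theta>"
  have "integral {0..pi} (\<lambda>\<theta>. integral {0..2 * pi} (?F \<theta>)) = 2 * pi * integral {0..pi} (\<lambda>\<theta>. pt x (arccos (cos \<theta>)) * sin \<theta>)"
    unfolding kernel_def by (rule zonal_integral[OF kernel_continuous(3)[OF x]])
  also have "integral {0..pi} (\<lambda>\<theta>. pt x (arccos (cos \<theta>)) * sin \<theta>) = integral {0..pi} (\<lambda>\<theta>. pt x \<theta> * sin \<theta>)"
    by (rule Henstock_Kurzweil_Integration.integral_cong) (simp add: arccos_cos)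
  also have "2 * pi * \<dots> = 1" using phase x by (simp add: phase_function_def)
  finally have 1: "integral {0..pi} (\<lambda>\<theta>. integral {0..2 * pi} (?F \<theta>)) = 1" .
  have "\<bar>integral {0..pi} (\<lambda>\<theta>. integral {0..2 * pi} (?F \<theta>))
      - dtheta M * dphi N * (\<Sum>i=1..int M - 1. \<Sum>j=0..int N - 1. ?F (of_int i * dtheta M) (of_int j * dphi N))\<bar>
    \<le> pi\<^sup>2 / 6 * (A * (dtheta M)\<^sup>2 + B * ((dphi N)\<^sup>2 / 2))"
  proof (rule quadrature_2d[OF _ kernel_theta[OF x] _ _ kernel_phi[OF x] _ M N])
    show "continuous_on UNIV (\<lambda>(\<theta>, \<phi>). ?F \<theta> \<phi>)"
      using kernel_continuous(1)[OF x, of UNIV \<alpha> \<beta>] unfolding case_prod_unfold by (intro continuous_intros)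
    show "?F \<theta> (\<phi> + 2 * pi) = ?F \<theta> \<phi>" for \<theta> \<phi>
      using cos_periodic[of "\<phi> - \<beta>"] by (simp add: kernel_eq algebra_simps)
  qed auto
  then show ?thesis unfolding 1 grid_dir_def by linarith
qed

lemma kernel_nonneg: "x \<in> box 0 L \<Longrightarrow> 0 \<le> kernel pt x \<xi> \<xi>'"
  using phase by (simp add: phase_function_def kernel_def)

text \<open>The constant collects the product rule for \<open>(p sin \<theta>) I\<close> in the two quadrature directions.\<close>

definition quad_const :: "real \<Rightarrow> real" where
  "quad_const K = pi\<^sup>2 / 6 * ((A * K + 2 * (A * pi) * K + A * pi\<^sup>2 * (2 * K)) +
     (B * K + 2 * (B * (4 * pi)) * K + (A * pi\<^sup>2 + B * (4 * pi)\<^sup>2) * (2 * K)))"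

lemma scattering_quadrature:
  assumes x: "x \<in> box 0 L" and M: "M > 0" and N: "N > 0" and K: "K \<ge> 0"
    and w: "continuous_on S2 w"
      "\<And>\<phi>. C11_on {0..pi} K K (2 * K) (\<lambda>\<theta>. w (sph_dir \<theta> \<phi>))"
      "\<And>\<theta>. C11_on {- (2 * pi)..2 * pi} K K (2 * K) (\<lambda>\<phi>. w (sph_dir \<theta> \<phi>))"
  shows "\<bar>(\<integral>\<xi>'. kernel pt x (sph_dir \<alpha> \<beta>) \<xi>' * w \<xi>' \<partial>sphere_measure) -
    dtheta M * dphi N * (\<Sum>i=1..int M - 1. \<Sum>j=0..int N - 1.
      kernel pt x (sph_dir \<alpha> \<beta>) (grid_dir M N i j) * sin (of_int i * dtheta M) * w (grid_dir M N i j))\<bar>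
    \<le> quad_const K * ((dtheta M)\<^sup>2 + (dphi N)\<^sup>2)"
proof -
  let ?F = "\<lambda>\<theta> \<phi>. kernel pt x (sph_dir \<alpha> \<beta>) (sph_dir \<theta> \<phi>) * sin \<theta> * w (sph_dir \<theta> \<phi>)"
  let ?X = "A * K + 2 * (A * pi) * K + A * pi\<^sup>2 * (2 * K)"
  let ?Y = "B * K + 2 * (B * (4 * pi)) * K + (A * pi\<^sup>2 + B * (4 * pi)\<^sup>2) * (2 * K)"
  have cw: "continuous_on UNIV (\<lambda>(\<theta>, \<phi>). w (sph_dir \<theta> \<phi>))"
    unfolding case_prod_unfold
    by (rule continuous_on_compose2[OF w(1)]) (auto intro!: continuous_intros simp: sph_dir_in_S2[simplified])
  have "(\<integral>\<xi>'. kernel pt x (sph_dir \<alpha> \<beta>) \<xi>' * w \<xi>' \<partial>sphere_measure) = integral {0..pi} (\<lambda>\<theta>. integral {0..2 * pi} (?F \<theta>))"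
    by (subst integral_sphere_measure) (auto intro!: continuous_intros kernel_continuous x w simp: mult_ac)
  moreover have "\<bar>integral {0..pi} (\<lambda>\<theta>. integral {0..2 * pi} (?F \<theta>))
      - dtheta M * dphi N * (\<Sum>i=1..int M - 1. \<Sum>j=0..int N - 1. ?F (of_int i * dtheta M) (of_int j * dphi N))\<bar>
    \<le> pi\<^sup>2 / 6 * (?X * (dtheta M)\<^sup>2 + ?Y * ((dphi N)\<^sup>2 / 2))"
  proof (rule quadrature_2d[OF _ C11_on_mult[OF kernel_theta[OF x] w(2) refl] _ _ C11_on_mult[OF kernel_phi[OF x] w(3) refl] _ M N])
    show "continuous_on UNIV (\<lambda>(\<theta>, \<phi>). ?F \<theta> \<phi>)"
      using kernel_continuous(1)[OF x, of UNIV \<alpha> \<beta>] cw unfolding case_prod_unfold by (intro continuous_intros)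
    have "sph_dir \<theta> (\<phi> + 2 * pi) = sph_dir \<theta> \<phi>" for \<theta> \<phi> by (simp add: sph_dir_def)
    then show "?F \<theta> (\<phi> + 2 * pi) = ?F \<theta> \<phi>" for \<theta> \<phi> by simp
  qed auto
  moreover have "pi\<^sup>2 / 6 * (?X * (dtheta M)\<^sup>2 + ?Y * ((dphi N)\<^sup>2 / 2)) \<le> quad_const K * ((dtheta M)\<^sup>2 + (dphi N)\<^sup>2)"
  proof -
    have XY: "0 \<le> ?X" "0 \<le> ?Y" using K sup_theta(2) sup_phi(2) by auto
    have "?X * (dtheta M)\<^sup>2 \<le> (?X + ?Y) * (dtheta M)\<^sup>2" by (rule mult_right_mono) (use XY in auto)
    moreover have "?Y * ((dphi N)\<^sup>2 / 2) \<le> (?X + ?Y) * (dphi N)\<^sup>2" by (rule mult_mono) (use XY in auto)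
    ultimately have "?X * (dtheta M)\<^sup>2 + ?Y * ((dphi N)\<^sup>2 / 2) \<le> (?X + ?Y) * ((dtheta M)\<^sup>2 + (dphi N)\<^sup>2)"
      unfolding distrib_left[of "?X + ?Y"] by linarith
    then have "pi\<^sup>2 / 6 * (?X * (dtheta M)\<^sup>2 + ?Y * ((dphi N)\<^sup>2 / 2)) \<le> pi\<^sup>2 / 6 * ((?X + ?Y) * ((dtheta M)\<^sup>2 + (dphi N)\<^sup>2))"
      by (rule mult_left_mono) simp
    then show ?thesis unfolding quad_const_def by (simp only: mult.assoc)
  qed
  ultimately show ?thesis unfolding grid_dir_def by simp
qed

end

section \<open>Stability and convergence of the scheme\<close>

lemma upwind_form:
  fixes \<xi> h :: real
  shows "- \<xi> * ((p - r) / (2 * h)) + \<bar>\<xi>\<bar> * ((p - 2 * v + r) / (2 * h))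
    = \<bar>\<xi>\<bar> / h * ((if \<xi> > 0 then r else p) - v)"
  by (cases "h = 0") (auto simp: field_simps abs_if)

text \<open>Defined as the integer version of \<open>sgn\<close>. For \<xi> = 0 the shifted point is
  the point itself.\<close>

definition upwind_shift :: "real \<Rightarrow> int" where
  "upwind_shift \<xi> = (if \<xi> > 0 then 1 else if \<xi> < 0 then -1 else 0)"

lemma of_int_upwind_shift: "of_int (upwind_shift \<xi>) = sgn \<xi>"
  by (simp add: upwind_shift_def)

text \<open>The second-difference terms are exactly the numerical viscosity that turns the central
  differences into one-sided ones: the downwind values cancel. Hence no value outside
  \<open>phase_space L \<union> inflow L\<close> contributes.\<close>

lemma A_Delta_upwind:
  "A_Delta L M Mt Mp v i j l m n =
     (let \<xi> = grid_dir Mt Mp m n; h = dx L M in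
      \<bar>\<xi>$1\<bar> / h$1 * (v (i - upwind_shift (\<xi>$1)) j l m n - v i j l m n) +
      \<bar>\<xi>$2\<bar> / h$2 * (v i (j - upwind_shift (\<xi>$2)) l m n - v i j l m n) +
      \<bar>\<xi>$3\<bar> / h$3 * (v i j (l - upwind_shift (\<xi>$3)) m n - v i j l m n))"
proof -
  let ?\<xi> = "grid_dir Mt Mp m n" and ?h = "dx L M"
  have *: "- x * ((p 1 - p (-1)) / (2 * h)) + \<bar>x\<bar> * ((p 1 - 2 * p 0 + p (-1)) / (2 * h))
      = \<bar>x\<bar> / h * (p (- upwind_shift x) - p 0)" for x h :: real and p :: "int \<Rightarrow> real"
    unfolding upwind_form by (auto simp: upwind_shift_def)
  show ?thesis
    using *[of "?\<xi>$1" "\<lambda>d. v (i + d) j l m n" "?h$1"] *[of "?\<xi>$2" "\<lambda>d. v i (j + d) l m n" "?h$2"]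
      *[of "?\<xi>$3" "\<lambda>d. v i j (l + d) m n" "?h$3"]
    unfolding A_Delta_def Let_def by simp
qed

lemma upwind_contraction:
  fixes g :: real
  assumes g: "g \<ge> 0" and a: "a1 \<ge> 0" "a2 \<ge> 0" "a3 \<ge> 0" and CFL: "g * (a1 + a2 + a3) \<le> 1"
    and e: "\<bar>e\<bar> \<le> E" and p: "a1 \<noteq> 0 \<Longrightarrow> \<bar>p1\<bar> \<le> E" "a2 \<noteq> 0 \<Longrightarrow> \<bar>p2\<bar> \<le> E" "a3 \<noteq> 0 \<Longrightarrow> \<bar>p3\<bar> \<le> E"
  shows "\<bar>e + g * (a1 * (p1 - e) + a2 * (p2 - e) + a3 * (p3 - e))\<bar> \<le> E"
proof -
  have b: "\<bar>g * a * p\<bar> \<le> g * a * E" if "a \<ge> 0" "a \<noteq> 0 \<Longrightarrow> \<bar>p\<bar> \<le> E" for a p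
    using that g by (cases "a = 0") (auto simp: abs_mult intro!: mult_left_mono)
  have "\<bar>(1 - g * (a1 + a2 + a3)) * e\<bar> \<le> (1 - g * (a1 + a2 + a3)) * E"
    using CFL e by (simp add: abs_mult mult_left_mono)
  moreover have "e + g * (a1 * (p1 - e) + a2 * (p2 - e) + a3 * (p3 - e))
      = (1 - g * (a1 + a2 + a3)) * e + g * a1 * p1 + g * a2 * p2 + g * a3 * p3"
    by (simp add: algebra_simps)
  moreover have "(1 - g * (a1 + a2 + a3)) * E + g * a1 * E + g * a2 * E + g * a3 * E = E"
    by (simp add: algebra_simps)
  ultimately show ?thesis
    using b[OF a(1) p(1)] b[OF a(2) p(2)] b[OF a(3) p(3)] by linarith
qed

lemma mu_star_le:
  assumes "coefficients L c \<mu>a \<mu>s" "x \<in> box 0 L"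
  shows "\<mu>s x * (1 + mu_star L \<mu>a \<mu>s) \<le> \<mu>s x + \<mu>a x"
proof (cases "\<mu>s x = 0")
  case True
  then show ?thesis using assms by (auto simp: coefficients_def)
next
  case False
  have pos: "\<And>y. y \<in> box 0 L \<Longrightarrow> \<mu>a y \<ge> 0 \<and> \<mu>s y \<ge> 0" using assms(1) by (auto simp: coefficients_def)
  have "mu_star L \<mu>a \<mu>s \<le> \<mu>a x / \<mu>s x"
    unfolding mu_star_def
    by (rule cINF_lower) (use assms(2) False pos in \<open>auto intro!: bdd_belowI2[where m=0]\<close>)
  then show ?thesis using False pos[OF assms(2)] by (simp add: field_simps)
qed

text \<open>Everything independent of the mesh is collected here, so that the truncation constant is
  defined before any discretisation parameter is fixed, as the order of quantifiers in the theorem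
  demands.\<close>

locale transport_problem = smooth_solution L T I J' J'' K + scattering L pt A B
  for L T I J' J'' K pt A B +
  fixes c \<mu>a \<mu>s :: "real^3 \<Rightarrow> real" and q I1 :: "real \<Rightarrow> real^3 \<Rightarrow> real^3 \<Rightarrow> real"
    and I0 :: "real^3 \<Rightarrow> real^3 \<Rightarrow> real" and mb :: real
  assumes T: "T > 0" and L: "\<And>i. L $ i > 0"
    and coefficients: "coefficients L c \<mu>a \<mu>s"
    and mb: "\<And>x. x \<in> box 0 L \<Longrightarrow> \<mu>a x \<le> mb" "\<And>x. x \<in> box 0 L \<Longrightarrow> \<mu>s x \<le> mb"
    and solves: "solves_P3 L T c \<mu>a \<mu>s pt q I0 I1 I"

begin

text \<open>The first \<open>K\<close> comes from the time difference. Inside the bracket,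
  \<open>K * \<Lambda>\<close> comes from the upwind differences, \<open>2 * mb * K\<close> from
  absorption at the new instead of the old time, and the last term from the scattering quadrature;
  \<open>c_plus\<close> appears because the scheme is multiplied by c.\<close>

definition trunc_const :: "real \<Rightarrow> real" where
  "trunc_const \<Lambda> = K + c_plus L c * (K * \<Lambda> + 2 * mb * K + mb * quad_const K)"

end

locale upwind = transport_problem L T I J' J'' K pt A B c \<mu>a \<mu>s q I1 I0 mb
  for L T I J' J'' K pt A B c \<mu>a \<mu>s q I1 I0 mb +
  fixes M :: "nat^3" and Mt Mp :: nat and dt \<Lambda> :: real and u :: "nat \<Rightarrow> grid_fun"
  assumes M: "\<And>i. M $ i > 0" and Mt: "Mt > 0" and Mp: "Mp > 0" and dt: "dt > 0"
    and ratio: "dx L M $ 1 + dx L M $ 2 + dx L M $ 3 = \<Lambda> * dt"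
    and CFL: "c_plus L c * dt / dx L M $ 1 + c_plus L c * dt / dx L M $ 2 + c_plus L c * dt / dx L M $ 3 \<le> 1"
    and angle: "A * (dtheta Mt)\<^sup>2 + B * ((dphi Mp)\<^sup>2 / 2) \<le> 6 / pi\<^sup>2 * mu_star L \<mu>a \<mu>s"
    and final: "T / dt \<in> \<int> \<Longrightarrow> (x, \<xi>) \<in> inflow L \<Longrightarrow> I T x \<xi> = I1 T x \<xi>"
    and scheme: "upwind_scheme L T c \<mu>a \<mu>s pt q I0 I1 M Mt Mp dt u"
begin

section \<open>Exact and discrete values on the grid, and the geometry of interior grid
  points\<close>

abbreviation "X \<equiv> grid_pt L M"
abbreviation "\<Xi> \<equiv> grid_dir Mt Mp"
abbreviation "h \<equiv> dx L M"
abbreviation "grid_dom i j l m n \<equiv> (X i j l, \<Xi> m n) \<in> phase_space L \<union> inflow L"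

definition U :: "nat \<Rightarrow> grid_fun" where
  "U k i j l m n = I (real k * dt) (X i j l) (\<Xi> m n)"

definition err :: "nat \<Rightarrow> grid_fun" where
  "err k i j l m n = U k i j l m n - u k i j l m n"

definition \<delta> :: real where "\<delta> = dt + (dtheta Mt)\<^sup>2 + (dphi Mp)\<^sup>2"

lemma h_pos: "h $ i > 0"
  using L M by (simp add: dx_def)

lemma c_le: "x \<in> box 0 L \<Longrightarrow> 0 < c x \<and> c x \<le> c_plus L c"
  using coefficients unfolding coefficients_def c_plus_def by (auto intro: cSUP_upper)

lemma mu_nonneg: "x \<in> box 0 L \<Longrightarrow> 0 \<le> \<mu>a x \<and> 0 \<le> \<mu>s x"
  using coefficients unfolding coefficients_def by auto

lemma X_nth: "X i j l $ 1 = of_int i * h $ 1" "X i j l $ 2 = of_int j * h $ 2" "X i j l $ 3 = of_int l * h $ 3"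
  by (simp_all add: grid_pt_def)

lemma X_shift:
  "X (i - upwind_shift \<xi>) j l = X i j l - (h $ 1 * sgn \<xi>) *\<^sub>R axis 1 1"
  "X i (j - upwind_shift \<xi>) l = X i j l - (h $ 2 * sgn \<xi>) *\<^sub>R axis 2 1"
  "X i j (l - upwind_shift \<xi>) = X i j l - (h $ 3 * sgn \<xi>) *\<^sub>R axis 3 1"
  by (simp_all add: vec_eq_iff forall_3 X_nth axis_def of_int_upwind_shift algebra_simps)

text \<open>An interior grid point has integer index between 1 and M - 1 in each coordinate, so a
  full mesh width fits on either side.\<close>

lemma grid_gap:
  assumes "X i j l \<in> box 0 L"
  shows "h $ d \<le> X i j l $ d" "h $ d \<le> L $ d - X i j l $ d"
proof -
  have *: "h $ d \<le> of_int i * h $ d \<and> h $ d \<le> L $ d - of_int i * h $ d"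
    if "0 < of_int i * h $ d" "of_int i * h $ d < L $ d" for i d
  proof -
    have Ld: "L $ d = real (M $ d) * h $ d" using M[of d] by (simp add: dx_def)
    have "0 < i" using that(1) h_pos[of d] by (simp add: zero_less_mult_iff)
    moreover have "i < int (M $ d)"
    proof -
      have "real_of_int i < real (M $ d)" using that(2) h_pos[of d] unfolding Ld by (simp add: mult_less_cancel_right_pos)
      then show ?thesis by linarith
    qed
    ultimately have "1 \<le> real_of_int i" "1 \<le> real (M $ d) - real_of_int i" by linarith+
    then have "1 * h $ d \<le> real_of_int i * h $ d" "1 * h $ d \<le> (real (M $ d) - real_of_int i) * h $ d"
      using h_pos[of d] by (intro mult_right_mono; simp)+
    then show ?thesis unfolding Ld by (simp add: left_diff_distrib)
  qed
  have "0 < X i j l $ d \<and> X i j l $ d < L $ d" using assms by (simp add: mem_box_cart)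
  then have "h $ d \<le> X i j l $ d \<and> h $ d \<le> L $ d - X i j l $ d"
    using exhaust_3[of d] *[of i 1] *[of j 2] *[of l 3] by (auto simp: X_nth)
  then show "h $ d \<le> X i j l $ d" "h $ d \<le> L $ d - X i j l $ d" by auto
qed

lemma neighbour:
  assumes z: "(X i j l, \<Xi> m n) \<in> phase_space L" and "\<Xi> m n $ d \<noteq> 0"
  shows "(X i j l - (h $ d * sgn (\<Xi> m n $ d)) *\<^sub>R axis d 1, \<Xi> m n) \<in> phase_space L \<union> inflow L"
proof (rule upwind_segment[OF z _ _ _ assms(2)])
  have "X i j l \<in> box 0 L" using z by (simp add: phase_space_def)
  then show "h $ d \<le> X i j l $ d" "h $ d \<le> L $ d - X i j l $ d" by (rule grid_gap)+
qed (use h_pos[of d] in simp)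

lemma comp_le_1: "\<bar>\<Xi> m n $ d\<bar> \<le> 1"
  using component_le_norm_cart[of "\<Xi> m n" d] by (simp add: grid_dir_def)

lemma consts_nonneg: "0 \<le> K" "0 \<le> mb" "0 \<le> \<Lambda>" "0 \<le> quad_const K" "0 \<le> c_plus L c"
proof -
  have x: "(1 / 2) *\<^sub>R L \<in> box 0 L" using L by (simp add: mem_box_cart)
  then have "((1 / 2) *\<^sub>R L, sph_dir 0 0) \<in> phase_space L" by (simp add: phase_space_def)
  then show K: "0 \<le> K" using K_nonneg[of 0 "(1 / 2) *\<^sub>R L" "sph_dir 0 0"] T by simp
  show "0 \<le> mb" using mu_nonneg[OF x] mb(1)[OF x] by linarith
  show "0 \<le> c_plus L c" using c_le[OF x] by linarith
  show "0 \<le> quad_const K" using K sup_theta(2) sup_phi(2) by (simp add: quad_const_def)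
  show "0 \<le> \<Lambda>"
    using ratio h_pos[of 1] h_pos[of 2] h_pos[of 3] dt by (metis add_pos_pos less_imp_le zero_less_mult_pos2)
qed

lemma trunc_nonneg: "0 \<le> trunc_const \<Lambda>"
  using consts_nonneg by (simp add: trunc_const_def)

section \<open>One-step estimates: stability of transport and scattering, and consistency\<close>

lemma A_Delta_contraction:
  assumes z: "(X i j l, \<Xi> m n) \<in> phase_space L"
    and E: "\<And>i j l m n. grid_dom i j l m n \<Longrightarrow> \<bar>v i j l m n\<bar> \<le> E"
  shows "\<bar>v i j l m n + c (X i j l) * dt * A_Delta L M Mt Mp v i j l m n\<bar> \<le> E"
proof -
  let ?x = "X i j l" and ?\<xi> = "\<Xi> m n"
  have x: "?x \<in> box 0 L" using z by (simp add: phase_space_def)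
  have "c ?x * dt * (\<bar>?\<xi>$d\<bar> / h$d) \<le> c_plus L c * dt / h$d" for d
  proof -
    have "c ?x * dt * (\<bar>?\<xi>$d\<bar> / h$d) \<le> c_plus L c * dt * (1 / h$d)"
      using c_le[OF x] dt h_pos[of d] comp_le_1[of m n d] by (intro mult_mono divide_right_mono) auto
    then show ?thesis by simp
  qed
  from this[of 1] this[of 2] this[of 3] CFL
  have CFL': "c ?x * dt * (\<bar>?\<xi>$1\<bar> / h$1 + \<bar>?\<xi>$2\<bar> / h$2 + \<bar>?\<xi>$3\<bar> / h$3) \<le> 1"
    by (simp only: distrib_left)
  show ?thesis
    unfolding A_Delta_upwind Let_def
  proof (rule upwind_contraction[OF _ _ _ _ CFL'])
    show "\<bar>v i j l m n\<bar> \<le> E" using z E by blast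
    show "\<bar>v (i - upwind_shift (?\<xi>$1)) j l m n\<bar> \<le> E" if "\<bar>?\<xi>$1\<bar> / h$1 \<noteq> 0"
      using neighbour[OF z, of 1] that by (intro E) (simp add: X_shift)
    show "\<bar>v i (j - upwind_shift (?\<xi>$2)) l m n\<bar> \<le> E" if "\<bar>?\<xi>$2\<bar> / h$2 \<noteq> 0"
      using neighbour[OF z, of 2] that by (intro E) (simp add: X_shift)
    show "\<bar>v i j (l - upwind_shift (?\<xi>$3)) m n\<bar> \<le> E" if "\<bar>?\<xi>$3\<bar> / h$3 \<noteq> 0"
      using neighbour[OF z, of 3] that by (intro E) (simp add: X_shift)
  qed (use h_pos dt c_le[OF x] in \<open>auto simp: less_imp_le\<close>)
qed

text \<open>The quadrature weights are nonnegative, since the kernel is and sin \<theta> is at the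
  polar nodes, so the maximum of \<open>v\<close> can be pulled out and only the total weight
  matters.\<close>

lemma K_Delta_bound:
  assumes z: "(X i j l, \<Xi> m n) \<in> phase_space L"
    and E: "\<And>i j l m n. grid_dom i j l m n \<Longrightarrow> \<bar>v i j l m n\<bar> \<le> E"
  shows "\<bar>K_Delta L M Mt Mp \<mu>s pt v i j l m n\<bar> \<le> (\<mu>s (X i j l) + \<mu>a (X i j l)) * E"
proof -
  let ?x = "X i j l" and ?\<xi> = "\<Xi> m n"
  have x: "?x \<in> box 0 L" using z by (simp add: phase_space_def)
  have dom: "grid_dom i j l i' j'" for i' j'
    using x sph_dir_in_S2 by (simp add: phase_space_def grid_dir_def)
  have E0: "0 \<le> E" using E[OF dom[of 0 0]] by linarith
  let ?w = "\<lambda>i' j'. kernel pt ?x ?\<xi> (\<Xi> i' j') * sin (of_int i' * dtheta Mt)"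
  have w0: "0 \<le> ?w i' j'" if "i' \<in> {1..int Mt - 1}" for i' j'
  proof -
    have "of_int i' * dtheta Mt \<le> pi"
    proof -
      have "of_int i' * pi \<le> real Mt * pi" using that by (intro mult_right_mono) auto
      then show ?thesis using Mt by (simp add: dtheta_def field_simps)
    qed
    then have "0 \<le> sin (of_int i' * dtheta Mt)"
      using that Mt by (intro sin_ge_zero) (auto simp: dtheta_def)
    then show ?thesis using kernel_nonneg[OF x] by simp
  qed
  have "\<bar>\<Sum>i'=1..int Mt - 1. \<Sum>j'=0..int Mp - 1. ?w i' j' * v i j l i' j'\<bar>
      \<le> (\<Sum>i'=1..int Mt - 1. \<Sum>j'=0..int Mp - 1. ?w i' j' * E)"
  proof (intro order_trans[OF sum_abs] sum_mono)
    fix i' j' assume i': "i' \<in> {1..int Mt - 1}"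
    show "\<bar>?w i' j' * v i j l i' j'\<bar> \<le> ?w i' j' * E"
      unfolding abs_mult[of "?w i' j'"] abs_of_nonneg[OF w0[OF i']]
      by (intro mult_left_mono w0[OF i'] E[OF dom])
  qed
  also have "\<dots> = (\<Sum>i'=1..int Mt - 1. \<Sum>j'=0..int Mp - 1. ?w i' j') * E"
    by (simp only: sum_distrib_right)
  finally have 1: "\<bar>\<Sum>i'=1..int Mt - 1. \<Sum>j'=0..int Mp - 1. ?w i' j' * v i j l i' j'\<bar>
      \<le> (\<Sum>i'=1..int Mt - 1. \<Sum>j'=0..int Mp - 1. ?w i' j') * E" .
  have pos: "0 \<le> \<mu>s ?x * dtheta Mt * dphi Mp" using mu_nonneg[OF x] by (simp add: dtheta_def dphi_def)
  have "\<bar>K_Delta L M Mt Mp \<mu>s pt v i j l m n\<bar> =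
      \<mu>s ?x * dtheta Mt * dphi Mp * \<bar>\<Sum>i'=1..int Mt - 1. \<Sum>j'=0..int Mp - 1. ?w i' j' * v i j l i' j'\<bar>"
    unfolding K_Delta_def abs_mult[of "\<mu>s ?x * dtheta Mt * dphi Mp"] using pos by simp
  also have "\<dots> \<le> \<mu>s ?x * dtheta Mt * dphi Mp * ((\<Sum>i'=1..int Mt - 1. \<Sum>j'=0..int Mp - 1. ?w i' j') * E)"
    by (rule mult_left_mono[OF 1 pos])
  also have "\<dots> = \<mu>s ?x * (dtheta Mt * dphi Mp * (\<Sum>i'=1..int Mt - 1. \<Sum>j'=0..int Mp - 1. ?w i' j')) * E"
    by (simp only: mult.assoc)
  also have "\<dots> \<le> \<mu>s ?x * (1 + mu_star L \<mu>a \<mu>s) * E"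
  proof (intro mult_right_mono mult_left_mono E0)
    \<comment> \<open>The factor 6 / pi^2 of the angular condition cancels the pi^2 / 6 of
      \<open>quadrature_2d\<close>.\<close>
    have "pi\<^sup>2 / 6 * (A * (dtheta Mt)\<^sup>2 + B * ((dphi Mp)\<^sup>2 / 2)) \<le> pi\<^sup>2 / 6 * (6 / pi\<^sup>2 * mu_star L \<mu>a \<mu>s)"
      by (rule mult_left_mono[OF angle]) simp
    also have "\<dots> = mu_star L \<mu>a \<mu>s" by simp
    finally show "dtheta Mt * dphi Mp * (\<Sum>i'=1..int Mt - 1. \<Sum>j'=0..int Mp - 1. ?w i' j') \<le> 1 + mu_star L \<mu>a \<mu>s"
      using sum_kernel_le[OF x Mt Mp, of "of_int m * dtheta Mt" "of_int n * dphi Mp"]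
      unfolding grid_dir_def by linarith
  qed (use mu_nonneg[OF x] in auto)
  also have "\<dots> \<le> (\<mu>s ?x + \<mu>a ?x) * E"
    by (intro mult_right_mono E0 mu_star_le[OF coefficients x])
  finally show ?thesis .
qed

text \<open>The equation at time t_k is subtracted from the scheme applied to the exact solution.
  The source cancels because both evaluate it at the same time and point; the remaining defects
  \<open>r1\<close> to \<open>r4\<close> are estimated separately.\<close>

lemma truncation:
  assumes z: "(X i j l, \<Xi> m n) \<in> phase_space L" and k: "real k \<le> T / dt - 1"
  shows "\<bar>U (Suc k) i j l m n - U k i j l m n - c (X i j l) * dt *
    (A_Delta L M Mt Mp (U k) i j l m n - Sigma_Delta L M \<mu>a \<mu>s (U (Suc k)) i j l m n
     + K_Delta L M Mt Mp \<mu>s pt (U k) i j l m n + q (real k * dt) (X i j l) (\<Xi> m n))\<bar>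
    \<le> dt * (trunc_const \<Lambda> * \<delta>)"
proof -
  let ?x = "X i j l" and ?\<xi> = "\<Xi> m n" and ?t = "real k * dt"
  let ?I = "I ?t ?x ?\<xi>" and ?I' = "I (?t + dt) ?x ?\<xi>"
  let ?AU = "A_Delta L M Mt Mp (U k) i j l m n" and ?KU = "K_Delta L M Mt Mp \<mu>s pt (U k) i j l m n"
  let ?q = "q ?t ?x ?\<xi>" and ?a = "(dtheta Mt)\<^sup>2 + (dphi Mp)\<^sup>2"
  define S where "S = (\<integral>\<xi>'. kernel pt ?x ?\<xi> \<xi>' * I ?t ?x \<xi>' \<partial>sphere_measure)"
  have x: "?x \<in> box 0 L" using z by (simp add: phase_space_def)
  have tT: "?t + dt \<le> T" using k dt by (simp add: field_simps)
  then have t: "?t \<in> {0..<T}" using dt by auto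
  obtain I_t g where g: "((\<lambda>s. I s ?x ?\<xi>) has_real_derivative I_t) (at ?t within {0..<T})"
      "GDERIV (\<lambda>y. I ?t y ?\<xi>) ?x :> g"
      "1 / c ?x * I_t = - (?\<xi> \<bullet> g) - (\<mu>a ?x + \<mu>s ?x) * ?I + \<mu>s ?x * S + ?q"
    and lim: "((\<lambda>t. I t ?x ?\<xi>) \<longlongrightarrow> I T ?x ?\<xi>) (at_left T)"
    using solves t z unfolding solves_P3_def S_def by blast
  have cx: "0 < c ?x" "c ?x \<le> c_plus L c" using c_le[OF x] by auto
  have mu: "0 \<le> \<mu>a ?x" "0 \<le> \<mu>s ?x" "\<mu>a ?x \<le> mb" "\<mu>s ?x \<le> mb" using mu_nonneg[OF x] mb x by auto
  note K0 = consts_nonneg(1) and \<Lambda>0 = consts_nonneg(3) and Q0 = consts_nonneg(4)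
  have U: "U k i j l m n = ?I" "U (Suc k) i j l m n = ?I'" by (simp_all add: U_def algebra_simps)
  note time = time_step[OF _ dt tT z g(1) lim]
  have r1: "\<bar>?I' - ?I - dt * I_t\<bar> \<le> dt * (K * dt)" and r1': "\<bar>?I' - ?I\<bar> \<le> K * dt"
    using time dt by (simp_all add: power2_eq_square mult_ac)
  have r2: "\<bar>?AU + ?\<xi> \<bullet> g\<bar> \<le> K * \<Lambda> * dt"
  proof -
    have *: "\<bar>\<bar>?\<xi> $ d\<bar> / h $ d * (I ?t (?x - (h $ d * sgn (?\<xi> $ d)) *\<^sub>R axis d 1) ?\<xi> - ?I) + ?\<xi> $ d * g $ d\<bar> \<le> K * h $ d" for d
      by (rule space_step[OF t z g(2) h_pos grid_gap[OF x]])
    have "?AU + ?\<xi> \<bullet> g = (\<Sum>d\<in>UNIV. \<bar>?\<xi> $ d\<bar> / h $ d * (I ?t (?x - (h $ d * sgn (?\<xi> $ d)) *\<^sub>R axis d 1) ?\<xi> - ?I) + ?\<xi> $ d * g $ d)"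
      by (simp add: A_Delta_upwind Let_def U_def X_shift inner_vec_def sum_3)
    also have "\<bar>\<dots>\<bar> \<le> (\<Sum>d\<in>UNIV. K * h $ d)" by (intro order_trans[OF sum_abs] sum_mono *)
    also have "\<dots> = K * \<Lambda> * dt" using ratio by (simp add: sum_3 mult.assoc flip: distrib_left)
    finally show ?thesis .
  qed
  have r3: "\<bar>\<mu>s ?x * S - ?KU\<bar> \<le> mb * (quad_const K * ?a)"
  proof -
    define R where "R = dtheta Mt * dphi Mp * (\<Sum>i'=1..int Mt - 1. \<Sum>j'=0..int Mp - 1.
      kernel pt ?x ?\<xi> (\<Xi> i' j') * sin (of_int i' * dtheta Mt) * I ?t ?x (\<Xi> i' j'))"
    have "\<bar>S - R\<bar> \<le> quad_const K * ?a"
      unfolding S_def R_def grid_dir_def[of Mt Mp m n]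
      by (rule scattering_quadrature[OF x Mt Mp K0 solution_continuous[OF t x] solution_theta[OF t x] solution_phi[OF t x]])
    then have "\<mu>s ?x * \<bar>S - R\<bar> \<le> mb * (quad_const K * ?a)" using mu by (intro mult_mono) auto
    moreover have "\<mu>s ?x * S - ?KU = \<mu>s ?x * (S - R)"
      by (simp add: R_def K_Delta_def U_def right_diff_distrib mult.assoc)
    ultimately show ?thesis using mu by (simp add: abs_mult)
  qed
  have r4: "\<bar>(\<mu>s ?x + \<mu>a ?x) * (?I' - ?I)\<bar> \<le> 2 * mb * K * dt"
  proof -
    have "\<bar>(\<mu>s ?x + \<mu>a ?x) * (?I' - ?I)\<bar> \<le> (2 * mb) * (K * dt)"
      unfolding abs_mult by (rule mult_mono) (use r1' mu in auto)
    then show ?thesis by (simp add: mult_ac)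
  qed
  \<comment> \<open>Defect of the bracket on the right-hand side of the scheme: upwind difference
    against -\<xi> \<bullet> grad I, absorption at the new against the old time, and scattering
    integral against its sum.\<close>
  let ?r = "- (?AU + ?\<xi> \<bullet> g) + (\<mu>s ?x + \<mu>a ?x) * (?I' - ?I) + (\<mu>s ?x * S - ?KU)"
  have It: "I_t = c ?x * (- (?\<xi> \<bullet> g) - (\<mu>a ?x + \<mu>s ?x) * ?I + \<mu>s ?x * S + ?q)"
    using g(3) cx(1) by (simp add: field_simps)
  have "\<bar>?r\<bar> \<le> K * \<Lambda> * dt + 2 * mb * K * dt + mb * (quad_const K * ?a)"
    using r2 r3 r4 by linarith
  also have "\<dots> \<le> K * \<Lambda> * \<delta> + 2 * mb * K * \<delta> + mb * (quad_const K * \<delta>)"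
    using K0 \<Lambda>0 mu Q0 dt by (intro add_mono mult_left_mono) (auto simp: \<delta>_def)
  also have "\<dots> = (K * \<Lambda> + 2 * mb * K + mb * quad_const K) * \<delta>" by (simp add: algebra_simps)
  finally have "c ?x * \<bar>?r\<bar> \<le> c_plus L c * ((K * \<Lambda> + 2 * mb * K + mb * quad_const K) * \<delta>)"
    using cx by (intro mult_mono) auto
  moreover have "K * dt \<le> K * \<delta>" using K0 by (intro mult_left_mono) (auto simp: \<delta>_def)
  ultimately have "K * dt + c ?x * \<bar>?r\<bar> \<le> trunc_const \<Lambda> * \<delta>"
    by (simp add: trunc_const_def distrib_right mult.assoc)
  then have "dt * (K * dt + c ?x * \<bar>?r\<bar>) \<le> dt * (trunc_const \<Lambda> * \<delta>)"
    using dt by (intro mult_left_mono) auto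
  moreover have "\<bar>c ?x * dt * ?r\<bar> = dt * (c ?x * \<bar>?r\<bar>)" using cx(1) dt by (simp add: abs_mult)
  moreover have "?I' - ?I - c ?x * dt * (?AU - Sigma_Delta L M \<mu>a \<mu>s (U (Suc k)) i j l m n + ?KU + ?q)
      = (?I' - ?I - dt * I_t) + c ?x * dt * ?r"
    unfolding It Sigma_Delta_def U by (simp add: algebra_simps)
  ultimately show ?thesis unfolding U using r1 by (simp only: distrib_left)
qed

text \<open>By linearity the error satisfies the scheme with the truncation error \<open>r\<close>
  as source. The old error contributes at most (1 + g s) E, with g = c \<Delta>t and s = \<mu>s +
  \<mu>a, which matches the implicit factor on the left, so dividing by it leaves E without
  amplification.\<close>

lemma err_step:
  assumes z: "(X i j l, \<Xi> m n) \<in> phase_space L" and k: "real k \<le> T / dt - 1"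
    and E: "\<And>i j l m n. grid_dom i j l m n \<Longrightarrow> \<bar>err k i j l m n\<bar> \<le> E"
  shows "\<bar>err (Suc k) i j l m n\<bar> \<le> E + dt * (trunc_const \<Lambda> * \<delta>)"
proof -
  let ?x = "X i j l" and ?R = "dt * (trunc_const \<Lambda> * \<delta>)"
  let ?A = "\<lambda>v. A_Delta L M Mt Mp v i j l m n" and ?K = "\<lambda>v. K_Delta L M Mt Mp \<mu>s pt v i j l m n"
  let ?q = "q (real k * dt) ?x (\<Xi> m n)" and ?s = "\<mu>s ?x + \<mu>a ?x" and ?g = "c ?x * dt"
  have x: "?x \<in> box 0 L" using z by (simp add: phase_space_def)
  have g0: "0 < ?g" using c_le[OF x] dt by simp
  have s0: "0 \<le> ?s" using mu_nonneg[OF x] by simp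
  have "1 / c ?x * ((u (Suc k) i j l m n - u k i j l m n) / dt) =
      ?A (u k) - ?s * u (Suc k) i j l m n + ?K (u k) + ?q"
    using scheme z k unfolding upwind_scheme_def Sigma_Delta_def by blast
  then have 1: "u (Suc k) i j l m n - u k i j l m n = ?g * (?A (u k) - ?s * u (Suc k) i j l m n + ?K (u k) + ?q)"
    using c_le[OF x] dt by (simp add: field_simps)
  have A: "?A (err k) = ?A (U k) - ?A (u k)"
    by (simp add: A_Delta_upwind Let_def err_def algebra_simps)
  have Kd: "?K (err k) = ?K (U k) - ?K (u k)"
    unfolding K_Delta_def err_def by (simp only: right_diff_distrib sum_subtractf)
  define r where "r = U (Suc k) i j l m n - U k i j l m n -
    ?g * (?A (U k) - ?s * U (Suc k) i j l m n + ?K (U k) + ?q)"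
  have r: "\<bar>r\<bar> \<le> ?R" using truncation[OF z k] by (simp add: r_def Sigma_Delta_def)
  have "(1 + ?g * ?s) * err (Suc k) i j l m n = (err k i j l m n + ?g * ?A (err k)) + ?g * ?K (err k) + r"
    using 1 unfolding A Kd r_def by (simp add: err_def algebra_simps)
  moreover have "\<bar>err k i j l m n + ?g * ?A (err k)\<bar> \<le> E"
    using A_Delta_contraction[OF z E] .
  moreover have "\<bar>?g * ?K (err k)\<bar> \<le> ?g * (?s * E)"
  proof -
    have "\<bar>?K (err k)\<bar> \<le> ?s * E" by (rule K_Delta_bound[OF z E])
    then show ?thesis unfolding abs_mult[of ?g] abs_of_pos[OF g0] using g0 by (intro mult_left_mono) auto
  qed
  ultimately have "\<bar>(1 + ?g * ?s) * err (Suc k) i j l m n\<bar> \<le> E + ?g * (?s * E) + ?R"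
    using r by linarith
  also have "\<dots> \<le> (1 + ?g * ?s) * (E + ?R)"
  proof -
    have "0 \<le> ?R" using r by linarith
    with g0 s0 have "0 \<le> ?g * ?s * ?R" by (meson less_imp_le mult_nonneg_nonneg)
    then show ?thesis by (simp add: algebra_simps)
  qed
  finally have "(1 + ?g * ?s) * \<bar>err (Suc k) i j l m n\<bar> \<le> (1 + ?g * ?s) * (E + ?R)"
    using g0 s0 by (simp add: abs_mult)
  moreover have "0 < 1 + ?g * ?s" using g0 s0 by (intro add_pos_nonneg) auto
  ultimately show ?thesis by (simp only: mult_le_cancel_left_pos)
qed

text \<open>Before \<open>T\<close> both sides take the boundary value. If k \<Delta>t = T, the
  exact value is a left limit and the boundary condition there comes from \<open>final\<close>,
  which applies because T / \<Delta>t = k is then an integer.\<close>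

lemma err_inflow:
  assumes z: "(X i j l, \<Xi> m n) \<in> inflow L" and k: "real k \<le> T / dt"
  shows "err k i j l m n = 0"
proof -
  have "u k i j l m n = I1 (real k * dt) (X i j l) (\<Xi> m n)"
    using scheme z k unfolding upwind_scheme_def by blast
  moreover have "I (real k * dt) (X i j l) (\<Xi> m n) = I1 (real k * dt) (X i j l) (\<Xi> m n)"
  proof (cases "real k * dt < T")
    case True
    then have "real k * dt \<in> {0..<T}" using dt by simp
    then show ?thesis using solves z unfolding solves_P3_def by blast
  next
    case False
    then have kT: "real k * dt = T" using k dt by (simp add: field_simps)
    then have "T / dt = real k" using dt by (simp add: field_simps)
    then have "T / dt \<in> \<int>" by simp
    then show ?thesis unfolding kT using z by (rule final)
  qed
  ultimately show ?thesis by (simp add: err_def U_def)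
qed

lemma error_bound:
  assumes "real k \<le> T / dt" "grid_dom i j l m n"
  shows "\<bar>err k i j l m n\<bar> \<le> real k * (dt * (trunc_const \<Lambda> * \<delta>))"
  using assms
proof (induction k arbitrary: i j l m n)
  case 0
  show ?case
  proof (cases "(X i j l, \<Xi> m n) \<in> inflow L")
    case False
    then have z: "(X i j l, \<Xi> m n) \<in> phase_space L" using 0 by blast
    then have "u 0 i j l m n = I0 (X i j l) (\<Xi> m n)"
      using scheme unfolding upwind_scheme_def by blast
    moreover have "I 0 (X i j l) (\<Xi> m n) = I0 (X i j l) (\<Xi> m n)"
      using solves z unfolding solves_P3_def by blast
    ultimately show ?thesis by (simp add: err_def U_def)
  qed (use err_inflow[of i j l m n 0] T dt in simp)
next
  case (Suc k)
  have k: "real k \<le> T / dt - 1" "real k \<le> T / dt" using Suc.prems(1) by auto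
  have IH: "\<bar>err k i j l m n\<bar> \<le> real k * (dt * (trunc_const \<Lambda> * \<delta>))" if "grid_dom i j l m n" for i j l m n
    using Suc.IH[OF k(2) that] .
  show ?case
  proof (cases "(X i j l, \<Xi> m n) \<in> phase_space L")
    case True
    then show ?thesis using err_step[OF True k(1) IH] by (simp add: algebra_simps)
  next
    case False
    then have "err (Suc k) i j l m n = 0" using err_inflow Suc.prems by blast
    moreover have "0 \<le> real (Suc k) * (dt * (trunc_const \<Lambda> * \<delta>))"
      using trunc_nonneg dt by (intro mult_nonneg_nonneg) (auto simp: \<delta>_def)
    ultimately show ?thesis by simp
  qed
qed

lemma error_norm_bound:
  assumes k: "real k \<le> T / dt"
  shows "error_norm L M Mt Mp (I (real k * dt)) (u k) \<le> ennreal (T * trunc_const \<Lambda> * \<delta>)"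
  unfolding error_norm_def
proof (rule SUP_least, clarify)
  fix i j l m n assume "grid_dom i j l m n"
  then have "\<bar>err k i j l m n\<bar> \<le> real k * (dt * (trunc_const \<Lambda> * \<delta>))" by (rule error_bound[OF k])
  also have "\<dots> = (real k * dt) * (trunc_const \<Lambda> * \<delta>)" by simp
  also have "\<dots> \<le> T * (trunc_const \<Lambda> * \<delta>)"
    using k dt trunc_nonneg by (intro mult_right_mono) (auto simp: field_simps \<delta>_def)
  finally show "ennreal \<bar>I (real k * dt) (X i j l) (\<Xi> m n) - u k i j l m n\<bar> \<le> ennreal (T * trunc_const \<Lambda> * \<delta>)"
    by (intro ennreal_leI) (simp add: err_def U_def mult.assoc)
qed

end

theorem theorem5p2:
  fixes L lam :: "real^3" and T :: real
    and c \<mu>a \<mu>s :: "real^3 \<Rightarrow> real"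
    and pt :: "real^3 \<Rightarrow> real \<Rightarrow> real"
    and q I1 I :: "real \<Rightarrow> real^3 \<Rightarrow> real^3 \<Rightarrow> real"
    and I0 :: "real^3 \<Rightarrow> real^3 \<Rightarrow> real"
  assumes "T > 0" and "\<forall>i. L $ i > 0"
    and "coefficients L c \<mu>a \<mu>s"
    and "phase_function L pt"
    and "inputs L T q I0 I1"
    and "bounded (\<mu>a ` box 0 L)" and "bounded (\<mu>s ` box 0 L)"
    and "solves_P3 L T c \<mu>a \<mu>s pt q I0 I1 I"
    and "C2_bounded_solution L T I"
  shows "\<exists>C>0. \<forall>(M :: nat^3) (Mt :: nat) (Mp :: nat) (dt :: real) (u :: nat \<Rightarrow> grid_fun).
    (\<forall>i. M $ i > 0) \<and> Mt > 0 \<and> Mp > 0 \<and> dt > 0 \<and>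
    (\<forall>i. dt / dx L M $ i = lam $ i) \<and>
    c_plus L c * dt / dx L M $ 1 + c_plus L c * dt / dx L M $ 2 + c_plus L c * dt / dx L M $ 3 \<le> 1 \<and>
    ennreal ((dtheta Mt)\<^sup>2) * sup_theta L pt + ennreal ((dphi Mp)\<^sup>2 / 2) * sup_phi L pt
      \<le> ennreal (6 / pi\<^sup>2 * mu_star L \<mu>a \<mu>s) \<and>
    (T / dt \<in> \<int> \<longrightarrow> (\<forall>(x, \<xi>)\<in>inflow L. I T x \<xi> = I1 T x \<xi>)) \<and>
    upwind_scheme L T c \<mu>a \<mu>s pt q I0 I1 M Mt Mp dt u \<longrightarrow>
    (\<forall>k. real k \<le> T / dt \<longrightarrow>
       error_norm L M Mt Mp (I (real k * dt)) (u k)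
         \<le> ennreal (C * (dt + (dtheta Mt)\<^sup>2 + (dphi Mp)\<^sup>2)))"
proof (cases "sup_theta L pt = top \<or> sup_phi L pt = top")
  \<comment> \<open>An infinite supremum, multiplied by a positive mesh width, violates the angular
    condition, whose right side is a real number. No mesh is admissible and any constant
    serves.\<close>
  case True
  have "\<not> ennreal ((dtheta Mt)\<^sup>2) * sup_theta L pt + ennreal ((dphi Mp)\<^sup>2 / 2) * sup_phi L pt
      \<le> ennreal (6 / pi\<^sup>2 * mu_star L \<mu>a \<mu>s)" if "Mt > 0" "Mp > 0" for Mt Mp
  proof -
    have "ennreal ((dtheta Mt)\<^sup>2) \<noteq> 0" "ennreal ((dphi Mp)\<^sup>2 / 2) \<noteq> 0"
      using that by (simp_all add: dtheta_def dphi_def)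
    then have "ennreal ((dtheta Mt)\<^sup>2) * sup_theta L pt + ennreal ((dphi Mp)\<^sup>2 / 2) * sup_phi L pt = top"
      using True by (auto simp: ennreal_mult_top ennreal_add_eq_top)
    then show ?thesis by (metis ennreal_neq_top top_unique)
  qed
  then show ?thesis by (intro exI[of _ 1]) auto
next
  case False
  define A B where "A = enn2real (sup_theta L pt)" and "B = enn2real (sup_phi L pt)"
  have A: "sup_theta L pt = ennreal A" "A \<ge> 0" and B: "sup_phi L pt = ennreal B" "B \<ge> 0"
    using False by (auto simp: A_def B_def ennreal_enn2real_if)
  have mu: "0 < mu_star L \<mu>a \<mu>s" using assms(3) by (simp add: coefficients_def)
  let ?S = "{0..<T} \<times> (phase_space L \<union> inflow L)"
  obtain J' J'' where J: "C2_on {(t, x, y). y \<noteq> 0 \<and> (t, x, sgn y) \<in> ?S} (\<lambda>(t, x, y). I t x (sgn y)) J' J''"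
      "bounded ((\<lambda>(t, x, \<xi>). I t x \<xi>) ` ?S)" "bounded (J' ` ?S)" "bounded (J'' ` ?S)"
    using assms(9) unfolding C2_bounded_solution_def Let_def by blast
  obtain K0 K1 K2 where K: "\<forall>z\<in>?S. norm ((\<lambda>(t, x, \<xi>). I t x \<xi>) z) \<le> K0"
      "\<forall>z\<in>?S. norm (J' z) \<le> K1" "\<forall>z\<in>?S. norm (J'' z) \<le> K2"
    using J(2-4) unfolding bounded_iff ball_simps by blast
  obtain ma ms where ms: "\<forall>x\<in>box 0 L. norm (\<mu>a x) \<le> ma" "\<forall>x\<in>box 0 L. norm (\<mu>s x) \<le> ms"
    using assms(6,7) unfolding bounded_iff ball_simps by blast
  define K where "K = max K0 (max K1 K2)"
  define mb where "mb = max ma ms"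
  interpret transport_problem L T I J' J'' K pt A B c \<mu>a \<mu>s q I1 I0 mb
  proof unfold_locales
    show "\<bar>I t x \<xi>\<bar> \<le> K \<and> norm (J' (t, x, \<xi>)) \<le> K \<and> norm (J'' (t, x, \<xi>)) \<le> K"
      if "t \<in> {0..<T}" "(x, \<xi>) \<in> phase_space L \<union> inflow L" for t x \<xi>
    proof -
      have "(t, x, \<xi>) \<in> ?S" using that by blast
      then have "\<bar>I t x \<xi>\<bar> \<le> K0" "norm (J' (t, x, \<xi>)) \<le> K1" "norm (J'' (t, x, \<xi>)) \<le> K2"
        using bspec[OF K(1)] bspec[OF K(2)] bspec[OF K(3)] by fastforce+
      then show ?thesis unfolding K_def by (simp add: le_max_iff_disj)
    qed
    show "\<mu>a x \<le> mb" "\<mu>s x \<le> mb" if "x \<in> box 0 L" for x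
      using ms that unfolding mb_def by fastforce+
  qed (use J(1) A B assms in auto)
  \<comment> \<open>Each spatial width is \<Delta>t divided by its mesh ratio, so the three widths
    sum to \<Lambda> \<Delta>t.\<close>
  define \<Lambda> where "\<Lambda> = 1 / lam $ 1 + 1 / lam $ 2 + 1 / lam $ 3"
  \<comment> \<open>The absolute value and the summand 1 merely secure C > 0.\<close>
  define C where "C = \<bar>T * trunc_const \<Lambda>\<bar> + 1"
  show ?thesis
  proof (intro exI[of _ C] conjI allI impI; (elim conjE)?)
    show "C > 0" by (simp add: C_def)
    fix M :: "nat^3" and Mt Mp :: nat and dt :: real and u k
    assume M: "\<forall>i. M $ i > 0" and Mt: "Mt > 0" and Mp: "Mp > 0" and dt: "dt > 0"
      and lam: "\<forall>i. dt / dx L M $ i = lam $ i"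
      and CFL: "c_plus L c * dt / dx L M $ 1 + c_plus L c * dt / dx L M $ 2 + c_plus L c * dt / dx L M $ 3 \<le> 1"
      and angle: "ennreal ((dtheta Mt)\<^sup>2) * sup_theta L pt + ennreal ((dphi Mp)\<^sup>2 / 2) * sup_phi L pt
        \<le> ennreal (6 / pi\<^sup>2 * mu_star L \<mu>a \<mu>s)"
      and final: "T / dt \<in> \<int> \<longrightarrow> (\<forall>(x, \<xi>)\<in>inflow L. I T x \<xi> = I1 T x \<xi>)"
      and scheme: "upwind_scheme L T c \<mu>a \<mu>s pt q I0 I1 M Mt Mp dt u"
      and k: "real k \<le> T / dt"
    have "ennreal ((dtheta Mt)\<^sup>2) * ennreal A = ennreal ((dtheta Mt)\<^sup>2 * A)"
      by (rule ennreal_mult[symmetric]) (use A(2) in auto)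
    moreover have "ennreal ((dphi Mp)\<^sup>2 / 2) * ennreal B = ennreal ((dphi Mp)\<^sup>2 / 2 * B)"
      by (rule ennreal_mult[symmetric]) (use B(2) in auto)
    moreover have "ennreal ((dtheta Mt)\<^sup>2 * A + (dphi Mp)\<^sup>2 / 2 * B)
        = ennreal ((dtheta Mt)\<^sup>2 * A) + ennreal ((dphi Mp)\<^sup>2 / 2 * B)"
      by (rule ennreal_plus) (use A(2) B(2) in auto)
    ultimately have "ennreal ((dtheta Mt)\<^sup>2 * A + (dphi Mp)\<^sup>2 / 2 * B) \<le> ennreal (6 / pi\<^sup>2 * mu_star L \<mu>a \<mu>s)"
      using angle unfolding A(1) B(1) by (simp only:)
    then have angle': "A * (dtheta Mt)\<^sup>2 + B * ((dphi Mp)\<^sup>2 / 2) \<le> 6 / pi\<^sup>2 * mu_star L \<mu>a \<mu>s"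
      using mu by (subst (asm) ennreal_le_iff) (auto simp: mult_ac)
    have "dx L M $ i = 1 / lam $ i * dt" for i
      using lam[rule_format, of i, symmetric] dt by simp
    then have ratio: "dx L M $ 1 + dx L M $ 2 + dx L M $ 3 = \<Lambda> * dt"
      by (simp add: \<Lambda>_def algebra_simps)
    interpret upwind L T I J' J'' K pt A B c \<mu>a \<mu>s q I1 I0 mb M Mt Mp dt \<Lambda> u
      by unfold_locales (use M Mt Mp dt ratio CFL angle' final scheme in auto)
    have "T * trunc_const \<Lambda> * \<delta> \<le> C * \<delta>"
      unfolding C_def using dt by (intro mult_right_mono) (auto simp: \<delta>_def)
    then show "error_norm L M Mt Mp (I (real k * dt)) (u k) \<le> ennreal (C * (dt + (dtheta Mt)\<^sup>2 + (dphi Mp)\<^sup>2))"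
      using error_norm_bound[OF k] unfolding \<delta>_def by (meson ennreal_leI order_trans)
  qed
qed

end
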